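(* Let $k\geq1$ be an integer. For every $c>0$, $$\delta_k(c)=\sum_{(\pi,\sigma)\in\mathfrak J_k}\operatorname{sgn}(\sigma)\int_{\mathbb R_{>0}^{2k}}\delta\!\left(\sum_{i=1}^{k}u_i-c\right)\prod_{\mathcal C\in\operatorname{Cyc}(\sigma)}\mathcal W_{\mathcal C}(\mathbf u,\mathbf v)\,d\mathbf u\,d\mathbf v .$$ Moreover, for every compact $\mathcal K\subset(0,\infty)$, uniformly for $c\in\mathcal K$, with $n=\lfloor cN\rfloor$ and $N\to\infty$, $$I_k(n;N)=\delta_k(c)N^{2k-1}+O_{k,\mathcal K}(N^{2k-2}),$$ with $\delta_k(c)$ given by the displayed sum.
   Context: For integers $k,n,N\ge 1$, $$I_k(n;N):=\int_{U(N)}\Bigl|\sum_{\substack{j_1,\ldots,j_k\geq1\\ j_1+\cdots+j_k=n}}\operatorname{Tr}(U^{j_1})\cdots\operatorname{Tr}(U^{j_k})\Bigr|^2dU,$$ where $dU$ is the normalised Haar probability measure on the unitary group $U(N)$. The function $\delta_k$ is defined by $\delta_k(c):=\lim_{N\to\infty} I_k(\lfloor cN\rfloor;N)/N^{2k-1}$ for $c>0$ whenever the limit exists. Let $\mathbf u=(u_1,\ldots,u_k)$, $\mathbf v=(v_1,\ldots,v_k)$ and $\Omega_k:=\{1^+,\ldots,k^+\}\cup\{1^-,\ldots,k^-\}$ (two disjoint labelled copies of $\{1,\dots,k\}$). Let $\Pi(\Omega_k)$ be the set of set partitions of $\Omega_k$, and for $\pi\in\Pi(\Omega_k)$ let $\mathfrak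 S(\pi)$ be the group of permutations of the blocks of $\pi$. Put $$\mathfrak J_k:=\{(\pi,\sigma):\pi\in\Pi(\Omega_k),\ \sigma\in\mathfrak S(\pi)\}.$$ For a block $B\in\pi$ put $B^+:=\{i:i^+\in B\}$, $B^-:=\{j:j^-\in B\}$ and $$d_B(\mathbf u,\mathbf v):=\sum_{i\in B^+}u_i-\sum_{j\in B^-}v_j .$$ $\operatorname{Cyc}(\sigma)$ is the set of cycles (including fixed points) in the disjoint cycle decomposition of $\sigma$. For $\mathcal C=(B_1,\ldots,B_\ell)\in\operatorname{Cyc}(\sigma)$, with $\sigma(B_j)=B_{j+1}$ for $1\le j<\ell$ and $\sigma(B_\ell)=B_1$, define $$D_{\mathcal C,0}:=0,\qquad D_{\mathcal C,j}:=\sum_{a=1}^{j}d_{B_a}(\mathbf u,\mathbf v)\quad(1\le j\le\ell),$$ $$\omega_{\mathcal C}(\mathbf u,\mathbf v):=\max_{0\leq j<\ell}D_{\mathcal C,j}-\min_{0\leq j<\ell}D_{\mathcal C,j},\qquad \mathcal W_{\mathcal C}(\mathbf u,\mathbf v):=\delta\!\left(D_{\mathcal C,\ell}\right)\bigl(1-\omega_{\mathcal C}(\mathbf u,\mathbf v)\bigr)_+,$$ where $t_+=\max(t,0)$ and $\delta(\cdot)$ is the Dirac delta distribution. On the set $D_{\mathcal C,\ell}=0$, $\omega_{\mathcal C}$ does not depend on the choice of initial block $B_1$. Meaning of the integrals: if some cycle of $\sigma$ has only $+$ labels or only $-$ labels in the union of its blocks, then $D_{\mathcal C,\ell}=0$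 has no solution with all variables positive and the integral is $0$. Otherwise let $\mathcal C_1,\dots,\mathcal C_s$ be the cycles; the delta factors are used to eliminate one variable $v_{j_a}$ for each cycle $\mathcal C_a$ (with $j_a^-$ belonging to a block of $\mathcal C_a$) via $D_{\mathcal C_a,|\mathcal C_a|}=0$, and one variable $u_{i}$ via $\sum_i u_i=c$; one then integrates the remaining factors $\prod_a(1-\omega_{\mathcal C_a})_+$ with Lebesgue measure in the remaining $2k-s-1$ variables over the set where all $2k$ variables are positive (if $2k-s-1=0$ this is evaluation at the single point). The result does not depend on the choice of eliminated variables. The notation $O_{k,\mathcal K}$ means the implied constant depends only on $k$ and $\mathcal K$. *)

theory Defs
  imports
    "HOL-Analysis.Analysis"
    "HOL-Probability.Probability_Measure"
    "HOL-Combinatorics.Combinatorics"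
    "HOL-Library.Disjoint_Sets"
    "Jordan_Normal_Form.Schur_Decomposition"
begin

section \<open>Haar measure on the unitary group\<close>

text \<open>The matrix size has to be a value and not a type, since the statement lets it tend to
  infinity; hence matrices from \<^theory>\<open>Jordan_Normal_Form.Matrix\<close>. That type carries no topology,
  so the Borel sigma-algebra of the unitary group is pulled back along the embedding
  into the product of \<open>N * N\<close> copies of the complex numbers.\<close>

definition unitary_group :: "nat \<Rightarrow> complex mat set" where
  "unitary_group N = {U \<in> carrier_mat N N. U * mat_adjoint U = 1\<^sub>m N \<and> mat_adjoint U * U = 1\<^sub>m N}"

definition borel_unitary :: "nat \<Rightarrow> complex mat measure" where
  "borel_unitary N = vimage_algebra (unitary_group N)
     (\<lambda>U. \<lambda>ij\<in>{..<N} \<times> {..<N}. U $$ ij) (PiM ({..<N} \<times> {..<N}) (\<lambda>_. borel))"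

text \<open>A left-invariant Borel probability measure. For each \<open>N \<ge> 1\<close> there is exactly one.\<close>

definition haar_unitary :: "nat \<Rightarrow> complex mat measure \<Rightarrow> bool" where
  "haar_unitary N M \<longleftrightarrow> prob_space M \<and> sets M = sets (borel_unitary N) \<and>
     (\<forall>V\<in>unitary_group N. distr M M (\<lambda>U. V * U) = M)"

definition mat_trace :: "'a::comm_monoid_add mat \<Rightarrow> 'a" where
  "mat_trace A = (\<Sum>i<dim_row A. A $$ (i, i))"

section \<open>The matrix integral and its scaling limit\<close>

text \<open>Ordered tuples \<open>(j\<^sub>1, \<dots>, j\<^sub>k)\<close> of positive integers with sum \<open>n\<close>.\<close>

definition compositions :: "nat \<Rightarrow> nat \<Rightarrow> (nat \<Rightarrow> nat) set" where
  "compositions k n = {j \<in> {1..k} \<rightarrow>\<^sub>E {1..}. (\<Sum>i=1..k. j i) = n}"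

definition I_int :: "(nat \<Rightarrow> complex mat measure) \<Rightarrow> nat \<Rightarrow> nat \<Rightarrow> nat \<Rightarrow> real" where
  "I_int \<mu> k n N =
     (LINT U|\<mu> N. (cmod (\<Sum>j\<in>compositions k n. \<Prod>i=1..k. mat_trace (U ^\<^sub>m j i)))\<^sup>2)"

definition scaled_I :: "(nat \<Rightarrow> complex mat measure) \<Rightarrow> nat \<Rightarrow> real \<Rightarrow> nat \<Rightarrow> real" where
  "scaled_I \<mu> k c N = I_int \<mu> k (nat \<lfloor>c * real N\<rfloor>) N / real N ^ (2 * k - 1)"

text \<open>Only meaningful where \<open>scaled_I \<mu> k c\<close> converges.\<close>

definition delta_fun :: "(nat \<Rightarrow> complex mat measure) \<Rightarrow> nat \<Rightarrow> real \<Rightarrow> real" where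
  "delta_fun \<mu> k c = lim (scaled_I \<mu> k c)"

section \<open>Set partitions, block permutations and their cycles\<close>

text \<open>\<open>Inl i\<close> is the label \<open>i\<^sup>+\<close> and \<open>Inr j\<close> is the label \<open>j\<^sup>-\<close>.\<close>

type_synonym block = "(nat + nat) set"

definition Omega :: "nat \<Rightarrow> (nat + nat) set" where
  "Omega k = {1..k} <+> {1..k}"

definition J_set :: "nat \<Rightarrow> (block set \<times> (block \<Rightarrow> block)) set" where
  "J_set k = {(\<pi>, \<sigma>). partition_on (Omega k) \<pi> \<and> \<sigma> permutes \<pi>}"

text \<open>A cycle is represented by the set of its blocks; their cyclic order is given by \<open>\<sigma>\<close>.\<close>

definition Cyc :: "block set \<Rightarrow> (block \<Rightarrow> block) \<Rightarrow> block set set" where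
  "Cyc \<pi> \<sigma> = orbit \<sigma> ` \<pi>"

definition plus_idx :: "block \<Rightarrow> nat set" where
  "plus_idx B = {i. Inl i \<in> B}"

definition minus_idx :: "block \<Rightarrow> nat set" where
  "minus_idx B = {j. Inr j \<in> B}"

definition d_block :: "(nat \<Rightarrow> real) \<Rightarrow> (nat \<Rightarrow> real) \<Rightarrow> block \<Rightarrow> real" where
  "d_block u v B = (\<Sum>i\<in>plus_idx B. u i) - (\<Sum>j\<in>minus_idx B. v j)"

definition D_partial ::
  "(block \<Rightarrow> block) \<Rightarrow> (nat \<Rightarrow> real) \<Rightarrow> (nat \<Rightarrow> real) \<Rightarrow> block \<Rightarrow> nat \<Rightarrow> real" where
  "D_partial \<sigma> u v B j = (\<Sum>a<j. d_block u v ((\<sigma> ^^ a) B))"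

text \<open>The initial block of the cycle is an arbitrary but fixed one; on the set where the total
  \<open>D_partial \<sigma> u v B (card C)\<close> vanishes the value does not depend on it.\<close>

definition omega_cyc ::
  "(block \<Rightarrow> block) \<Rightarrow> (nat \<Rightarrow> real) \<Rightarrow> (nat \<Rightarrow> real) \<Rightarrow> block set \<Rightarrow> real" where
  "omega_cyc \<sigma> u v C =
     (let B = (SOME B. B \<in> C) in
        Max (D_partial \<sigma> u v B ` {..<card C}) - Min (D_partial \<sigma> u v B ` {..<card C}))"

section \<open>The integrals with delta factors\<close>

text \<open>The delta factors are resolved by elimination. From \<open>\<Sum>u\<^sub>i = c\<close> we eliminate \<open>u\<^sub>1\<close>, and from
  each cycle \<open>C\<close> the variable \<open>v\<^sub>j\<close> with the least minus label \<open>j\<close> occurring in \<open>C\<close>; the value of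
  the integral does not depend on this choice. A point \<open>w\<close> of the integration domain assigns
  values to the remaining labels \<open>free_labels\<close>.\<close>

definition elim_idx :: "block set \<Rightarrow> nat" where
  "elim_idx C = (LEAST j. j \<in> minus_idx (\<Union>C))"

definition free_labels :: "nat \<Rightarrow> block set \<Rightarrow> (block \<Rightarrow> block) \<Rightarrow> (nat + nat) set" where
  "free_labels k \<pi> \<sigma> = Omega k - {Inl 1} - (\<lambda>C. Inr (elim_idx C)) ` Cyc \<pi> \<sigma>"

definition u_of :: "nat \<Rightarrow> real \<Rightarrow> (nat + nat \<Rightarrow> real) \<Rightarrow> nat \<Rightarrow> real" where
  "u_of k c w i = (if i = 1 then c - (\<Sum>l=2..k. w (Inl l)) else w (Inl i))"

text \<open>The eliminated \<open>v\<^sub>j\<close> is the solution of \<open>D\<^sub>C\<^sub>,\<^sub>\<ell> = 0\<close> for the cycle \<open>C\<close> it was assigned to.\<close>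

definition v_of :: "nat \<Rightarrow> real \<Rightarrow> block set \<Rightarrow> (block \<Rightarrow> block) \<Rightarrow> (nat + nat \<Rightarrow> real) \<Rightarrow> nat \<Rightarrow> real" where
  "v_of k c \<pi> \<sigma> w j =
     (if Inr j \<in> free_labels k \<pi> \<sigma> then w (Inr j)
      else let C = (THE C. C \<in> Cyc \<pi> \<sigma> \<and> elim_idx C = j) in
        (\<Sum>i\<in>plus_idx (\<Union>C). u_of k c w i) - (\<Sum>l\<in>minus_idx (\<Union>C) - {j}. w (Inr l)))"

text \<open>\<open>\<integral> \<delta>(\<Sum>u\<^sub>i - c) \<Prod>\<^sub>C W\<^sub>C(u, v) du dv\<close> over positive \<open>u\<close> and \<open>v\<close>. If there are no free labels,
  the product measure is the unit point mass, so the integral is evaluation at a point.\<close>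

definition cycle_integral :: "nat \<Rightarrow> real \<Rightarrow> block set \<Rightarrow> (block \<Rightarrow> block) \<Rightarrow> real" where
  "cycle_integral k c \<pi> \<sigma> =
     (if \<exists>C\<in>Cyc \<pi> \<sigma>. plus_idx (\<Union>C) = {} \<or> minus_idx (\<Union>C) = {} then 0
      else LINT w|PiM (free_labels k \<pi> \<sigma>) (\<lambda>_. lborel).
        (let u = u_of k c w; v = v_of k c \<pi> \<sigma> w in
           if \<forall>i\<in>{1..k}. 0 < u i \<and> 0 < v i
           then \<Prod>C\<in>Cyc \<pi> \<sigma>. max 0 (1 - omega_cyc \<sigma> u v C)
           else 0))"

end

theory Submission
  imports Defs
begin

text \<open>The integrand of the matrix integral is a sum of products of traces \<open>tr(U^j)\<close> and their complex
  conjugates. For integers \<open>a\<^sub>i\<close> with sum zero the expectation of \<open>\<Prod>\<^sub>i tr(U^(a\<^sub>i))\<close> can be computed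
  exactly, and the exact result turns the integral into a sum over lattice points in which each term of the
  limit formula is already visible. What remains is to replace that sum by an integral.

  The exact expectation is Weyl's integration formula: it is the coefficient of \<open>x^\<delta>\<close>, where
  \<open>\<delta> = (0, \<dots>, N - 1)\<close>, in the product of the power sums \<open>p\<^sub>a(x) = \<Sum>\<^sub>r x\<^sub>r^a\<close> with the Vandermonde alternant.
  It follows from invariance alone. Left invariance of Haar measure under the groups \<open>exp (i t P)\<close>,
  with \<open>P\<close> a rank-one projection, yields loop equations (\<open>loop_equation\<close>), and these say that the Casimir
  operator of \<open>U(N)\<close> sends products of traces to functions of expectation zero. On the torus of eigenvalues, after
  multiplication by the alternant, the Casimir operator multiplies the monomial \<open>x^l\<close> by \<open>|l|\<^sup>2 - |\<delta>|\<^sup>2\<close>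
  (\<open>radial_laplacian_alt\<close>). Hence every monomial with \<open>|l|\<^sup>2 \<noteq> |\<delta>|\<^sup>2\<close> can be removed without changing the
  expectation. Antisymmetry and homogeneity leave only the permutations of \<open>\<delta>\<close>, so the function has become the
  constant that its coefficient at \<open>x^\<delta>\<close> prescribes (\<open>E_eq_coeff\<close>).

  To read off the coefficient, choose a variable \<open>x\<^sub>r\<close> from each power sum and a permutation from the alternant.
  The labels that choose the same \<open>r\<close> form the blocks of a set partition \<open>\<pi>\<close>, the permutation restricts to a
  permutation \<open>\<sigma>\<close> of the blocks, and the condition on the exponents says that the level \<open>r\<close> of a block changes by
  \<open>d\<^sub>B\<close> along \<open>\<sigma>\<close>. Distinct blocks have distinct levels, but assignments with coinciding levels cancel in pairs
  like equal columns of a determinant, so this restriction can be dropped. Then each cycle is independently a closed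
  walk in a strip of width \<open>N\<close>, with \<open>(N - \<omega>)\<^sub>+\<close> possible starting levels if its total increment is zero
  (\<open>alt_coeff_eq_cycles\<close>, \<open>I_int_exact\<close>).

  For fixed \<open>(\<pi>, \<sigma>)\<close> with \<open>s\<close> cycles the lattice points are parametrised by the \<open>2k - 1 - s\<close> free labels, and the
  product of the weights scales like \<open>N^s\<close>. The sum is \<open>N^(2k-1)\<close> times a Riemann sum with mesh \<open>1/N\<close> of a function
  that is Lipschitz except for a jump where one of the variables changes sign. The Lipschitz part causes a
  relative error \<open>O(1/N)\<close>, and the jump set has a neighbourhood of measure \<open>O(1/N)\<close> (\<open>riemann_sum\<close>). Both bounds
  are uniform for \<open>c\<close> in a compact subset of the positive half-line.\<close>

section \<open>Alternants and power sums on the torus\<close>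

text \<open>The sum over \<open>0 \<le> s < m\<close>, and minus the sum over \<open>m \<le> s < 0\<close> when \<open>m\<close> is negative. With this
  orientation the Leibniz rule for \<open>U^m\<close> and the geometric sum for \<open>x^m - y^m\<close> have the same form
  for positive and for negative powers.\<close>

definition oriented_sum :: "int \<Rightarrow> (int \<Rightarrow> 'a::comm_ring_1) \<Rightarrow> 'a" where
  "oriented_sum m f = (if 0 \<le> m then \<Sum>s\<in>{0..<m}. f s else - (\<Sum>s\<in>{m..<0}. f s))"

lemma oriented_sum_0 [simp]: "oriented_sum 0 f = 0"
  by (simp add: oriented_sum_def)

lemma oriented_sum_Suc: "oriented_sum (m + 1) f = oriented_sum m f + f m"
proof (cases "m \<ge> 0")
  case True
  then have "{0..<m+1} = insert m {0..<m}" by auto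
  then show ?thesis using True by (simp add: oriented_sum_def)
next
  case False
  show ?thesis
  proof (cases "m = -1")
    case True
    have "{-1..<0::int} = {-1}" by auto
    then show ?thesis using True by (simp add: oriented_sum_def)
  next
    case F2: False
    have "{m..<0} = insert m {m+1..<0}" using False by auto
    then show ?thesis using False F2 by (simp add: oriented_sum_def)
  qed
qed

lemma oriented_sum_sum: "oriented_sum m (\<lambda>s. \<Sum>i\<in>I. f i s) = (\<Sum>i\<in>I. oriented_sum m (f i))"
  by (auto simp: oriented_sum_def sum_negf intro: sum.swap)

lemma oriented_sum_const: "oriented_sum m (\<lambda>s. c) = of_int m * c"
  by (auto simp: oriented_sum_def)

lemma oriented_sum_cong: "(\<And>s. f s = g s) \<Longrightarrow> oriented_sum m f = oriented_sum m g"
  by (simp add: oriented_sum_def)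

lemma oriented_sum_cmult: "oriented_sum m (\<lambda>s. c * f s) = c * oriented_sum m f"
  by (simp add: oriented_sum_def sum_distrib_left)

lemma oriented_sum_telescope: "oriented_sum m (\<lambda>s. F (s + 1) - F s) = F m - F (0::int)"
proof (induction m rule: int_induct[where k = 0])
  case base
  show ?case by simp
next
  case (step1 i)
  then show ?case by (simp add: oriented_sum_Suc)
next
  case (step2 i)
  have "oriented_sum i (\<lambda>s. F (s + 1) - F s) = oriented_sum (i - 1) (\<lambda>s. F (s + 1) - F s) + (F i - F (i - 1))"
    using oriented_sum_Suc[of "i - 1" "\<lambda>s. F (s + 1) - F s"] by simp
  then show ?case using step2 by (simp add: algebra_simps)
qed

text \<open>The quotient of \<open>x^(m+1) - y^(m+1)\<close> by \<open>x - y\<close>, in a form that also makes sense at \<open>x = y\<close>.\<close>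

lemma oriented_sum_geometric:
  fixes x y :: "'a::field"
  assumes "x \<noteq> 0" "y \<noteq> 0"
  shows "(x - y) * oriented_sum (m + 1) (\<lambda>s. x powi s * y powi (m - s)) = x powi (m + 1) - y powi (m + 1)"
proof -
  have "(x - y) * (x powi s * y powi (m - s)) =
        x powi (s + 1) * y powi (m + 1 - (s + 1)) - x powi s * y powi (m + 1 - s)" for s
  proof -
    have "y powi (m + 1 - s) = y powi (m - s) * y"
      using assms power_int_add_1[of y "m - s"] by (simp add: algebra_simps)
    moreover have "x powi (s + 1) = x powi s * x"
      using assms by (simp add: power_int_add_1)
    ultimately show ?thesis by (simp add: left_diff_distrib mult_ac)
  qed
  then have "(x - y) * oriented_sum (m + 1) (\<lambda>s. x powi s * y powi (m - s)) =
     oriented_sum (m + 1) (\<lambda>s. x powi (s + 1) * y powi (m + 1 - (s + 1)) - x powi s * y powi (m + 1 - s))"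
    by (simp add: oriented_sum_cmult[symmetric] cong: oriented_sum_cong)
  also have "\<dots> = x powi (m + 1) - y powi (m + 1)"
    by (subst oriented_sum_telescope) simp
  finally show ?thesis .
qed

definition torus :: "nat \<Rightarrow> (nat \<Rightarrow> complex) set" where
  "torus N = {x. \<forall>r<N. cmod (x r) = 1}"

definition laurent_mono :: "nat \<Rightarrow> (nat \<Rightarrow> int) \<Rightarrow> (nat \<Rightarrow> complex) \<Rightarrow> complex" where
  "laurent_mono N l x = (\<Prod>r<N. x r powi l r)"

definition psum :: "nat \<Rightarrow> int \<Rightarrow> (nat \<Rightarrow> complex) \<Rightarrow> complex" where
  "psum N a x = (\<Sum>r<N. x r powi a)"

text \<open>The Vandermonde determinant of the points \<open>x r\<close>, expanded over permutations. Its diagonal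
  monomial has the exponent vector \<open>\<delta> = (0, 1, \<dots>, N - 1)\<close>.\<close>

definition alt :: "nat \<Rightarrow> (nat \<Rightarrow> complex) \<Rightarrow> complex" where
  "alt N x = (\<Sum>\<tau> | \<tau> permutes {..<N}. of_int (sign \<tau>) * laurent_mono N (\<lambda>r. int (\<tau> r)) x)"

text \<open>The Euler field \<open>x\<^sub>r \<partial>/\<partial>x\<^sub>r\<close> applied to the alternant, computed monomial by monomial.\<close>

definition euler_alt :: "nat \<Rightarrow> nat \<Rightarrow> (nat \<Rightarrow> complex) \<Rightarrow> complex" where
  "euler_alt N r x = (\<Sum>\<tau> | \<tau> permutes {..<N}. of_int (sign \<tau>) * of_nat (\<tau> r) * laurent_mono N (\<lambda>r. int (\<tau> r)) x)"

lemma torus_nz: "x \<in> torus N \<Longrightarrow> r < N \<Longrightarrow> x r \<noteq> 0"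
  unfolding torus_def by force

lemma laurent_mono_add:
  assumes "x \<in> torus N"
  shows "laurent_mono N (\<lambda>r. l r + m r) x = laurent_mono N l x * laurent_mono N m x"
  unfolding laurent_mono_def prod.distrib[symmetric]
  using assms by (intro prod.cong) (auto simp: power_int_add torus_nz)

lemma laurent_mono_mult: "laurent_mono N l (\<lambda>r. x r * y r) = laurent_mono N l x * laurent_mono N l y"
  unfolding laurent_mono_def prod.distrib[symmetric] by (simp add: power_int_mult_distrib)

lemma laurent_mono_cong: "(\<And>r. r < N \<Longrightarrow> l r = m r) \<Longrightarrow> (\<And>r. r < N \<Longrightarrow> x r = y r) \<Longrightarrow> laurent_mono N l x = laurent_mono N m y"
  unfolding laurent_mono_def by (intro prod.cong) auto

lemma laurent_mono_permute:
  assumes "p permutes {..<N}"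
  shows "laurent_mono N l (x \<circ> p) = laurent_mono N (l \<circ> Hilbert_Choice.inv p) x"
proof -
  have "laurent_mono N l (x \<circ> p) = (\<Prod>r<N. (\<lambda>r. x r powi l (Hilbert_Choice.inv p r)) (p r))"
    unfolding laurent_mono_def using permutes_inverses[OF assms] by simp
  also have "\<dots> = (\<Prod>r<N. x r powi l (Hilbert_Choice.inv p r))"
    by (rule prod.reindex_bij_betw) (use assms in \<open>simp add: permutes_imp_bij\<close>)
  finally show ?thesis by (simp add: laurent_mono_def o_def)
qed

lemma alt_permute:
  assumes p: "p permutes {..<N}"
  shows "alt N (x \<circ> p) = of_int (sign p) * alt N x"
proof -
  have pp: "permutation p" using p by (rule permutes_imp_permutation[rotated]) simp
  have "alt N x = (\<Sum>\<tau> | \<tau> permutes {..<N}. of_int (sign (\<tau> \<circ> Hilbert_Choice.inv p)) * laurent_mono N (\<lambda>r. int ((\<tau> \<circ> Hilbert_Choice.inv p) r)) x)"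
    unfolding alt_def
    using sum_permutations_compose_right[OF permutes_inv[OF p],
        of "\<lambda>\<tau>. of_int (sign \<tau>) * laurent_mono N (\<lambda>r. int (\<tau> r)) x"] .
  also have "\<dots> = (\<Sum>\<tau> | \<tau> permutes {..<N}. of_int (sign p) * (of_int (sign \<tau>) * laurent_mono N (\<lambda>r. int (\<tau> r)) (x \<circ> p)))"
  proof (rule sum.cong[OF refl])
    fix \<tau> assume "\<tau> \<in> {\<tau>. \<tau> permutes {..<N}}"
    then have "permutation \<tau>" by (auto intro: permutes_imp_permutation[rotated])
    then have "sign (\<tau> \<circ> Hilbert_Choice.inv p) = sign \<tau> * sign p"
      using pp by (simp add: sign_compose permutation_inverse sign_inverse)
    then show "of_int (sign (\<tau> \<circ> Hilbert_Choice.inv p)) * laurent_mono N (\<lambda>r. int ((\<tau> \<circ> Hilbert_Choice.inv p) r)) x =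
        of_int (sign p) * (of_int (sign \<tau>) * laurent_mono N (\<lambda>r. int (\<tau> r)) (x \<circ> p))"
      using laurent_mono_permute[OF p, of "\<lambda>r. int (\<tau> r)" x] by (simp add: o_def)
  qed
  finally have "alt N x = of_int (sign p) * alt N (x \<circ> p)"
    by (simp add: alt_def sum_distrib_left)
  then show ?thesis
    by (metis (no_types, lifting) mult.assoc mult_1 of_int_1 of_int_mult sign_idempotent)
qed

lemma alt_repeated:
  assumes "r < N" "q < N" "r \<noteq> q" "x r = x q"
  shows "alt N x = 0"
proof -
  have "x \<circ> Transposition.transpose r q = x" using assms(4) by (auto simp: fun_eq_iff Transposition.transpose_def)
  moreover have "Transposition.transpose r q permutes {..<N}" using assms by (intro permutes_swap_id) auto
  ultimately show ?thesis
    using alt_permute[of "Transposition.transpose r q" N x] assms(3) by (simp add: sign_swap_id)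
qed

text \<open>The alternant as a polynomial in the single variable \<open>x r\<close>, so that roots and degrees can be used.\<close>

definition altpoly :: "nat \<Rightarrow> nat \<Rightarrow> (nat \<Rightarrow> complex) \<Rightarrow> complex poly" where
  "altpoly N r x = (\<Sum>\<tau> | \<tau> permutes {..<N}.
     monom (of_int (sign \<tau>) * (\<Prod>q\<in>{..<N}-{r}. x q ^ \<tau> q)) (\<tau> r))"

lemma poly_altpoly:
  assumes "r < N"
  shows "poly (altpoly N r x) y = alt N (x(r := y))"
proof -
  have "laurent_mono N (\<lambda>r. int (\<tau> r)) (x(r := y)) = (\<Prod>q\<in>{..<N}-{r}. x q ^ \<tau> q) * y ^ \<tau> r" for \<tau>
  proof -
    have "laurent_mono N (\<lambda>r. int (\<tau> r)) (x(r := y)) = y ^ \<tau> r * (\<Prod>q\<in>{..<N}-{r}. (x(r:=y)) q ^ \<tau> q)"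
      unfolding laurent_mono_def using assms by (subst prod.remove[of _ r]) auto
    then show ?thesis by (simp add: mult.commute)
  qed
  then show ?thesis unfolding altpoly_def alt_def by (simp add: poly_sum poly_monom mult.assoc)
qed

lemma degree_altpoly:
  assumes "r < N"
  shows "degree (altpoly N r x) < N"
proof -
  have "degree (altpoly N r x) \<le> N - 1"
    unfolding altpoly_def
  proof (rule degree_sum_le)
    fix \<tau> assume "\<tau> \<in> {\<tau>. \<tau> permutes {..<N}}"
    then have "\<tau> r < N" using assms permutes_in_image by fastforce
    then show "degree (monom (of_int (sign \<tau>) * (\<Prod>q\<in>{..<N}-{r}. x q ^ \<tau> q)) (\<tau> r)) \<le> N - 1"
      by (intro order.trans[OF degree_monom_le]) auto
  qed (simp add: finite_permutations)
  then show ?thesis using assms by simp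
qed

text \<open>The degree is below \<open>N\<close>, and each of the other \<open>N - 1\<close> points is a root because two arguments of
  the alternant then coincide.\<close>

lemma altpoly_factor:
  assumes r: "r < N" and inj: "inj_on x {..<N}"
  shows "altpoly N r x = Polynomial.smult (coeff (altpoly N r x) (N - 1)) (\<Prod>q\<in>{..<N}-{r}. [:- x q, 1:])"
    (is "?p = Polynomial.smult ?c ?q")
proof (rule ccontr)
  assume ne: "?p \<noteq> Polynomial.smult ?c ?q"
  define d where "d = ?p - Polynomial.smult ?c ?q"
  have d0: "d \<noteq> 0" using ne by (simp add: d_def)
  have degq: "degree ?q = N - 1"
    using r by (subst degree_prod_eq_sum_degree) auto
  have lcq: "coeff ?q (N - 1) = 1"
    using degq lead_coeff_prod[of "\<lambda>q. [:- x q, 1:]" "{..<N}-{r}"] by simp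
  have "degree d \<le> N - 1" unfolding d_def
    using degree_altpoly[OF r, of x] degq by (intro degree_diff_le) auto
  moreover have "coeff d (N - 1) = 0" unfolding d_def using lcq by simp
  ultimately have "degree d < N - 1 \<or> d = 0 \<or> N - 1 = 0"
    by (metis le_neq_implies_less leading_coeff_0_iff)
  moreover have "N - 1 = 0 \<Longrightarrow> d = 0"
    using \<open>degree d \<le> N - 1\<close> \<open>coeff d (N - 1) = 0\<close> by (metis le_zero_eq leading_coeff_0_iff)
  ultimately have degd: "degree d < N - 1" using d0 by blast
  have roots: "x ` ({..<N}-{r}) \<subseteq> {y. poly d y = 0}"
  proof (intro image_subsetI CollectI)
    fix q assume q: "q \<in> {..<N} - {r}"
    have "poly ?p (x q) = 0"
      unfolding poly_altpoly[OF r] by (rule alt_repeated[of r _ q]) (use q r in auto)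
    moreover have "poly ?q (x q) = 0"
      using q by (auto simp: poly_prod)
    ultimately show "poly d (x q) = 0" by (simp add: d_def)
  qed
  have "N - 1 = card (x ` ({..<N}-{r}))"
    using r inj by (subst card_image) (auto intro: inj_on_subset)
  also have "\<dots> \<le> card {y. poly d y = 0}"
    using roots poly_roots_finite[OF d0] by (intro card_mono) auto
  also have "\<dots> \<le> degree d" using d0 by (rule card_poly_roots_bound)
  finally show False using degd by simp
qed

text \<open>The logarithmic derivative of the factorisation into linear factors.\<close>

lemma euler_alt_eq:
  assumes r: "r < N" and inj: "inj_on x {..<N}"
  shows "euler_alt N r x = alt N x * (\<Sum>q\<in>{..<N}-{r}. x r / (x r - x q))"
proof -
  let ?p = "altpoly N r x" let ?Q = "{..<N}-{r}"
  define c where "c = coeff ?p (N - 1)"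
  have pq: "?p = Polynomial.smult c (\<Prod>q\<in>?Q. [:- x q, 1:])"
    unfolding c_def by (rule altpoly_factor[OF r inj])
  have nz: "x r - x q \<noteq> 0" if "q \<in> ?Q" for q
    using that inj r by (auto dest: inj_onD)
  have "euler_alt N r x = x r * poly (pderiv ?p) (x r)"
  proof -
    have "x r * poly (pderiv (monom c n)) (x r) = of_nat n * c * x r ^ n" for c n
      by (cases n) (auto simp: pderiv_monom poly_monom)
    then have "x r * poly (pderiv ?p) (x r) = (\<Sum>\<tau> | \<tau> permutes {..<N}.
      of_nat (\<tau> r) * (of_int (sign \<tau>) * (\<Prod>q\<in>{..<N}-{r}. x q ^ \<tau> q)) * x r ^ \<tau> r)"
      unfolding altpoly_def by (simp add: higher_pderiv_sum pderiv_sum poly_sum sum_distrib_left)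
    also have "\<dots> = euler_alt N r x"
      unfolding euler_alt_def laurent_mono_def
      using r by (intro sum.cong refl) (subst prod.remove[of _ r], auto simp: mult_ac)
    finally show ?thesis by simp
  qed
  also have "poly (pderiv ?p) (x r) = c * (\<Sum>q\<in>?Q. \<Prod>j\<in>?Q-{q}. x r - x j)"
    unfolding pq by (simp add: pderiv_smult pderiv_prod poly_sum poly_prod pderiv_pCons)
  also have "(\<Sum>q\<in>?Q. \<Prod>j\<in>?Q-{q}. x r - x j) = (\<Sum>q\<in>?Q. (\<Prod>j\<in>?Q. x r - x j) / (x r - x q))"
  proof (rule sum.cong[OF refl])
    fix q assume q: "q \<in> ?Q"
    show "(\<Prod>j\<in>?Q-{q}. x r - x j) = (\<Prod>j\<in>?Q. x r - x j) / (x r - x q)"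
      using q nz[OF q] by (subst prod.remove[of ?Q q]) auto
  qed
  also have "x r * (c * \<dots>) = c * (\<Prod>j\<in>?Q. x r - x j) * (\<Sum>q\<in>?Q. x r / (x r - x q))"
    by (simp add: sum_distrib_left mult_ac)
  also have "c * (\<Prod>j\<in>?Q. x r - x j) = alt N x"
  proof -
    have "alt N x = poly ?p (x r)" using poly_altpoly[OF r, of x "x r"] by simp
    then show ?thesis unfolding pq by (simp add: poly_prod)
  qed
  finally show ?thesis .
qed

text \<open>Vandermonde: the leading coefficient in the last variable is the alternant of the other ones.\<close>

lemma alt_nonzero: "inj_on x {..<N} \<Longrightarrow> alt N x \<noteq> 0"
proof (induction N)
  case 0
  have "{\<tau>::nat\<Rightarrow>nat. \<tau> permutes {..<0}} = {id}" by auto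
  then show ?case by (simp add: alt_def laurent_mono_def)
next
  case (Suc N)
  let ?p = "altpoly (Suc N) N x"
  have "coeff ?p N = alt N x"
  proof -
    have perm: "{\<tau>. \<tau> permutes {..<Suc N}} \<inter> {\<tau>. \<tau> N = N} = {\<tau>. \<tau> permutes {..<N}}"
    proof (intro equalityI subsetI)
      fix \<tau> assume "\<tau> \<in> {\<tau>. \<tau> permutes {..<Suc N}} \<inter> {\<tau>. \<tau> N = N}"
      then show "\<tau> \<in> {\<tau>. \<tau> permutes {..<N}}"
        by (auto intro!: permutes_superset[of \<tau> "{..<Suc N}"] simp: less_Suc_eq)
    next
      fix \<tau> assume "\<tau> \<in> {\<tau>. \<tau> permutes {..<N}}"
      then have "\<tau> permutes {..<N}" by simp
      then show "\<tau> \<in> {\<tau>. \<tau> permutes {..<Suc N}} \<inter> {\<tau>. \<tau> N = N}"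
        by (auto simp: permutes_not_in intro: permutes_subset)
    qed
    have "coeff ?p N = (\<Sum>\<tau> | \<tau> permutes {..<Suc N}.
       if \<tau> N = N then of_int (sign \<tau>) * (\<Prod>q\<in>{..<Suc N}-{N}. x q ^ \<tau> q) else 0)"
      unfolding altpoly_def by (simp add: coeff_sum)
    also have "\<dots> = (\<Sum>\<tau> \<in> {\<tau>. \<tau> permutes {..<Suc N}} \<inter> {\<tau>. \<tau> N = N}. of_int (sign \<tau>) * (\<Prod>q\<in>{..<Suc N}-{N}. x q ^ \<tau> q))"
      by (subst sum.inter_restrict) (auto simp: finite_permutations intro!: sum.cong)
    also have "{..<Suc N}-{N} = {..<N}" by auto
    finally show ?thesis unfolding perm alt_def laurent_mono_def by simp
  qed
  then have pf: "?p = Polynomial.smult (alt N x) (\<Prod>q\<in>{..<Suc N}-{N}. [:- x q, 1:])"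
    using altpoly_factor[OF _ Suc.prems, of N] by simp
  have "alt (Suc N) x = poly ?p (x N)"
    using poly_altpoly[of N "Suc N" x "x N"] by simp
  also have "\<dots> = alt N x * (\<Prod>q\<in>{..<Suc N}-{N}. x N - x q)"
    unfolding pf by (simp add: poly_prod)
  finally have "alt (Suc N) x = alt N x * (\<Prod>q\<in>{..<Suc N}-{N}. x N - x q)" .
  moreover have "alt N x \<noteq> 0"
    using Suc.IH inj_on_subset[OF Suc.prems, of "{..<N}"] by auto
  moreover have "(\<Prod>q\<in>{..<Suc N}-{N}. x N - x q) \<noteq> 0"
    using Suc.prems by (auto dest: inj_onD)
  ultimately show ?case by simp
qed


text \<open>Expanding a product of power sums and an alternant selects a variable \<open>\<phi> i\<close> from the \<open>i\<close>-th power
  sum and a permutation \<open>\<tau>\<close> from the alternant; this is the exponent vector of the resulting monomial.\<close>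

definition exponents :: "nat \<Rightarrow> 'i set \<Rightarrow> ('i \<Rightarrow> int) \<Rightarrow> (nat \<Rightarrow> nat) \<Rightarrow> ('i \<Rightarrow> nat) \<Rightarrow> nat \<Rightarrow> int" where
  "exponents N I a \<tau> \<phi> r = (if r < N then int (\<tau> r) + (\<Sum>i\<in>I. if \<phi> i = r then a i else 0) else 0)"

definition energy :: "nat \<Rightarrow> (nat \<Rightarrow> int) \<Rightarrow> int" where
  "energy N l = (\<Sum>r<N. (l r)\<^sup>2)"

text \<open>As a function of the eigenvalues of \<open>U\<close>, this is the derivative of \<open>tr(X U^m) \<Prod>\<^sub>l tr(U^(a l))\<close> in the
  direction \<open>X\<^sup>T U\<close>, summed over all matrix units \<open>X\<close>.\<close>

definition loop_term :: "nat \<Rightarrow> int \<Rightarrow> 'i set \<Rightarrow> ('i \<Rightarrow> int) \<Rightarrow> (nat \<Rightarrow> complex) \<Rightarrow> complex" where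
  "loop_term N m L a x = oriented_sum m (\<lambda>s. psum N s x * psum N (m - s) x) * (\<Prod>i\<in>L. psum N (a i) x)
     + (\<Sum>l\<in>L. of_int (a l) * psum N (m + a l) x * (\<Prod>i\<in>L-{l}. psum N (a i) x))"

text \<open>The quadratic Casimir operator of \<open>U(N)\<close> applied to the class function \<open>\<Prod>\<^sub>i tr(U^(a i))\<close>, as a
  function of the eigenvalues.\<close>

definition radial_laplacian :: "nat \<Rightarrow> 'i set \<Rightarrow> ('i \<Rightarrow> int) \<Rightarrow> (nat \<Rightarrow> complex) \<Rightarrow> complex" where
  "radial_laplacian N I a x = (\<Sum>i\<in>I. of_int (a i) * loop_term N (a i) (I - {i}) a x)"

lemma laurent_mono_exponents:
  assumes x: "x \<in> torus N" and I: "finite I" and \<phi>: "\<phi> \<in> I \<rightarrow>\<^sub>E {..<N}"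
  shows "laurent_mono N (exponents N I a \<tau> \<phi>) x = laurent_mono N (\<lambda>r. int (\<tau> r)) x * (\<Prod>i\<in>I. x (\<phi> i) powi a i)"
proof -
  have "laurent_mono N (exponents N I a \<tau> \<phi>) x
      = laurent_mono N (\<lambda>r. int (\<tau> r) + (\<Sum>i\<in>I. if \<phi> i = r then a i else 0)) x"
    by (rule laurent_mono_cong) (auto simp: exponents_def)
  also have "\<dots> = laurent_mono N (\<lambda>r. int (\<tau> r)) x * laurent_mono N (\<lambda>r. \<Sum>i\<in>I. if \<phi> i = r then a i else 0) x"
    by (rule laurent_mono_add[OF x])
  also have "laurent_mono N (\<lambda>r. \<Sum>i\<in>I. if \<phi> i = r then a i else 0) x
      = (\<Prod>r<N. \<Prod>i\<in>I. if \<phi> i = r then x r powi a i else 1)"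
    unfolding laurent_mono_def
  proof (rule prod.cong[OF refl])
    fix r assume "r \<in> {..<N}"
    then have "x r \<noteq> 0" using torus_nz[OF x] by simp
    with I show "x r powi (\<Sum>i\<in>I. if \<phi> i = r then a i else 0) = (\<Prod>i\<in>I. if \<phi> i = r then x r powi a i else 1)"
      by (induction I rule: finite_induct) (auto simp: power_int_add)
  qed
  also have "\<dots> = (\<Prod>i\<in>I. \<Prod>r<N. if \<phi> i = r then x r powi a i else 1)"
    by (rule prod.swap)
  also have "\<dots> = (\<Prod>i\<in>I. x (\<phi> i) powi a i)"
    using \<phi> by (intro prod.cong refl) (auto simp: prod.delta PiE_iff)
  finally show ?thesis .
qed

lemma psum_prod_expand:
  assumes "finite I"
  shows "(\<Prod>i\<in>I. psum N (a i) x) = (\<Sum>\<phi>\<in>I \<rightarrow>\<^sub>E {..<N}. \<Prod>i\<in>I. x (\<phi> i) powi a i)"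
  unfolding psum_def using assms by (subst prod_sum_PiE) auto

lemma psum_prod_weight:
  assumes I: "finite I" and j: "j \<in> I"
  shows "(\<Sum>\<phi>\<in>I \<rightarrow>\<^sub>E {..<N}. (\<Prod>i\<in>I. x (\<phi> i) powi a i) * h (\<phi> j)) =
    (\<Sum>r<N. x r powi a j * h r) * (\<Prod>i\<in>I-{j}. psum N (a i) x)"
proof -
  let ?f = "\<lambda>i r. x r powi a i * (if i = j then h r else 1)"
  have "(\<Prod>i\<in>I. x (\<phi> i) powi a i) * h (\<phi> j) = (\<Prod>i\<in>I. ?f i (\<phi> i))" for \<phi>
    unfolding prod.distrib using I j by (simp add: prod.delta)
  then have "(\<Sum>\<phi>\<in>I \<rightarrow>\<^sub>E {..<N}. (\<Prod>i\<in>I. x (\<phi> i) powi a i) * h (\<phi> j))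
      = (\<Sum>\<phi>\<in>I \<rightarrow>\<^sub>E {..<N}. \<Prod>i\<in>I. ?f i (\<phi> i))"
    by (simp only:)
  also have "\<dots> = (\<Prod>i\<in>I. \<Sum>r<N. ?f i r)"
    by (rule prod_sum_PiE[symmetric]) (use I in auto)
  also have "\<dots> = (\<Sum>r<N. ?f j r) * (\<Prod>i\<in>I-{j}. \<Sum>r<N. ?f i r)"
    using I j by (subst prod.remove[of _ j]) auto
  finally show ?thesis by (simp add: psum_def)
qed

lemma psum_prod_pair:
  assumes x: "x \<in> torus N" and I: "finite I" and j: "i \<in> I" "j \<in> I" "i \<noteq> j"
  shows "(\<Sum>\<phi>\<in>I \<rightarrow>\<^sub>E {..<N}. (\<Prod>i\<in>I. x (\<phi> i) powi a i) * (if \<phi> i = \<phi> j then 1 else 0)) =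
    psum N (a i + a j) x * (\<Prod>l\<in>I-{i}-{j}. psum N (a l) x)"
proof -
  let ?f = "\<lambda>r l s. x s powi a l * (if l = i then (if s = r then 1 else 0) else 1) * (if l = j then (if s = r then 1 else 0) else 1)"
  have "(\<Prod>i\<in>I. x (\<phi> i) powi a i) * (if \<phi> i = \<phi> j then 1 else 0) = (\<Sum>r<N. \<Prod>l\<in>I. ?f r l (\<phi> l))"
    if "\<phi> \<in> I \<rightarrow>\<^sub>E {..<N}" for \<phi>
  proof -
    have h1: "(\<Prod>l\<in>I. ?f r l (\<phi> l)) = (\<Prod>i\<in>I. x (\<phi> i) powi a i) * (if \<phi> i = r then 1 else 0) * (if \<phi> j = r then 1 else 0)" for r
      unfolding prod.distrib using I j by (simp add: prod.delta)
    have h2: "\<phi> i < N" using that j by (auto simp: PiE_iff)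
    have h3: "(if \<phi> i = \<phi> j then 1 else 0::complex) = (\<Sum>r<N. (if \<phi> i = r then 1 else 0) * (if \<phi> j = r then 1 else 0))"
      using h2 by (simp add: if_distrib[where f = "\<lambda>z. z * _"] sum.delta cong: if_cong)
    show ?thesis unfolding h1 h3 by (simp add: sum_distrib_left mult.assoc)
  qed
  then have "(\<Sum>\<phi>\<in>I \<rightarrow>\<^sub>E {..<N}. (\<Prod>i\<in>I. x (\<phi> i) powi a i) * (if \<phi> i = \<phi> j then 1 else 0)) =
     (\<Sum>\<phi>\<in>I \<rightarrow>\<^sub>E {..<N}. \<Sum>r<N. \<Prod>l\<in>I. ?f r l (\<phi> l))"
    by (intro sum.cong) auto
  also have "\<dots> = (\<Sum>r<N. \<Sum>\<phi>\<in>I \<rightarrow>\<^sub>E {..<N}. \<Prod>l\<in>I. ?f r l (\<phi> l))"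
    by (rule sum.swap)
  also have "\<dots> = (\<Sum>r<N. \<Prod>l\<in>I. \<Sum>s<N. ?f r l s)"
    using I by (intro sum.cong refl) (subst prod_sum_PiE, auto)
  also have "\<dots> = (\<Sum>r<N. x r powi (a i + a j) * (\<Prod>l\<in>I-{i}-{j}. psum N (a l) x))"
  proof (rule sum.cong[OF refl])
    fix r assume r: "r \<in> {..<N}"
    have "(\<Prod>l\<in>I. \<Sum>s<N. ?f r l s) = (\<Sum>s<N. ?f r i s) * ((\<Sum>s<N. ?f r j s) * (\<Prod>l\<in>I-{i}-{j}. \<Sum>s<N. ?f r l s))"
      using I j by (subst prod.remove[of _ i], simp, simp, subst prod.remove[of _ j]) auto
    also have "(\<Sum>s<N. ?f r i s) = x r powi a i"
      using j r by (simp add: if_distrib[where f = "\<lambda>z. _ * z"] sum.delta cong: if_cong)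
    also have "(\<Sum>s<N. ?f r j s) = x r powi a j"
      using j r by (simp add: if_distrib[where f = "\<lambda>z. _ * z"] sum.delta cong: if_cong)
    also have "(\<Prod>l\<in>I-{i}-{j}. \<Sum>s<N. ?f r l s) = (\<Prod>l\<in>I-{i}-{j}. psum N (a l) x)"
      by (intro prod.cong refl) (auto simp: psum_def)
    finally show "(\<Prod>l\<in>I. \<Sum>s<N. ?f r l s) = x r powi (a i + a j) * (\<Prod>l\<in>I-{i}-{j}. psum N (a l) x)"
      using torus_nz[OF x, of r] r by (simp add: power_int_add)
  qed
  finally show ?thesis by (simp add: psum_def sum_distrib_right)
qed

text \<open>Expanding the squares. The linear terms will become Euler fields of the alternant; the quadratic
  ones record which power sums chose the same variable.\<close>

lemma energy_exponents:
  assumes \<tau>: "\<tau> permutes {..<N}" and I: "finite I" and \<phi>: "\<phi> \<in> I \<rightarrow>\<^sub>E {..<N}"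
  shows "energy N (exponents N I a \<tau> \<phi>) = energy N int + (\<Sum>i\<in>I. 2 * a i * int (\<tau> (\<phi> i)))
     + (\<Sum>i\<in>I. \<Sum>j\<in>I. a i * a j * (if \<phi> i = \<phi> j then 1 else 0))"
proof -
  let ?v = "\<lambda>r. \<Sum>i\<in>I. if \<phi> i = r then a i else 0"
  have \<phi>N: "\<phi> i < N" if "i \<in> I" for i using \<phi> that by (auto simp: PiE_iff)
  have "energy N (exponents N I a \<tau> \<phi>) = (\<Sum>r<N. (int (\<tau> r) + ?v r)\<^sup>2)"
    unfolding energy_def by (intro sum.cong) (auto simp: exponents_def)
  also have "\<dots> = (\<Sum>r<N. (int (\<tau> r))\<^sup>2) + 2 * (\<Sum>r<N. int (\<tau> r) * ?v r) + (\<Sum>r<N. ?v r * ?v r)"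
  proof -
    have "(\<Sum>r<N. (int (\<tau> r) + v r)\<^sup>2) =
      (\<Sum>r<N. (int (\<tau> r))\<^sup>2) + 2 * (\<Sum>r<N. int (\<tau> r) * v r) + (\<Sum>r<N. v r * v r)" for v :: "nat \<Rightarrow> int"
    proof -
      have "(int (\<tau> r) + v r)\<^sup>2 = (int (\<tau> r))\<^sup>2 + 2 * (int (\<tau> r) * v r) + v r * v r" for r
        by (simp add: power2_eq_square algebra_simps)
      then show ?thesis by (simp add: sum.distrib sum_distrib_left)
    qed
    then show ?thesis .
  qed
  also have "(\<Sum>r<N. (int (\<tau> r))\<^sup>2) = energy N int"
    unfolding energy_def
    by (rule sum.reindex_bij_betw[OF permutes_imp_bij[OF \<tau>], of "\<lambda>r. (int r)\<^sup>2"])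
  also have "(\<Sum>r<N. int (\<tau> r) * ?v r) = (\<Sum>i\<in>I. \<Sum>r<N. if \<phi> i = r then int (\<tau> r) * a i else 0)"
  proof -
    have "(\<Sum>r<N. int (\<tau> r) * ?v r) = (\<Sum>r<N. \<Sum>i\<in>I. if \<phi> i = r then int (\<tau> r) * a i else 0)"
      by (intro sum.cong refl) (simp add: sum_distrib_left if_distrib[where f = "\<lambda>z. _ * z"] cong: if_cong)
    then show ?thesis by (simp only: sum.swap[of _ I])
  qed
  also have "\<dots> = (\<Sum>i\<in>I. int (\<tau> (\<phi> i)) * a i)"
    using \<phi>N by (intro sum.cong refl) (simp add: sum.delta)
  also have "(\<Sum>r<N. ?v r * ?v r) = (\<Sum>r<N. \<Sum>i\<in>I. \<Sum>j\<in>I. (if \<phi> i = r then a i else 0) * (if \<phi> j = r then a j else 0))"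
    by (simp add: sum_product)
  also have "\<dots> = (\<Sum>i\<in>I. \<Sum>j\<in>I. \<Sum>r<N. (if \<phi> i = r then a i else 0) * (if \<phi> j = r then a j else 0))"
    by (subst sum.swap, intro sum.cong refl, rule sum.swap)
  also have "\<dots> = (\<Sum>i\<in>I. \<Sum>j\<in>I. a i * a j * (if \<phi> i = \<phi> j then 1 else 0))"
    using \<phi>N by (intro sum.cong refl) (simp add: if_distrib[where f = "\<lambda>z. z * _"] sum.delta cong: if_cong)
  finally show ?thesis by (simp add: sum_distrib_left mult_ac)
qed

text \<open>In the sum of logarithmic derivatives the pairs \<open>(r, q)\<close> and \<open>(q, r)\<close> combine to
  \<open>(x\<^sub>r^(a+1) - x\<^sub>q^(a+1)) / (x\<^sub>r - x\<^sub>q)\<close>, which is a geometric sum; so the poles cancel and power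
  sums remain.\<close>

lemma euler_field_alt:
  assumes x: "x \<in> torus N" and inj: "inj_on x {..<N}"
  shows "2 * (\<Sum>r<N. x r powi a * euler_alt N r x) =
    alt N x * (oriented_sum a (\<lambda>s. psum N s x * psum N (a - s) x) + of_int (int N - a - 1) * psum N a x)"
proof -
  let ?g = "\<lambda>r q. oriented_sum (a + 1) (\<lambda>s. x r powi s * x q powi (a - s))"
  let ?h = "\<lambda>r q. x r powi (a + 1) / (x r - x q)"
  have nz: "x r \<noteq> 0" if "r < N" for r using torus_nz[OF x that] .
  have dn: "x r - x q \<noteq> 0" if "r < N" "q < N" "r \<noteq> q" for r q
    using that inj by (auto dest: inj_onD)
  have gg: "?h r q + ?h q r = ?g r q" if "r < N" "q < N" "r \<noteq> q" for r q
  proof -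
    have "?h q r = - (x q powi (a + 1) / (x r - x q))"
      by (metis minus_diff_eq divide_minus_right)
    then have "(x r - x q) * (?h r q + ?h q r) = x r powi (a + 1) - x q powi (a + 1)"
      using dn[OF that] by (simp add: diff_divide_distrib[symmetric])
    also have "\<dots> = (x r - x q) * ?g r q"
      using oriented_sum_geometric[OF nz nz] that by simp
    finally show ?thesis using dn[OF that] by simp
  qed
  have "(\<Sum>r<N. x r powi a * euler_alt N r x) = alt N x * (\<Sum>r<N. \<Sum>q\<in>{..<N}-{r}. ?h r q)"
    unfolding sum_distrib_left
  proof (rule sum.cong[OF refl])
    fix r assume r: "r \<in> {..<N}"
    then have "x r powi (a + 1) = x r powi a * x r" using nz by (simp add: power_int_add_1)
    with r show "x r powi a * euler_alt N r x = (\<Sum>q\<in>{..<N}-{r}. alt N x * ?h r q)"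
      by (simp add: euler_alt_eq[OF _ inj] sum_distrib_left mult_ac)
  qed
  moreover have "(\<Sum>r<N. \<Sum>q\<in>{..<N}-{r}. ?h r q) = (\<Sum>r<N. \<Sum>q\<in>{..<N}-{r}. ?h q r)"
  proof -
    have "(\<Sum>r<N. \<Sum>q\<in>{..<N}-{r}. ?h r q) = (\<Sum>r<N. \<Sum>q<N. if q \<noteq> r then ?h r q else 0)"
      by (rule sum.cong[OF refl], rule sum.mono_neutral_cong_left) auto
    also have "\<dots> = (\<Sum>r<N. \<Sum>q<N. if q \<noteq> r then ?h q r else 0)"
      by (subst sum.swap, intro sum.cong refl) auto
    also have "\<dots> = (\<Sum>r<N. \<Sum>q\<in>{..<N}-{r}. ?h q r)"
      by (rule sum.cong[OF refl], rule sum.mono_neutral_cong_right) auto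
    finally show ?thesis .
  qed
  ultimately have "2 * (\<Sum>r<N. x r powi a * euler_alt N r x) =
      alt N x * (\<Sum>r<N. \<Sum>q\<in>{..<N}-{r}. ?h r q + ?h q r)"
    by (simp add: sum.distrib algebra_simps)
  also have "(\<Sum>r<N. \<Sum>q\<in>{..<N}-{r}. ?h r q + ?h q r) = (\<Sum>r<N. \<Sum>q\<in>{..<N}-{r}. ?g r q)"
    using gg by (intro sum.cong refl) auto
  also have "\<dots> = (\<Sum>r<N. (\<Sum>q<N. ?g r q) - ?g r r)"
    by (intro sum.cong refl) (simp add: sum_diff1)
  also have "\<dots> = (\<Sum>r<N. \<Sum>q<N. ?g r q) - (\<Sum>r<N. ?g r r)"
    by (simp add: sum_subtractf)
  also have "(\<Sum>r<N. ?g r r) = (\<Sum>r<N. of_int (a + 1) * x r powi a)"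
  proof (rule sum.cong[OF refl])
    fix r assume "r \<in> {..<N}"
    then have "x r powi s * x r powi (a - s) = x r powi a" for s
      using nz power_int_add[of "x r" s "a - s"] by simp
    then show "?g r r = of_int (a + 1) * x r powi a"
      by (simp add: oriented_sum_const)
  qed
  also have "\<dots> = of_int (a + 1) * psum N a x"
    by (simp add: psum_def sum_distrib_left)
  also have "(\<Sum>r<N. \<Sum>q<N. ?g r q) = oriented_sum (a + 1) (\<lambda>s. psum N s x * psum N (a - s) x)"
    unfolding psum_def sum_product by (simp add: oriented_sum_sum)
  also have "\<dots> = oriented_sum a (\<lambda>s. psum N s x * psum N (a - s) x) + of_nat N * psum N a x"
    by (simp add: oriented_sum_Suc) (simp add: psum_def)
  finally show ?thesis by (simp add: algebra_simps)
qed

lemma psum_prod_alt: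
  assumes x: "x \<in> torus N" and I: "finite I"
  shows "(\<Prod>i\<in>I. psum N (a i) x) * alt N x = (\<Sum>\<phi>\<in>I \<rightarrow>\<^sub>E {..<N}. \<Sum>\<tau> | \<tau> permutes {..<N}.
      of_int (sign \<tau>) * laurent_mono N (exponents N I a \<tau> \<phi>) x)"
  unfolding psum_prod_expand[OF I] alt_def sum_product
  using I by (intro sum.cong refl) (simp add: laurent_mono_exponents[OF x I] mult_ac)

text \<open>After multiplication by the alternant the Casimir operator becomes the flat Laplacian of the torus:
  it multiplies the monomial with exponent vector \<open>l\<close> by \<open>|l|\<^sup>2 - |\<delta>|\<^sup>2\<close>. The terms linear in the
  exponents give the splittings of a power sum into two, the quadratic ones its mergers with another
  power sum, and the leftover multiple of \<open>\<Sum>\<^sub>i a i\<close> vanishes in degree zero.\<close>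

lemma radial_laplacian_alt:
  assumes x: "x \<in> torus N" and inj: "inj_on x {..<N}" and I: "finite I" and a0: "(\<Sum>i\<in>I. a i) = 0"
  shows "radial_laplacian N I a x * alt N x = (\<Sum>\<phi>\<in>I \<rightarrow>\<^sub>E {..<N}. \<Sum>\<tau> | \<tau> permutes {..<N}.
      of_int (sign \<tau>) * of_int (energy N (exponents N I a \<tau> \<phi>) - energy N int) * laurent_mono N (exponents N I a \<tau> \<phi>) x)"
proof -
  let ?P = "\<lambda>\<phi>. \<Prod>i\<in>I. x (\<phi> i) powi a i"
  let ?pr = "\<lambda>J. \<Prod>i\<in>J. psum N (a i) x"
  let ?sg = "\<lambda>a. oriented_sum a (\<lambda>s. psum N s x * psum N (a - s) x)"
  let ?Phi = "I \<rightarrow>\<^sub>E {..<N}"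
  let ?e = "\<lambda>\<phi> i j. if \<phi> i = \<phi> j then 1 else 0"
  have inner: "(\<Sum>\<tau> | \<tau> permutes {..<N}.
      of_int (sign \<tau>) * of_int (energy N (exponents N I a \<tau> \<phi>) - energy N int) * laurent_mono N (exponents N I a \<tau> \<phi>) x)
      = (\<Sum>i\<in>I. 2 * of_int (a i) * (?P \<phi> * euler_alt N (\<phi> i) x))
       + (\<Sum>i\<in>I. \<Sum>j\<in>I. of_int (a i) * of_int (a j) * (?P \<phi> * ?e \<phi> i j) * alt N x)"
    if \<phi>: "\<phi> \<in> ?Phi" for \<phi>
  proof -
    have "(\<Sum>\<tau> | \<tau> permutes {..<N}.
      of_int (sign \<tau>) * of_int (energy N (exponents N I a \<tau> \<phi>) - energy N int) * laurent_mono N (exponents N I a \<tau> \<phi>) x)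
     = (\<Sum>\<tau> | \<tau> permutes {..<N}. (\<Sum>i\<in>I. 2 * of_int (a i) * (?P \<phi> * (of_int (sign \<tau>) * of_nat (\<tau> (\<phi> i)) * laurent_mono N (\<lambda>r. int (\<tau> r)) x)))
       + (\<Sum>i\<in>I. \<Sum>j\<in>I. of_int (a i) * of_int (a j) * (?P \<phi> * ?e \<phi> i j)) * (of_int (sign \<tau>) * laurent_mono N (\<lambda>r. int (\<tau> r)) x))"
    proof (rule sum.cong[OF refl])
      fix \<tau> assume "\<tau> \<in> {\<tau>. \<tau> permutes {..<N}}"
      then have \<tau>: "\<tau> permutes {..<N}" by simp
      have en: "(of_int (energy N (exponents N I a \<tau> \<phi>) - energy N int) :: complex)
         = (\<Sum>i\<in>I. 2 * of_int (a i) * of_nat (\<tau> (\<phi> i))) + (\<Sum>i\<in>I. \<Sum>j\<in>I. of_int (a i) * of_int (a j) * ?e \<phi> i j)"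
        unfolding energy_exponents[OF \<tau> I \<phi>] by (simp add: of_int_sum) (intro sum.cong refl, simp)
      show "of_int (sign \<tau>) * of_int (energy N (exponents N I a \<tau> \<phi>) - energy N int) * laurent_mono N (exponents N I a \<tau> \<phi>) x
        = (\<Sum>i\<in>I. 2 * of_int (a i) * (?P \<phi> * (of_int (sign \<tau>) * of_nat (\<tau> (\<phi> i)) * laurent_mono N (\<lambda>r. int (\<tau> r)) x)))
       + (\<Sum>i\<in>I. \<Sum>j\<in>I. of_int (a i) * of_int (a j) * (?P \<phi> * ?e \<phi> i j)) * (of_int (sign \<tau>) * laurent_mono N (\<lambda>r. int (\<tau> r)) x)"
        unfolding en laurent_mono_exponents[OF x I \<phi>]
        by (simp only: distrib_left distrib_right sum_distrib_left sum_distrib_right mult_ac)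
    qed
    also have "\<dots> = (\<Sum>\<tau> | \<tau> permutes {..<N}. \<Sum>i\<in>I. 2 * of_int (a i) * (?P \<phi> * (of_int (sign \<tau>) * of_nat (\<tau> (\<phi> i)) * laurent_mono N (\<lambda>r. int (\<tau> r)) x)))
       + (\<Sum>i\<in>I. \<Sum>j\<in>I. of_int (a i) * of_int (a j) * (?P \<phi> * ?e \<phi> i j)) * alt N x"
      by (simp only: sum.distrib alt_def sum_distrib_left)
    also have "(\<Sum>\<tau> | \<tau> permutes {..<N}. \<Sum>i\<in>I. 2 * of_int (a i) * (?P \<phi> * (of_int (sign \<tau>) * of_nat (\<tau> (\<phi> i)) * laurent_mono N (\<lambda>r. int (\<tau> r)) x)))
       = (\<Sum>i\<in>I. 2 * of_int (a i) * (?P \<phi> * euler_alt N (\<phi> i) x))"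
      by (subst sum.swap) (simp only: euler_alt_def sum_distrib_left)
    finally show ?thesis by (simp only: sum_distrib_right)
  qed
  have pr: "?pr I = psum N (a i) x * ?pr (I - {i})" if "i \<in> I" for i
    using I that by (rule prod.remove)
  have first: "(\<Sum>\<phi>\<in>?Phi. ?P \<phi> * euler_alt N (\<phi> i) x) * 2
      = alt N x * (?sg (a i) + of_int (int N - a i - 1) * psum N (a i) x) * ?pr (I - {i})" if "i \<in> I" for i
    using euler_field_alt[OF x inj, of "a i"] psum_prod_weight[OF I that, where h = "\<lambda>r. euler_alt N r x" and a = a and x = x and N = N]
    by (simp add: mult_ac)
  have diag: "(\<Sum>\<phi>\<in>?Phi. ?P \<phi> * ?e \<phi> i i) = psum N (a i) x * ?pr (I - {i})" if "i \<in> I" for i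
    using psum_prod_expand[OF I, of N a x] pr[OF that] by simp
  have "(\<Sum>\<phi>\<in>?Phi. \<Sum>\<tau> | \<tau> permutes {..<N}.
      of_int (sign \<tau>) * of_int (energy N (exponents N I a \<tau> \<phi>) - energy N int) * laurent_mono N (exponents N I a \<tau> \<phi>) x)
     = (\<Sum>\<phi>\<in>?Phi. (\<Sum>i\<in>I. 2 * of_int (a i) * (?P \<phi> * euler_alt N (\<phi> i) x))
       + (\<Sum>i\<in>I. \<Sum>j\<in>I. of_int (a i) * of_int (a j) * (?P \<phi> * ?e \<phi> i j) * alt N x))"
    using inner by (rule sum.cong[OF refl])
  also have "\<dots> = (\<Sum>i\<in>I. of_int (a i) * ((\<Sum>\<phi>\<in>?Phi. ?P \<phi> * euler_alt N (\<phi> i) x) * 2))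
     + (\<Sum>i\<in>I. of_int (a i) * (\<Sum>j\<in>I. of_int (a j) * (\<Sum>\<phi>\<in>?Phi. ?P \<phi> * ?e \<phi> i j)) * alt N x)"
  proof -
    have "(\<Sum>\<phi>\<in>?Phi. \<Sum>i\<in>I. 2 * of_int (a i) * (?P \<phi> * euler_alt N (\<phi> i) x))
       = (\<Sum>i\<in>I. of_int (a i) * ((\<Sum>\<phi>\<in>?Phi. ?P \<phi> * euler_alt N (\<phi> i) x) * 2))"
      by (subst sum.swap) (simp add: sum_distrib_left sum_distrib_right mult_ac)
    moreover have "(\<Sum>\<phi>\<in>?Phi. \<Sum>i\<in>I. \<Sum>j\<in>I. of_int (a i) * of_int (a j) * (?P \<phi> * ?e \<phi> i j) * alt N x)
       = (\<Sum>i\<in>I. of_int (a i) * (\<Sum>j\<in>I. of_int (a j) * (\<Sum>\<phi>\<in>?Phi. ?P \<phi> * ?e \<phi> i j)) * alt N x)"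
    proof -
      have "(\<Sum>\<phi>\<in>?Phi. \<Sum>i\<in>I. \<Sum>j\<in>I. F \<phi> i j) = (\<Sum>i\<in>I. \<Sum>j\<in>I. \<Sum>\<phi>\<in>?Phi. F \<phi> i j)" for F :: "_ \<Rightarrow> _ \<Rightarrow> _ \<Rightarrow> complex"
        by (subst sum.swap, intro sum.cong refl, rule sum.swap)
      then show ?thesis by (simp only: sum_distrib_left sum_distrib_right mult.assoc)
    qed
    ultimately show ?thesis by (simp only: sum.distrib)
  qed
  also have "\<dots> = (\<Sum>i\<in>I. of_int (a i) * loop_term N (a i) (I - {i}) a x * alt N x + of_int (a i) * (of_nat N - 1) * ?pr I * alt N x)"
    unfolding sum.distrib[symmetric]
  proof (rule sum.cong[OF refl])
    fix i assume i: "i \<in> I"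
    have "(\<Sum>j\<in>I. of_int (a j) * (\<Sum>\<phi>\<in>?Phi. ?P \<phi> * ?e \<phi> i j))
      = of_int (a i) * (psum N (a i) x * ?pr (I - {i})) +
        (\<Sum>j\<in>I-{i}. of_int (a j) * psum N (a i + a j) x * ?pr (I - {i} - {j}))"
      unfolding sum.remove[OF I i] diag[OF i]
      by (intro arg_cong2[where f = "(+)"] refl sum.cong) (auto simp: psum_prod_pair[OF x I i])
    then show "of_int (a i) * ((\<Sum>\<phi>\<in>?Phi. ?P \<phi> * euler_alt N (\<phi> i) x) * 2) +
       of_int (a i) * (\<Sum>j\<in>I. of_int (a j) * (\<Sum>\<phi>\<in>?Phi. ?P \<phi> * ?e \<phi> i j)) * alt N x =
       of_int (a i) * loop_term N (a i) (I - {i}) a x * alt N x + of_int (a i) * (of_nat N - 1) * ?pr I * alt N x"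
      unfolding first[OF i] pr[OF i] loop_term_def by (simp add: algebra_simps)
  qed
  also have "\<dots> = radial_laplacian N I a x * alt N x + of_int (\<Sum>i\<in>I. a i) * ((of_nat N - 1) * ?pr I * alt N x)"
    by (simp add: sum.distrib radial_laplacian_def sum_distrib_right mult.assoc)
  finally show ?thesis using a0 by simp
qed

text \<open>Dedekind's argument for the independence of characters: translating a relation by \<open>y\<close> and subtracting
  a multiple of it removes one monomial and rescales the others by factors that some \<open>y\<close> makes nonzero.\<close>

lemma laurent_mono_independent:
  assumes "finite L" "\<And>l r. l \<in> L \<Longrightarrow> r \<ge> N \<Longrightarrow> l r = 0"
    and "\<And>x. x \<in> torus N \<Longrightarrow> (\<Sum>l\<in>L. c l * laurent_mono N l x) = 0"
  shows "\<forall>l\<in>L. c l = 0"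
  using assms
proof (induction L arbitrary: c rule: finite_induct)
  case empty
  then show ?case by simp
next
  case (insert l0 F)
  have mem: "(\<lambda>r. x r * y r) \<in> torus N" if "x \<in> torus N" "y \<in> torus N" for x y
    using that by (auto simp: torus_def norm_mult)
  have rel: "c l0 * laurent_mono N l0 x + (\<Sum>l\<in>F. c l * laurent_mono N l x) = 0" if "x \<in> torus N" for x
    using insert.prems(2)[OF that] insert.hyps by simp
  have F0: "c l * (laurent_mono N l y - laurent_mono N l0 y) = 0" if y: "y \<in> torus N" and l: "l \<in> F" for y l
  proof -
    have "\<forall>l\<in>F. c l * (laurent_mono N l y - laurent_mono N l0 y) = 0"
    proof (rule insert.IH)
      show "l r = 0" if "l \<in> F" "r \<ge> N" for l r using insert.prems(1) that by auto
      fix x assume x: "x \<in> torus N"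
      have "0 = (c l0 * laurent_mono N l0 (\<lambda>r. x r * y r) + (\<Sum>l\<in>F. c l * laurent_mono N l (\<lambda>r. x r * y r)))
          - laurent_mono N l0 y * (c l0 * laurent_mono N l0 x + (\<Sum>l\<in>F. c l * laurent_mono N l x))"
        unfolding rel[OF mem[OF x y]] rel[OF x] by simp
      also have "\<dots> = (\<Sum>l\<in>F. c l * (laurent_mono N l y - laurent_mono N l0 y) * laurent_mono N l x)"
        unfolding laurent_mono_mult by (simp add: algebra_simps sum_distrib_left sum_subtractf)
      finally show "(\<Sum>l\<in>F. c l * (laurent_mono N l y - laurent_mono N l0 y) * laurent_mono N l x) = 0" by simp
    qed
    then show ?thesis using l by blast
  qed
  have cF: "c l = 0" if l: "l \<in> F" for l
  proof -
    have "l \<noteq> l0" using l insert.hyps by auto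
    then obtain r where r: "l r \<noteq> l0 r" by auto
    then have rN: "r < N"
      using insert.prems(1)[of l r] insert.prems(1)[of l0 r] l by (metis insertCI not_le)
    \<comment> \<open>The angle at which the two characters differ by half a turn.\<close>
    define t where "t = pi / of_int (l r - l0 r)"
    define y where "y = (\<lambda>q. if q = r then cis t else 1)"
    have y: "y \<in> torus N" by (auto simp: y_def torus_def)
    have tm: "laurent_mono N m y = cis (of_int (m r) * t)" for m
    proof -
      have "laurent_mono N m y = y r powi m r * (\<Prod>q\<in>{..<N}-{r}. y q powi m q)"
        unfolding laurent_mono_def using rN by (intro prod.remove) auto
      also have "(\<Prod>q\<in>{..<N}-{r}. y q powi m q) = 1"
        by (intro prod.neutral) (auto simp: y_def)
      finally show ?thesis by (simp add: y_def cis_power_int)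
    qed
    have "laurent_mono N l y \<noteq> laurent_mono N l0 y"
    proof
      assume "laurent_mono N l y = laurent_mono N l0 y"
      then have "cis (of_int (l r) * t) / cis (of_int (l0 r) * t) = 1"
        unfolding tm by simp
      then have "cis (of_int (l r - l0 r) * t) = 1"
        by (simp add: cis_divide left_diff_distrib)
      moreover have "of_int (l r - l0 r) * t = pi" using r by (simp add: t_def)
      ultimately show False by (simp add: complex_eq_iff)
    qed
    with F0[OF y l] show ?thesis by simp
  qed
  have "(\<lambda>_. 1) \<in> torus N" by (simp add: torus_def)
  from rel[OF this] cF have "c l0 * laurent_mono N l0 (\<lambda>_. 1) = 0" by simp
  then have "c l0 = 0" by (simp add: laurent_mono_def)
  with cF show ?case by auto
qed

text \<open>Turning the \<open>r\<close>-th coordinate by the angle \<open>t r\<close> separates coinciding coordinates for all small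
  nonzero \<open>t\<close>, so a value at any point is a limit of values at points with distinct coordinates.\<close>

lemma torus_distinct_dense:
  fixes h :: "(nat \<Rightarrow> complex) \<Rightarrow> complex"
  assumes x: "x \<in> torus N"
    and zero: "\<And>y. y \<in> torus N \<Longrightarrow> inj_on y {..<N} \<Longrightarrow> h y = 0"
    and cont: "((\<lambda>t. h (\<lambda>r. x r * cis (t * real r))) \<longlongrightarrow> h x) (at 0)"
  shows "h x = 0"
proof -
  let ?y = "\<lambda>t r. x r * cis (t * real r)"
  have mem: "?y t \<in> torus N" for t using x by (auto simp: torus_def norm_mult)
  have pair: "\<forall>\<^sub>F t in at 0. ?y t r \<noteq> ?y t q" if "r < N" "q < N" "r < q" for r q
  proof (cases "x r = x q")
    case True
    have "\<forall>\<^sub>F t in at (0::real). t \<noteq> 0 \<and> \<bar>t\<bar> * real q < 1"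
    proof (intro eventually_conj)
      show "\<forall>\<^sub>F t in at (0::real). t \<noteq> 0" by (simp add: eventually_at_filter)
      have "((\<lambda>t. \<bar>t\<bar> * real q) \<longlongrightarrow> \<bar>0\<bar> * real q) (at 0)" by (intro tendsto_intros)
      then show "\<forall>\<^sub>F t in at 0. \<bar>t\<bar> * real q < 1"
        by (rule order_tendstoD) simp
    qed
    then show ?thesis
    proof eventually_elim
      case (elim t)
      show ?case
      proof
        assume "?y t r = ?y t q"
        then have "cis (t * real q) / cis (t * real r) = 1" using True torus_nz[OF x that(2)] by simp
        then have "cos (t * (real q - real r)) = 1"
          by (simp add: cis_divide right_diff_distrib complex_eq_iff)
        then obtain n :: int where n: "t * (real q - real r) = of_int n * 2 * pi"
          using cos_one_2pi_int by auto
        have "\<bar>t * (real q - real r)\<bar> \<le> \<bar>t\<bar> * real q"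
          using that by (simp add: abs_mult mult_left_mono)
        then have "\<bar>of_int n * 2 * pi\<bar> < 1" using elim n by simp
        then have "\<bar>real_of_int n\<bar> * (2 * pi) < 1" by (simp add: abs_mult)
        moreover have "2 * pi \<ge> 1" using pi_gt3 by simp
        ultimately have "\<bar>real_of_int n\<bar> < 1"
          by (smt (verit) mult_le_cancel_left1)
        then have "n = 0" by linarith
        then show False using n elim that by simp
      qed
    qed
  next
    case False
    have "((\<lambda>t. ?y t r - ?y t q) \<longlongrightarrow> x r * cis (0 * real r) - x q * cis (0 * real q)) (at 0)"
      by (intro tendsto_intros)
    then have "\<forall>\<^sub>F t in at 0. ?y t r - ?y t q \<noteq> 0"
      by (rule tendsto_imp_eventually_ne) (use False in simp)
    then show ?thesis by eventually_elim simp
  qed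
  have "\<forall>\<^sub>F t in at 0. \<forall>r\<in>{..<N}. \<forall>q\<in>{..<N}. r < q \<longrightarrow> ?y t r \<noteq> ?y t q"
    using pair by (intro eventually_ball_finite ballI) (auto simp: eventually_mono)
  then have "\<forall>\<^sub>F t in at 0. h (?y t) = 0"
  proof eventually_elim
    case (elim t)
    have "inj_on (?y t) {..<N}"
    proof (rule inj_onI)
      fix r q assume "r \<in> {..<N}" "q \<in> {..<N}" "?y t r = ?y t q"
      then show "r = q" using elim by (metis linorder_neqE_nat)
    qed
    then show ?case using zero mem by blast
  qed
  then have "((\<lambda>t. h (?y t)) \<longlongrightarrow> 0) (at 0)" by (rule tendsto_eventually)
  from tendsto_unique[OF _ cont this] show ?thesis by simp
qed

section \<open>Integration of symmetric functions\<close>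

text \<open>Linear combinations of products of power sums of total degree zero. The labels range over one fixed
  infinite type because the Casimir operator splits a power sum into two, which needs a fresh label.\<close>

inductive symspan :: "nat \<Rightarrow> ((nat \<Rightarrow> complex) \<Rightarrow> complex) \<Rightarrow> bool" for N where
  base: "finite (I :: (nat + nat) set) \<Longrightarrow> (\<Sum>i\<in>I. a i) = 0 \<Longrightarrow> symspan N (\<lambda>x. \<Prod>i\<in>I. psum N (a i) x)"
| add: "symspan N g \<Longrightarrow> symspan N h \<Longrightarrow> symspan N (\<lambda>x. g x + h x)"
| scale: "symspan N g \<Longrightarrow> symspan N (\<lambda>x. c * g x)"

lemma symspan_const: "symspan N (\<lambda>x. c)"
  using symspan.scale[OF symspan.base[of "{}" "\<lambda>_. 0" N], of c] by simp

lemma symspan_sum: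
  "finite J \<Longrightarrow> (\<And>j. j \<in> J \<Longrightarrow> symspan N (g j)) \<Longrightarrow> symspan N (\<lambda>x. \<Sum>j\<in>J. g j x)"
  by (induction J rule: finite_induct) (auto intro: symspan_const symspan.add)


lemma ex_fresh: "finite (I :: (nat + nat) set) \<Longrightarrow> \<exists>j. j \<notin> I"
  by (rule ex_new_if_finite) (simp_all add: finite_Plus_UNIV_iff flip: UNIV_Plus_UNIV)

lemma symspan_split:
  assumes L: "finite (L :: (nat + nat) set)" and sum: "m + (\<Sum>i\<in>L. a i) = 0"
  shows "symspan N (\<lambda>x. psum N s x * psum N (m - s) x * (\<Prod>i\<in>L. psum N (a i) x))"
proof -
  obtain j where j: "j \<notin> L" using ex_fresh[OF L] by blast
  obtain k where k: "k \<notin> insert j L" using ex_fresh[of "insert j L"] L by blast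
  have "symspan N (\<lambda>x. \<Prod>i\<in>insert k (insert j L). psum N ((a(j := s, k := m - s)) i) x)"
  proof (rule symspan.base)
    have "(\<Sum>i\<in>insert k (insert j L). (a(j := s, k := m - s)) i) = m - s + (s + (\<Sum>i\<in>L. a i))"
      using j k L by (auto intro!: sum.cong)
    then show "(\<Sum>i\<in>insert k (insert j L). (a(j := s, k := m - s)) i) = 0" using sum by simp
  qed (use L in auto)
  also have "(\<lambda>x. \<Prod>i\<in>insert k (insert j L). psum N ((a(j := s, k := m - s)) i) x) =
     (\<lambda>x. psum N s x * psum N (m - s) x * (\<Prod>i\<in>L. psum N (a i) x))"
  proof
    fix x
    have "(\<Prod>i\<in>L. psum N ((a(j := s, k := m - s)) i) x) = (\<Prod>i\<in>L. psum N (a i) x)"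
      using j k by (intro prod.cong) auto
    then show "(\<Prod>i\<in>insert k (insert j L). psum N ((a(j := s, k := m - s)) i) x) =
      psum N s x * psum N (m - s) x * (\<Prod>i\<in>L. psum N (a i) x)"
      using j k L by (auto simp: mult_ac)
  qed
  finally show ?thesis .
qed

lemma symspan_loop_term:
  assumes L: "finite (L :: (nat + nat) set)" and sum: "m + (\<Sum>i\<in>L. a i) = 0"
  shows "symspan N (loop_term N m L a)"
proof -
  have 1: "symspan N (\<lambda>x. oriented_sum m (\<lambda>s. psum N s x * psum N (m - s) x) * (\<Prod>i\<in>L. psum N (a i) x))"
  proof -
    have *: "symspan N (\<lambda>x. \<Sum>s\<in>S. psum N s x * psum N (m - s) x * (\<Prod>i\<in>L. psum N (a i) x))" if "finite S" for S
      using that symspan_split[OF assms] by (rule symspan_sum)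
    show ?thesis
    proof (cases "0 \<le> m")
      case True
      then show ?thesis using *[of "{0..<m}"] by (simp add: oriented_sum_def sum_distrib_right)
    next
      case False
      then show ?thesis using symspan.scale[OF *[of "{m..<0}"], of "-1"] by (simp add: oriented_sum_def sum_distrib_right)
    qed
  qed
  have 2: "symspan N (\<lambda>x. \<Sum>l\<in>L. of_int (a l) * (psum N (m + a l) x * (\<Prod>i\<in>L-{l}. psum N (a i) x)))"
  proof (intro symspan_sum symspan.scale)
    fix l assume l: "l \<in> L"
    have "symspan N (\<lambda>x. \<Prod>i\<in>L. psum N ((a(l := m + a l)) i) x)"
    proof (rule symspan.base[OF L])
      show "(\<Sum>i\<in>L. (a(l := m + a l)) i) = 0"
        using sum l L by (simp add: sum.remove[of L l])
    qed
    also have "(\<lambda>x. \<Prod>i\<in>L. psum N ((a(l := m + a l)) i) x) = (\<lambda>x. psum N (m + a l) x * (\<Prod>i\<in>L-{l}. psum N (a i) x))"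
      using L l by (auto simp: prod.remove[of L l] intro!: ext)
    finally show "symspan N (\<lambda>x. psum N (m + a l) x * (\<Prod>i\<in>L-{l}. psum N (a i) x))" .
  qed (use L in auto)
  show ?thesis using symspan.add[OF 1 2] unfolding loop_term_def[abs_def] by (simp add: mult.assoc)
qed

lemma symspan_radial_laplacian:
  assumes I: "finite (I :: (nat + nat) set)" and sum: "(\<Sum>i\<in>I. a i) = 0"
  shows "symspan N (radial_laplacian N I a)"
  unfolding radial_laplacian_def[abs_def] using assms
  by (intro symspan_sum symspan.scale symspan_loop_term) (auto simp: sum.remove)

lemma psum_permute: "p permutes {..<N} \<Longrightarrow> psum N a (x \<circ> p) = psum N a x"
  unfolding psum_def
  using sum.reindex_bij_betw[OF permutes_imp_bij, of p "{..<N}" "\<lambda>r. x r powi a"] by simp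

lemma symspan_permute: "symspan N g \<Longrightarrow> p permutes {..<N} \<Longrightarrow> g (x \<circ> p) = g x"
  by (induction rule: symspan.induct) (simp_all add: psum_permute)

text \<open>Continuity along the paths on which the coordinates turn at different speeds; these paths leave the set
  of points with coinciding coordinates at once.\<close>

definition path_continuous :: "nat \<Rightarrow> ((nat \<Rightarrow> complex) \<Rightarrow> complex) \<Rightarrow> bool" where
  "path_continuous N h \<longleftrightarrow> (\<forall>x\<in>torus N. ((\<lambda>t. h (\<lambda>r. x r * cis (t * real r))) \<longlongrightarrow> h x) (at 0))"

lemma path_continuous_const: "path_continuous N (\<lambda>x. c)"
  by (simp add: path_continuous_def)

lemma path_continuous_add: "path_continuous N g \<Longrightarrow> path_continuous N h \<Longrightarrow> path_continuous N (\<lambda>x. g x + h x)"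
  by (simp add: path_continuous_def tendsto_add)

lemma path_continuous_diff: "path_continuous N g \<Longrightarrow> path_continuous N h \<Longrightarrow> path_continuous N (\<lambda>x. g x - h x)"
  by (simp add: path_continuous_def tendsto_diff)

lemma path_continuous_mult: "path_continuous N g \<Longrightarrow> path_continuous N h \<Longrightarrow> path_continuous N (\<lambda>x. g x * h x)"
  by (simp add: path_continuous_def tendsto_mult)

lemma path_continuous_sum: "(\<And>i. i \<in> I \<Longrightarrow> path_continuous N (g i)) \<Longrightarrow> path_continuous N (\<lambda>x. \<Sum>i\<in>I. g i x)"
  by (simp add: path_continuous_def tendsto_sum)

lemma path_continuous_prod: "(\<And>i. i \<in> I \<Longrightarrow> path_continuous N (g i)) \<Longrightarrow> path_continuous N (\<lambda>x. \<Prod>i\<in>I. g i x)"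
  by (simp add: path_continuous_def tendsto_prod)

lemma path_continuous_power_int: "r < N \<Longrightarrow> path_continuous N (\<lambda>x. x r powi a)"
  unfolding path_continuous_def
proof
  fix x assume "r < N" "x \<in> torus N"
  then have nz: "x r * cis (0 * real r) \<noteq> 0" using torus_nz by simp
  have "((\<lambda>t. (x r * cis (t * real r)) powi a) \<longlongrightarrow> (x r * cis (0 * real r)) powi a) (at 0)"
    using nz by (intro tendsto_intros) auto
  then show "((\<lambda>t. (x r * cis (t * real r)) powi a) \<longlongrightarrow> x r powi a) (at 0)" by simp
qed

lemma path_continuous_laurent_mono: "path_continuous N (laurent_mono N l)"
  unfolding laurent_mono_def[abs_def] by (intro path_continuous_prod path_continuous_power_int) auto

lemma path_continuous_psum: "path_continuous N (psum N a)"
  unfolding psum_def[abs_def] by (intro path_continuous_sum path_continuous_power_int) auto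

lemma path_continuous_alt: "path_continuous N (alt N)"
  unfolding alt_def[abs_def] by (intro path_continuous_sum path_continuous_mult path_continuous_const path_continuous_laurent_mono)

lemma path_continuous_symspan: "symspan N g \<Longrightarrow> path_continuous N g"
  by (induction rule: symspan.induct) (intro path_continuous_prod path_continuous_psum path_continuous_add path_continuous_mult path_continuous_const; assumption)+

lemma torus_dense_eq:
  assumes "x \<in> torus N" "path_continuous N g" "path_continuous N h"
    and "\<And>y. y \<in> torus N \<Longrightarrow> inj_on y {..<N} \<Longrightarrow> g y = h y"
  shows "g x = h x"
  using torus_distinct_dense[OF assms(1), of "\<lambda>x. g x - h x"] path_continuous_diff[OF assms(2,3)] assms(1,4)
  by (auto simp: path_continuous_def)

text \<open>\<open>\<Phi>\<close> lists the coefficients of the Laurent polynomial \<open>g \<cdot> alt\<close>. If \<open>g\<close> were a Schur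
  function, this would be a single antisymmetrised monomial.\<close>

definition alt_expansion :: "nat \<Rightarrow> ((nat \<Rightarrow> complex) \<Rightarrow> complex) \<Rightarrow> ((nat \<Rightarrow> int) \<Rightarrow> complex) \<Rightarrow> bool" where
  "alt_expansion N g \<Phi> \<longleftrightarrow> finite {l. \<Phi> l \<noteq> 0} \<and> (\<forall>l r. \<Phi> l \<noteq> 0 \<longrightarrow> r \<ge> N \<longrightarrow> l r = 0) \<and>
     (\<forall>x\<in>torus N. g x * alt N x = (\<Sum>l | \<Phi> l \<noteq> 0. \<Phi> l * laurent_mono N l x))"

lemma alt_expansion_sum:
  assumes "alt_expansion N g \<Phi>" "finite L" "{l. \<Phi> l \<noteq> 0} \<subseteq> L" "x \<in> torus N"
  shows "g x * alt N x = (\<Sum>l\<in>L. \<Phi> l * laurent_mono N l x)"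
proof -
  have "g x * alt N x = (\<Sum>l | \<Phi> l \<noteq> 0. \<Phi> l * laurent_mono N l x)"
    using assms unfolding alt_expansion_def by blast
  also have "\<dots> = (\<Sum>l\<in>L. \<Phi> l * laurent_mono N l x)"
    using assms by (intro sum.mono_neutral_left) auto
  finally show ?thesis .
qed

lemma reprI:
  assumes "finite L" "\<And>l. l \<notin> L \<Longrightarrow> \<Phi> l = 0" "\<And>l r. l \<in> L \<Longrightarrow> r \<ge> N \<Longrightarrow> l r = 0"
    and "\<And>x. x \<in> torus N \<Longrightarrow> g x * alt N x = (\<Sum>l\<in>L. \<Phi> l * laurent_mono N l x)"
  shows "alt_expansion N g \<Phi>"
proof -
  have sub: "{l. \<Phi> l \<noteq> 0} \<subseteq> L" using assms(2) by blast
  have "(\<Sum>l\<in>L. \<Phi> l * laurent_mono N l x) = (\<Sum>l | \<Phi> l \<noteq> 0. \<Phi> l * laurent_mono N l x)" for x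
    using sub assms(1) by (intro sum.mono_neutral_right) auto
  then show ?thesis
    unfolding alt_expansion_def
  proof (intro conjI ballI allI impI)
    show "finite {l. \<Phi> l \<noteq> 0}" by (rule finite_subset[OF sub assms(1)])
    show "l r = 0" if "\<Phi> l \<noteq> 0" "N \<le> r" for l r
      by (rule assms(3)) (use sub that(1) in blast, rule that(2))
    fix x assume "x \<in> torus N"
    then show "g x * alt N x = (\<Sum>l | \<Phi> l \<noteq> 0. \<Phi> l * laurent_mono N l x)"
      using assms(4) \<open>\<And>x. (\<Sum>l\<in>L. \<Phi> l * laurent_mono N l x) = (\<Sum>l | \<Phi> l \<noteq> 0. \<Phi> l * laurent_mono N l x)\<close> by simp
  qed
qed

lemma alt_expansion_unique:
  assumes "alt_expansion N g \<Phi>" "alt_expansion N g \<Psi>"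
  shows "\<Phi> = \<Psi>"
proof
  fix l0
  let ?L = "{l. \<Phi> l \<noteq> 0} \<union> {l. \<Psi> l \<noteq> 0}"
  have fin: "finite ?L" using assms by (auto simp: alt_expansion_def)
  have "\<forall>l\<in>?L. \<Phi> l - \<Psi> l = 0"
  proof (rule laurent_mono_independent[OF fin])
    show "l r = 0" if "l \<in> ?L" "r \<ge> N" for l r using that assms by (auto simp: alt_expansion_def)
    fix x assume x: "x \<in> torus N"
    have "(\<Sum>l\<in>?L. \<Phi> l * laurent_mono N l x) = (\<Sum>l\<in>?L. \<Psi> l * laurent_mono N l x)"
      using alt_expansion_sum[OF assms(1) fin _ x] alt_expansion_sum[OF assms(2) fin _ x] by auto
    then show "(\<Sum>l\<in>?L. (\<Phi> l - \<Psi> l) * laurent_mono N l x) = 0"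
      by (simp add: left_diff_distrib sum_subtractf)
  qed
  then have "l0 \<in> ?L \<Longrightarrow> \<Phi> l0 = \<Psi> l0" by (metis right_minus_eq)
  moreover have "l0 \<notin> ?L \<Longrightarrow> \<Phi> l0 = \<Psi> l0" by simp
  ultimately show "\<Phi> l0 = \<Psi> l0" by blast
qed

lemma alt_expansion_add:
  assumes "alt_expansion N g \<Phi>" "alt_expansion N h \<Psi>"
  shows "alt_expansion N (\<lambda>x. g x + h x) (\<lambda>l. \<Phi> l + \<Psi> l)"
proof -
  let ?L = "{l. \<Phi> l \<noteq> 0} \<union> {l. \<Psi> l \<noteq> 0}"
  have fin: "finite ?L" using assms by (auto simp: alt_expansion_def)
  show ?thesis
  proof (rule reprI[OF fin])
    show "l r = 0" if "l \<in> ?L" "r \<ge> N" for l r using that assms by (auto simp: alt_expansion_def)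
    fix x assume x: "x \<in> torus N"
    show "(g x + h x) * alt N x = (\<Sum>l\<in>?L. (\<Phi> l + \<Psi> l) * laurent_mono N l x)"
      using alt_expansion_sum[OF assms(1) fin _ x] alt_expansion_sum[OF assms(2) fin _ x]
      by (simp add: distrib_right sum.distrib)
  qed auto
qed

lemma alt_expansion_scale:
  assumes "alt_expansion N g \<Phi>"
  shows "alt_expansion N (\<lambda>x. c * g x) (\<lambda>l. c * \<Phi> l)"
proof -
  let ?L = "{l. \<Phi> l \<noteq> 0}"
  have fin: "finite ?L" using assms by (auto simp: alt_expansion_def)
  show ?thesis
  proof (rule reprI[OF fin])
    show "l r = 0" if "l \<in> ?L" "r \<ge> N" for l r using that assms by (auto simp: alt_expansion_def)
    fix x assume x: "x \<in> torus N"
    show "c * g x * alt N x = (\<Sum>l\<in>?L. c * \<Phi> l * laurent_mono N l x)"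
      using alt_expansion_sum[OF assms fin _ x] by (simp add: sum_distrib_left mult.assoc)
  qed auto
qed

lemma alt_expansion_family:
  assumes K: "finite K" and w: "\<And>k r. k \<in> K \<Longrightarrow> r \<ge> N \<Longrightarrow> w k r = 0"
    and eq: "\<And>x. x \<in> torus N \<Longrightarrow> g x * alt N x = (\<Sum>k\<in>K. c k * laurent_mono N (w k) x)"
  shows "alt_expansion N g (\<lambda>l. \<Sum>k\<in>K. if w k = l then c k else 0)"
proof (rule reprI[of "w ` K"])
  fix x assume x: "x \<in> torus N"
  have "(\<Sum>l\<in>w ` K. (\<Sum>k\<in>K. if w k = l then c k else 0) * laurent_mono N l x)
     = (\<Sum>l\<in>w ` K. \<Sum>k\<in>K. if w k = l then c k * laurent_mono N l x else 0)"
    by (simp add: sum_distrib_right if_distrib[where f = "\<lambda>z. z * _"] cong: if_cong)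
  also have "\<dots> = (\<Sum>k\<in>K. \<Sum>l\<in>w ` K. if w k = l then c k * laurent_mono N l x else 0)"
    by (rule sum.swap)
  also have "\<dots> = (\<Sum>k\<in>K. c k * laurent_mono N (w k) x)"
    using K by (intro sum.cong refl) (simp add: sum.delta)
  finally show "g x * alt N x = (\<Sum>l\<in>w ` K. (\<Sum>k\<in>K. if w k = l then c k else 0) * laurent_mono N l x)"
    using eq[OF x] by simp
next
  fix l assume "l \<notin> w ` K"
  then show "(\<Sum>k\<in>K. if w k = l then c k else 0) = 0" by (intro sum.neutral) auto
qed (use K w in auto)

definition alt_index :: "nat \<Rightarrow> 'i set \<Rightarrow> (('i \<Rightarrow> nat) \<times> (nat \<Rightarrow> nat)) set" where
  "alt_index N I = (I \<rightarrow>\<^sub>E {..<N}) \<times> {\<tau>. \<tau> permutes {..<N}}"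

definition alt_coeff :: "nat \<Rightarrow> 'i set \<Rightarrow> ('i \<Rightarrow> int) \<Rightarrow> (nat \<Rightarrow> int) \<Rightarrow> complex" where
  "alt_coeff N I a l = (\<Sum>(\<phi>, \<tau>)\<in>alt_index N I. if exponents N I a \<tau> \<phi> = l then of_int (sign \<tau>) else 0)"

lemma finite_alt_index: "finite I \<Longrightarrow> finite (alt_index N I)"
  unfolding alt_index_def by (intro finite_cartesian_product finite_PiE) (auto intro: finite_permutations)

lemma alt_expansion_base:
  assumes I: "finite I"
  shows "alt_expansion N (\<lambda>x. \<Prod>i\<in>I. psum N (a i) x) (alt_coeff N I a)"
proof -
  have "alt_expansion N (\<lambda>x. \<Prod>i\<in>I. psum N (a i) x)
     (\<lambda>l. \<Sum>k\<in>alt_index N I. if (case k of (\<phi>, \<tau>) \<Rightarrow> exponents N I a \<tau> \<phi>) = l then (case k of (\<phi>, \<tau>) \<Rightarrow> of_int (sign \<tau>)) else 0)"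
  proof (rule alt_expansion_family[OF finite_alt_index[OF I]])
    fix x assume "x \<in> torus N"
    from psum_prod_alt[OF this I, of a]
    show "(\<Prod>i\<in>I. psum N (a i) x) * alt N x =
       (\<Sum>k\<in>alt_index N I. (case k of (\<phi>, \<tau>) \<Rightarrow> of_int (sign \<tau>)) * laurent_mono N (case k of (\<phi>, \<tau>) \<Rightarrow> exponents N I a \<tau> \<phi>) x)"
      by (simp add: alt_index_def sum.cartesian_product case_prod_unfold)
  qed (auto simp: exponents_def)
  then show ?thesis by (simp add: alt_coeff_def[abs_def] case_prod_unfold cong: if_cong)
qed

lemma alt_expansion_radial_laplacian:
  assumes I: "finite (I :: (nat + nat) set)" and a0: "(\<Sum>i\<in>I. a i) = 0"
  shows "alt_expansion N (radial_laplacian N I a) (\<lambda>l. of_int (energy N l - energy N int) * alt_coeff N I a l)"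
proof -
  let ?w = "\<lambda>k. case k of (\<phi>, \<tau>) \<Rightarrow> exponents N I a \<tau> \<phi>"
  let ?c = "\<lambda>k. case k of (\<phi>, \<tau>) \<Rightarrow> of_int (sign \<tau>) * of_int (energy N (exponents N I a \<tau> \<phi>) - energy N int)"
  have "alt_expansion N (radial_laplacian N I a) (\<lambda>l. \<Sum>k\<in>alt_index N I. if ?w k = l then ?c k else 0)"
  proof (rule alt_expansion_family[OF finite_alt_index[OF I]])
    fix x assume x: "x \<in> torus N"
    have "(\<lambda>x. radial_laplacian N I a x * alt N x) x = (\<lambda>x. \<Sum>k\<in>alt_index N I. ?c k * laurent_mono N (?w k) x) x"
    proof (rule torus_dense_eq[OF x])
      show "path_continuous N (\<lambda>x. radial_laplacian N I a x * alt N x)"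
        by (intro path_continuous_mult path_continuous_alt path_continuous_symspan symspan_radial_laplacian assms)
      show "path_continuous N (\<lambda>x. \<Sum>k\<in>alt_index N I. ?c k * laurent_mono N (?w k) x)"
        by (intro path_continuous_sum path_continuous_mult path_continuous_const path_continuous_laurent_mono)
      show "radial_laplacian N I a y * alt N y = (\<Sum>k\<in>alt_index N I. ?c k * laurent_mono N (?w k) y)"
        if "y \<in> torus N" "inj_on y {..<N}" for y
        using radial_laplacian_alt[OF that I a0]
        by (simp add: alt_index_def sum.cartesian_product case_prod_unfold)
    qed
    then show "radial_laplacian N I a x * alt N x = (\<Sum>k\<in>alt_index N I. ?c k * laurent_mono N (?w k) x)" .
  qed (auto simp: exponents_def)
  also have "(\<lambda>l. \<Sum>k\<in>alt_index N I. if ?w k = l then ?c k else 0)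
     = (\<lambda>l. of_int (energy N l - energy N int) * alt_coeff N I a l)"
    unfolding alt_coeff_def sum_distrib_left
    by (intro ext sum.cong refl) (auto simp: case_prod_unfold)
  finally show ?thesis .
qed

lemma sum_exponents:
  assumes \<tau>: "\<tau> permutes {..<N}" and I: "finite I" and \<phi>: "\<phi> \<in> I \<rightarrow>\<^sub>E {..<N}"
  shows "(\<Sum>r<N. exponents N I a \<tau> \<phi> r) = (\<Sum>r<N. int r) + (\<Sum>i\<in>I. a i)"
proof -
  have "(\<Sum>r<N. exponents N I a \<tau> \<phi> r) = (\<Sum>r<N. int (\<tau> r)) + (\<Sum>r<N. \<Sum>i\<in>I. if \<phi> i = r then a i else 0)"
    by (simp add: exponents_def sum.distrib)
  also have "(\<Sum>r<N. int (\<tau> r)) = (\<Sum>r<N. int r)"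
    by (rule sum.reindex_bij_betw[OF permutes_imp_bij[OF \<tau>]])
  also have "(\<Sum>r<N. \<Sum>i\<in>I. if \<phi> i = r then a i else 0) = (\<Sum>i\<in>I. a i)"
    using \<phi> by (subst sum.swap) (auto simp: sum.delta PiE_iff intro!: sum.cong)
  finally show ?thesis .
qed

text \<open>The quadratic \<open>j (j - (N - 1))\<close> is nonpositive at \<open>0, \<dots>, N - 1\<close> and positive at all other integers, so
  exchanging an element of the range for an element outside it increases the sum.\<close>

lemma int_set_eq_range:
  fixes S :: "int set"
  assumes S: "finite S" "card S = N" and s1: "\<Sum>S = (\<Sum>r<N. int r)" and s2: "(\<Sum>s\<in>S. s\<^sup>2) = (\<Sum>r<N. (int r)\<^sup>2)"
  shows "S = int ` {..<N}"
proof -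
  let ?D = "int ` {..<N}"
  let ?f = "\<lambda>j::int. j * (j - (int N - 1))"
  have D: "finite ?D" "card ?D = N" by (auto simp: card_image)
  have "sum ?f S = sum ?f ?D"
  proof -
    have "sum ?f S = (\<Sum>s\<in>S. s\<^sup>2) - (int N - 1) * \<Sum>S"
      by (simp add: algebra_simps power2_eq_square sum.distrib sum_subtractf sum_distrib_left)
    also have "\<dots> = sum ?f ?D"
      unfolding s1 s2
      by (simp add: sum.reindex algebra_simps power2_eq_square sum.distrib sum_subtractf sum_distrib_left)
    finally show ?thesis .
  qed
  moreover have "sum ?f S = sum ?f (S - ?D) + sum ?f (S \<inter> ?D)"
    by (subst sum.Int_Diff[OF S(1), of ?f ?D]) (rule add.commute)
  moreover have "sum ?f ?D = sum ?f (?D - S) + sum ?f (S \<inter> ?D)"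
    by (subst sum.Int_Diff[OF D(1), of ?f S], subst Int_commute[of ?D S]) (rule add.commute)
  ultimately have eq: "sum ?f (S - ?D) = sum ?f (?D - S)" by simp
  have pos: "?f j > 0" if "j \<in> S - ?D" for j
  proof -
    have "j < 0 \<or> j \<ge> int N"
    proof (rule ccontr)
      assume "\<not> ?thesis"
      then have "j = int (nat j)" "nat j < N" by auto
      then show False using that by blast
    qed
    moreover have "int N \<ge> 1" using that S by (cases N) auto
    ultimately show ?thesis
    proof (elim disjE)
      assume "j < 0"
      then show ?thesis using \<open>int N \<ge> 1\<close> by (intro mult_neg_neg) auto
    next
      assume "j \<ge> int N"
      then show ?thesis using \<open>int N \<ge> 1\<close> by (intro mult_pos_pos) auto
    qed
  qed
  have "sum ?f (?D - S) \<le> 0"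
    by (intro sum_nonpos) (auto intro!: mult_nonneg_nonpos)
  then have "S - ?D = {}"
    using eq sum_pos[of "S - ?D" ?f] pos S(1) by (metis finite_Diff not_le)
  then have "S \<subseteq> ?D" by auto
  then show ?thesis by (rule card_subset_eq[OF D(1)]) (simp only: D(2) S(2))
qed

text \<open>The properties of Haar integration, read on functions of the eigenvalues, that determine it on
  \<^const>\<open>symspan\<close>.\<close>

locale weyl_functional =
  fixes N :: nat and E :: "((nat \<Rightarrow> complex) \<Rightarrow> complex) \<Rightarrow> complex"
  assumes E_add: "\<And>g h. symspan N g \<Longrightarrow> symspan N h \<Longrightarrow> E (\<lambda>x. g x + h x) = E g + E h"
    and E_scale: "\<And>g c. symspan N g \<Longrightarrow> E (\<lambda>x. c * g x) = c * E g"
    and E_cong: "\<And>g h. (\<And>x. x \<in> torus N \<Longrightarrow> g x = h x) \<Longrightarrow> E g = E h"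
    and E_one: "E (\<lambda>x. 1) = 1"
    and E_loop: "\<And>m (L :: (nat + nat) set) a. finite L \<Longrightarrow> m + (\<Sum>i\<in>L. a i) = 0 \<Longrightarrow> E (loop_term N m L a) = 0"
begin

lemma E_zero: "E (\<lambda>x. 0) = 0"
  using E_scale[OF symspan_const, of 0 0] by simp

lemma E_sum: "finite J \<Longrightarrow> (\<And>j. j \<in> J \<Longrightarrow> symspan N (g j)) \<Longrightarrow> E (\<lambda>x. \<Sum>j\<in>J. g j x) = (\<Sum>j\<in>J. E (g j))"
  by (induction J rule: finite_induct) (auto simp: E_zero E_add symspan_sum)

lemma E_radial_laplacian:
  assumes I: "finite (I :: (nat + nat) set)" and a0: "(\<Sum>i\<in>I. a i) = 0"
  shows "E (radial_laplacian N I a) = 0"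
proof -
  have s: "a i + sum a (I - {i}) = 0" if "i \<in> I" for i
    using that assms by (simp add: sum.remove)
  have "E (radial_laplacian N I a) = (\<Sum>i\<in>I. E (\<lambda>x. of_int (a i) * loop_term N (a i) (I - {i}) a x))"
    unfolding radial_laplacian_def[abs_def] using s I
    by (intro E_sum symspan.scale symspan_loop_term) auto
  also have "\<dots> = 0"
    using s I by (intro sum.neutral ballI) (simp add: E_scale symspan_loop_term E_loop)
  finally show ?thesis .
qed

lemma radial_laplacian_exists:
  assumes "symspan N g"
  shows "\<exists>\<Phi> g'. alt_expansion N g \<Phi> \<and> (\<forall>l. \<Phi> l \<noteq> 0 \<longrightarrow> (\<Sum>r<N. l r) = (\<Sum>r<N. int r)) \<and>
    symspan N g' \<and> E g' = 0 \<and> alt_expansion N g' (\<lambda>l. of_int (energy N l - energy N int) * \<Phi> l)"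
  using assms
proof (induction rule: symspan.induct)
  case (base I a)
  have "(\<Sum>r<N. l r) = (\<Sum>r<N. int r)" if "alt_coeff N I a l \<noteq> 0" for l
  proof -
    from that obtain k where k: "k \<in> alt_index N I" "(case k of (\<phi>, \<tau>) \<Rightarrow> if exponents N I a \<tau> \<phi> = l then of_int (sign \<tau>) else (0::complex)) \<noteq> 0"
      unfolding alt_coeff_def by (rule sum.not_neutral_contains_not_neutral)
    obtain \<phi> \<tau> where "k = (\<phi>, \<tau>)" by (cases k)
    with k have "(\<phi>, \<tau>) \<in> alt_index N I" "exponents N I a \<tau> \<phi> = l"
      by (auto split: if_splits)
    then show ?thesis using sum_exponents[of \<tau> N I \<phi> a] base by (auto simp: alt_index_def)
  qed
  then show ?case
    using alt_expansion_base[OF base(1), of N a] alt_expansion_radial_laplacian[OF base] symspan_radial_laplacian[OF base] E_radial_laplacian[OF base]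
    by blast
next
  case (add g h)
  then obtain \<Phi> g' \<Psi> h' where
    1: "alt_expansion N g \<Phi>" "\<forall>l. \<Phi> l \<noteq> 0 \<longrightarrow> (\<Sum>r<N. l r) = (\<Sum>r<N. int r)" "symspan N g'" "E g' = 0"
      "alt_expansion N g' (\<lambda>l. of_int (energy N l - energy N int) * \<Phi> l)" and
    2: "alt_expansion N h \<Psi>" "\<forall>l. \<Psi> l \<noteq> 0 \<longrightarrow> (\<Sum>r<N. l r) = (\<Sum>r<N. int r)" "symspan N h'" "E h' = 0"
      "alt_expansion N h' (\<lambda>l. of_int (energy N l - energy N int) * \<Psi> l)"
    by blast
  show ?case
    by (rule exI[of _ "\<lambda>l. \<Phi> l + \<Psi> l"], rule exI[of _ "\<lambda>x. g' x + h' x"])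
       (use 1 2 alt_expansion_add[OF 1(1) 2(1)] alt_expansion_add[OF 1(5) 2(5)] in
         \<open>auto simp: E_add distrib_left intro: symspan.add\<close>, metis add_0)
next
  case (scale g c)
  then obtain \<Phi> g' where
    1: "alt_expansion N g \<Phi>" "\<forall>l. \<Phi> l \<noteq> 0 \<longrightarrow> (\<Sum>r<N. l r) = (\<Sum>r<N. int r)" "symspan N g'" "E g' = 0"
      "alt_expansion N g' (\<lambda>l. of_int (energy N l - energy N int) * \<Phi> l)"
    by blast
  show ?case
    by (rule exI[of _ "\<lambda>l. c * \<Phi> l"], rule exI[of _ "\<lambda>x. c * g' x"])
       (use 1 alt_expansion_scale[OF 1(1), of c] alt_expansion_scale[OF 1(5), of c] in
         \<open>auto simp: E_scale mult_ac intro: symspan.scale\<close>)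
qed

lemma radial_laplacian_alt_expansion:
  assumes "symspan N g" "alt_expansion N g \<Phi>"
  obtains g' where "symspan N g'" "E g' = 0" "alt_expansion N g' (\<lambda>l. of_int (energy N l - energy N int) * \<Phi> l)"
    "\<And>l. \<Phi> l \<noteq> 0 \<Longrightarrow> (\<Sum>r<N. l r) = (\<Sum>r<N. int r)"
proof -
  from radial_laplacian_exists[OF assms(1)] obtain \<Psi> g' where *: "alt_expansion N g \<Psi>"
    "\<forall>l. \<Psi> l \<noteq> 0 \<longrightarrow> (\<Sum>r<N. l r) = (\<Sum>r<N. int r)" "symspan N g'" "E g' = 0"
    "alt_expansion N g' (\<lambda>l. of_int (energy N l - energy N int) * \<Psi> l)" by blast
  have "\<Psi> = \<Phi>" by (rule alt_expansion_unique[OF *(1) assms(2)])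
  then show ?thesis using *(2-5) by (intro that[of g']) simp_all
qed

text \<open>Subtracting \<open>1/s\<close> times the Casimir operator does not change \<open>E\<close>, and multiplies the coefficient of a
  monomial of relative energy \<open>e\<close> by \<open>1 - e/s\<close>, which is \<open>0\<close> for \<open>e = s\<close> and \<open>1\<close> for \<open>e = 0\<close>.\<close>

lemma kill_eigenvalues:
  assumes "finite S" "0 \<notin> S" "symspan N g" "alt_expansion N g \<Phi>"
  shows "\<exists>g'. symspan N g' \<and> E g' = E g \<and>
     alt_expansion N g' (\<lambda>l. (\<Prod>s\<in>S. 1 - of_int (energy N l - energy N int) / of_int s) * \<Phi> l)"
  using assms
proof (induction S rule: finite_induct)
  case empty
  then show ?case by auto
next
  case (insert s S)
  then obtain g' where g': "symspan N g'" "E g' = E g"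
     "alt_expansion N g' (\<lambda>l. (\<Prod>s\<in>S. 1 - of_int (energy N l - energy N int) / of_int s) * \<Phi> l)" (is "alt_expansion N g' ?\<Psi>")
    by auto
  obtain h where h: "symspan N h" "E h = 0"
    "alt_expansion N h (\<lambda>l. of_int (energy N l - energy N int) * ?\<Psi> l)"
    by (rule radial_laplacian_alt_expansion[OF g'(1,3)])
  have "alt_expansion N (\<lambda>x. g' x + (- 1 / of_int s) * h x)
    (\<lambda>l. ?\<Psi> l + (- 1 / of_int s) * (of_int (energy N l - energy N int) * ?\<Psi> l))"
    by (intro alt_expansion_add alt_expansion_scale g' h)
  moreover have "(\<lambda>l. ?\<Psi> l + (- 1 / of_int s) * (of_int (energy N l - energy N int) * ?\<Psi> l)) =
     (\<lambda>l. (\<Prod>s\<in>insert s S. 1 - of_int (energy N l - energy N int) / of_int s) * \<Phi> l)"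
  proof -
    have "P * F + (- 1 / z) * (d * (P * F)) = (1 - d / z) * P * F" for P F d z :: complex
      by (simp add: algebra_simps)
    then show ?thesis by (simp only: prod.insert[OF insert.hyps])
  qed
  moreover have "symspan N (\<lambda>x. g' x + (- 1 / of_int s) * h x)"
    by (intro symspan.add symspan.scale g' h)
  moreover have "E (\<lambda>x. g' x + (- 1 / of_int s) * h x) = E g"
    by (simp only: E_add[OF g'(1) symspan.scale[OF h(1)]] E_scale[OF h(1)] h(2) g'(2)) simp
  ultimately show ?case by (intro exI[of _ "\<lambda>x. g' x + (- 1 / of_int s) * h x"]) simp
qed

lemma alt_expansion_antisym:
  assumes "symspan N g" "alt_expansion N g \<Phi>" "p permutes {..<N}"
  shows "\<Phi> (l \<circ> p) = of_int (sign p) * \<Phi> l"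
proof -
  let ?L = "{l. \<Phi> l \<noteq> 0}"
  let ?q = "Hilbert_Choice.inv p"
  have q: "?q permutes {..<N}" using assms(3) by (rule permutes_inv)
  have qq: "Hilbert_Choice.inv ?q = p" using assms(3) by (simp add: inv_inv_eq permutes_bij)
  have fin: "finite ?L" using assms by (auto simp: alt_expansion_def)
  have comp: "(m \<circ> ?q) \<circ> p = m" "(m \<circ> p) \<circ> ?q = m" for m :: "nat \<Rightarrow> int"
    using permutes_inverses[OF assms(3)] by (auto simp: fun_eq_iff)
  have inj: "inj_on (\<lambda>m. m \<circ> p) ?L" by (rule inj_on_inverseI[where g = "\<lambda>m. m \<circ> ?q"]) (simp add: comp)
  have "alt_expansion N g (\<lambda>m. of_int (sign p) * \<Phi> (m \<circ> ?q))"
  proof (rule reprI[of "(\<lambda>m. m \<circ> p) ` ?L"])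
    show "finite ((\<lambda>m. m \<circ> p) ` ?L)" using fin by simp
    show "of_int (sign p) * \<Phi> (m \<circ> ?q) = 0" if "m \<notin> (\<lambda>m. m \<circ> p) ` ?L" for m
    proof -
      have "\<Phi> (m \<circ> ?q) = 0"
      proof (rule ccontr)
        assume "\<Phi> (m \<circ> ?q) \<noteq> 0"
        then have "(m \<circ> ?q) \<circ> p \<in> (\<lambda>m. m \<circ> p) ` ?L" by blast
        then show False using that by (simp only: comp)
      qed
      then show ?thesis by simp
    qed
    show "m r = 0" if m: "m \<in> (\<lambda>m. m \<circ> p) ` ?L" and r: "r \<ge> N" for m r
      using m r assms(2) permutes_not_in[OF assms(3), of r] by (auto simp: alt_expansion_def)
    fix x assume x: "x \<in> torus N"
    then have x': "x \<circ> ?q \<in> torus N"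
      using permutes_in_image[OF q] by (auto simp: torus_def)
    have "g x * alt N x = of_int (sign p) * (g (x \<circ> ?q) * alt N (x \<circ> ?q))"
      using symspan_permute[OF assms(1) q] alt_permute[OF q] sign_inverse[of p]
        permutes_imp_permutation[OF _ assms(3)]
      by (simp add: mult_ac) (metis (no_types, lifting) mult.assoc mult_1 of_int_1 of_int_mult sign_idempotent)
    also have "g (x \<circ> ?q) * alt N (x \<circ> ?q) = (\<Sum>m\<in>?L. \<Phi> m * laurent_mono N m (x \<circ> ?q))"
      using alt_expansion_sum[OF assms(2) fin _ x'] by auto
    also have "\<dots> = (\<Sum>m\<in>?L. \<Phi> m * laurent_mono N (m \<circ> p) x)"
      by (simp add: laurent_mono_permute[OF q] qq)
    also have "of_int (sign p) * \<dots> = (\<Sum>m\<in>(\<lambda>m. m \<circ> p) ` ?L. of_int (sign p) * \<Phi> (m \<circ> ?q) * laurent_mono N m x)"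
      by (subst sum.reindex[OF inj]) (simp add: comp sum_distrib_left mult.assoc o_assoc[symmetric] permutes_inv_o[OF assms(3)])
    finally show "g x * alt N x = (\<Sum>m\<in>(\<lambda>m. m \<circ> p) ` ?L. of_int (sign p) * \<Phi> (m \<circ> ?q) * laurent_mono N m x)" .
  qed
  from alt_expansion_unique[OF assms(2) this] have "\<Phi> (l \<circ> p) = of_int (sign p) * \<Phi> ((l \<circ> p) \<circ> ?q)" by metis
  then show ?thesis by (simp only: comp)
qed

text \<open>Remove all monomials of nonzero relative energy. By antisymmetry the exponents of a remaining monomial are
  distinct; they have the same sum and the same sum of squares as \<open>\<delta>\<close>, hence they are a permutation of it.
  So what remains of \<open>g \<cdot> alt\<close> is a multiple of the alternant, \<open>g\<close> has become constant, and the
  constant is the coefficient of \<open>x^\<delta>\<close>, which never changed.\<close>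

theorem E_eq_coeff:
  assumes g: "symspan N g" "alt_expansion N g \<Phi>"
  shows "E g = \<Phi> (\<lambda>r. if r < N then int r else 0)"
proof -
  let ?\<delta> = "\<lambda>r. if r < N then int r else 0"
  let ?e = "\<lambda>l. energy N l - energy N int"
  define S where "S = ?e ` {l. \<Phi> l \<noteq> 0} - {0}"
  have fin: "finite {l. \<Phi> l \<noteq> 0}" using g by (auto simp: alt_expansion_def)
  have S: "finite S" "0 \<notin> S" using fin by (auto simp: S_def)
  define \<Psi> where "\<Psi> = (\<lambda>l. (\<Prod>s\<in>S. 1 - of_int (?e l) / of_int s) * \<Phi> l)"
  from kill_eigenvalues[OF S g] obtain h where h: "symspan N h" "E h = E g" "alt_expansion N h \<Psi>"
    unfolding \<Psi>_def by blast
  have deg: "(\<Sum>r<N. l r) = (\<Sum>r<N. int r)" if "\<Phi> l \<noteq> 0" for l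
  proof -
    have "\<forall>l. \<Phi> l \<noteq> 0 \<longrightarrow> (\<Sum>r<N. l r) = (\<Sum>r<N. int r)" by (rule radial_laplacian_alt_expansion[OF g]) blast
    then show ?thesis using that by blast
  qed
  have \<Psi>\<delta>: "\<Psi> ?\<delta> = \<Phi> ?\<delta>"
  proof -
    have "energy N ?\<delta> = energy N int" by (simp add: energy_def)
    then show ?thesis by (simp add: \<Psi>_def)
  qed
  have e0: "?e l = 0" if "\<Psi> l \<noteq> 0" for l
  proof (rule ccontr)
    assume "?e l \<noteq> 0"
    moreover have "\<Phi> l \<noteq> 0" using that by (auto simp: \<Psi>_def)
    ultimately have "?e l \<in> S" by (auto simp: S_def)
    then have "(\<Prod>s\<in>S. 1 - of_int (?e l) / of_int s) = (0::complex)"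
      using S \<open>?e l \<noteq> 0\<close> by (intro prod_zero) (auto intro!: bexI[of _ "?e l"])
    then show False using that by (simp add: \<Psi>_def)
  qed
  let ?X = "{..<N}"
  have perm: "\<exists>\<tau>. \<tau> permutes ?X \<and> l = ?\<delta> \<circ> \<tau>" if l: "\<Psi> l \<noteq> 0" for l
  proof -
    have \<Phi>l: "\<Phi> l \<noteq> 0" using l by (auto simp: \<Psi>_def)
    have out: "l r = 0" if "r \<ge> N" for r using g(2) \<Phi>l that by (auto simp: alt_expansion_def)
    have inj: "inj_on l ?X"
    proof (rule inj_onI, rule ccontr)
      fix r q assume rq: "r \<in> ?X" "q \<in> ?X" "l r = l q" "r \<noteq> q"
      have "l \<circ> Transposition.transpose r q = l" using rq by (auto simp: fun_eq_iff Transposition.transpose_def)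
      moreover have "Transposition.transpose r q permutes ?X" using rq by (intro permutes_swap_id) auto
      ultimately have "\<Phi> l = - \<Phi> l"
        using alt_expansion_antisym[OF g, of "Transposition.transpose r q" l] rq by (simp add: sign_swap_id)
      then show False using \<Phi>l by simp
    qed
    have "l ` ?X = int ` ?X"
    proof (rule int_set_eq_range)
      show "card (l ` ?X) = N" using inj by (simp add: card_image)
      show "\<Sum>(l ` ?X) = (\<Sum>r<N. int r)" using deg[OF \<Phi>l] by (simp add: sum.reindex[OF inj])
      show "(\<Sum>s\<in>l ` ?X. s\<^sup>2) = (\<Sum>r<N. (int r)\<^sup>2)"
        using e0[OF l] by (simp add: sum.reindex[OF inj] energy_def)
    qed simp
    define \<tau> where "\<tau> = (\<lambda>r. if r < N then nat (l r) else r)"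
    have nn: "l r = int (\<tau> r) \<and> \<tau> r < N" if "r < N" for r
    proof -
      have "l r \<in> int ` ?X" using that \<open>l ` ?X = int ` ?X\<close> by blast
      then show ?thesis using that by (auto simp: \<tau>_def)
    qed
    have "inj_on \<tau> ?X" using inj nn by (metis inj_on_def lessThan_iff)
    moreover have "\<tau> ` ?X \<subseteq> ?X" using nn by auto
    ultimately have "bij_betw \<tau> ?X ?X"
      by (metis bij_betw_def endo_inj_surj finite_lessThan)
    then have "\<tau> permutes ?X"
      by (rule bij_imp_permutes) (simp add: \<tau>_def)
    moreover have "l = ?\<delta> \<circ> \<tau>"
      using nn out by (auto simp: fun_eq_iff \<tau>_def)
    ultimately show ?thesis by blast
  qed
  have inj\<delta>: "inj_on (\<lambda>\<tau>. ?\<delta> \<circ> \<tau>) {\<tau>. \<tau> permutes ?X}"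
  proof (rule inj_onI)
    fix \<tau> \<tau>' assume a: "\<tau> \<in> {\<tau>. \<tau> permutes ?X}" "\<tau>' \<in> {\<tau>. \<tau> permutes ?X}" "?\<delta> \<circ> \<tau> = ?\<delta> \<circ> \<tau>'"
    show "\<tau> = \<tau>'"
    proof
      fix r show "\<tau> r = \<tau>' r"
      proof (cases "r < N")
        case True
        then have "\<tau> r < N" "\<tau>' r < N" using a(1,2) permutes_in_image by fastforce+
        then show ?thesis using fun_cong[OF a(3), of r] by simp
      next
        case False
        then show ?thesis using a permutes_not_in by (metis lessThan_iff mem_Collect_eq)
      qed
    qed
  qed
  have main: "h x * alt N x = \<Phi> ?\<delta> * alt N x" if x: "x \<in> torus N" for x
  proof -
    have "h x * alt N x = (\<Sum>l\<in>(\<lambda>\<tau>. ?\<delta> \<circ> \<tau>) ` {\<tau>. \<tau> permutes ?X}. \<Psi> l * laurent_mono N l x)"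
      by (rule alt_expansion_sum[OF h(3) _ _ x]) (use perm in \<open>auto simp: finite_permutations\<close>)
    also have "\<dots> = (\<Sum>\<tau> | \<tau> permutes ?X. \<Psi> (?\<delta> \<circ> \<tau>) * laurent_mono N (?\<delta> \<circ> \<tau>) x)"
      by (simp add: sum.reindex[OF inj\<delta>])
    also have "\<dots> = (\<Sum>\<tau> | \<tau> permutes ?X. \<Psi> ?\<delta> * (of_int (sign \<tau>) * laurent_mono N (\<lambda>r. int (\<tau> r)) x))"
    proof (rule sum.cong[OF refl])
      fix \<tau> assume "\<tau> \<in> {\<tau>. \<tau> permutes ?X}"
      then have \<tau>: "\<tau> permutes ?X" by simp
      have "laurent_mono N (?\<delta> \<circ> \<tau>) x = laurent_mono N (\<lambda>r. int (\<tau> r)) x"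
        using permutes_in_image[OF \<tau>] by (intro laurent_mono_cong) auto
      then show "\<Psi> (?\<delta> \<circ> \<tau>) * laurent_mono N (?\<delta> \<circ> \<tau>) x = \<Psi> ?\<delta> * (of_int (sign \<tau>) * laurent_mono N (\<lambda>r. int (\<tau> r)) x)"
        using alt_expansion_antisym[OF h(1,3) \<tau>, of ?\<delta>] by simp
    qed
    also have "\<dots> = \<Phi> ?\<delta> * alt N x"
      unfolding \<Psi>\<delta> alt_def by (simp add: sum_distrib_left)
    finally show ?thesis .
  qed
  have hc: "h x = \<Phi> ?\<delta>" if x: "x \<in> torus N" for x
  proof -
    have "h x = (\<lambda>_. \<Phi> ?\<delta>) x"
    proof (rule torus_dense_eq[OF x path_continuous_symspan[OF h(1)] path_continuous_const])
      fix y assume "y \<in> torus N" "inj_on y {..<N}"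
      then show "h y = \<Phi> ?\<delta>" using main[of y] alt_nonzero[of y N] by simp
    qed
    then show ?thesis .
  qed
  have "E g = E (\<lambda>x. \<Phi> ?\<delta> * 1)" unfolding h(2)[symmetric] by (rule E_cong) (simp add: hc)
  also have "\<dots> = \<Phi> ?\<delta>" using E_scale[OF symspan_const, of "\<Phi> ?\<delta>" 1] E_one by simp
  finally show ?thesis .
qed

lemma E_psum_prod:
  assumes I: "finite (I :: (nat + nat) set)" and a0: "(\<Sum>i\<in>I. a i) = 0"
  shows "E (\<lambda>x. \<Prod>i\<in>I. psum N (a i) x) = alt_coeff N I a (\<lambda>r. if r < N then int r else 0)"
  by (rule E_eq_coeff[OF symspan.base[OF assms] alt_expansion_base[OF I]])

end

section \<open>Unitary matrices\<close>

lemma mult_index: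
  "A \<in> carrier_mat N N \<Longrightarrow> B \<in> carrier_mat N N \<Longrightarrow> i < N \<Longrightarrow> j < N \<Longrightarrow>
    (A * B) $$ (i, j) = (\<Sum>k<N. A $$ (i, k) * B $$ (k, j))"
  by (simp add: scalar_prod_def atLeast0LessThan)

lemma adjoint_carrier: "A \<in> carrier_mat N N \<Longrightarrow> mat_adjoint A \<in> carrier_mat N N"
  by (auto simp: mat_adjoint_def)

lemma adjoint_index:
  "(A :: complex mat) \<in> carrier_mat N N \<Longrightarrow> i < N \<Longrightarrow> j < N \<Longrightarrow> mat_adjoint A $$ (i, j) = cnj (A $$ (j, i))"
  by (auto simp: mat_adjoint_def mat_of_rows_index conjugate_complex_def)

lemma adjoint_adjoint: "(A :: complex mat) \<in> carrier_mat N N \<Longrightarrow> mat_adjoint (mat_adjoint A) = A"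
  by (rule eq_matI) (use adjoint_carrier[of A N] adjoint_carrier[of "mat_adjoint A" N] in
     \<open>auto simp: adjoint_index[of _ N]\<close>)

lemma adjoint_mult:
  assumes "(A :: complex mat) \<in> carrier_mat N N" "B \<in> carrier_mat N N"
  shows "mat_adjoint (A * B) = mat_adjoint B * mat_adjoint A"
proof (rule eq_matI)
  note c = assms adjoint_carrier[OF assms(1)] adjoint_carrier[OF assms(2)]
  fix i j assume "i < dim_row (mat_adjoint B * mat_adjoint A)" "j < dim_col (mat_adjoint B * mat_adjoint A)"
  then have "i < N" "j < N" using c by auto
  then show "mat_adjoint (A * B) $$ (i, j) = (mat_adjoint B * mat_adjoint A) $$ (i, j)"
    using c by (subst adjoint_index[of _ N], simp_all only: mult_carrier_mat mult_index)
      (simp_all add: adjoint_index mult_index[OF c(1,2)] mult_index[OF c(4,3)] mult.commute del: index_mult_mat)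
qed (use assms adjoint_carrier[of A N] adjoint_carrier[of B N] adjoint_carrier[of "A * B" N] in auto)

lemma mat_trace_index: "A \<in> carrier_mat N N \<Longrightarrow> mat_trace A = (\<Sum>i<N. A $$ (i, i))"
  by (auto simp: mat_trace_def)

lemma mat_trace_commute:
  assumes "(A :: complex mat) \<in> carrier_mat N N" "B \<in> carrier_mat N N"
  shows "mat_trace (A * B) = mat_trace (B * A)"
proof -
  have "mat_trace (A * B) = (\<Sum>i<N. \<Sum>k<N. A $$ (i, k) * B $$ (k, i))"
    using assms by (simp add: mat_trace_index[of _ N] mult_index del: index_mult_mat)
  also have "\<dots> = (\<Sum>k<N. \<Sum>i<N. A $$ (i, k) * B $$ (k, i))"
    by (rule sum.swap)
  also have "\<dots> = mat_trace (B * A)"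
    using assms by (simp add: mat_trace_index[of _ N] mult_index mult.commute del: index_mult_mat)
  finally show ?thesis .
qed

lemma unitaryD:
  assumes "U \<in> unitary_group N"
  shows "U \<in> carrier_mat N N" "mat_adjoint U \<in> carrier_mat N N"
    "U * mat_adjoint U = 1\<^sub>m N" "mat_adjoint U * U = 1\<^sub>m N"
  using assms by (auto simp: unitary_group_def intro: adjoint_carrier)

lemma unitary_one: "1\<^sub>m N \<in> unitary_group N"
proof -
  have "mat_adjoint (1\<^sub>m N) = (1\<^sub>m N :: complex mat)"
  proof (rule eq_matI)
    fix i j assume "i < dim_row (1\<^sub>m N :: complex mat)" "j < dim_col (1\<^sub>m N :: complex mat)"
    then show "mat_adjoint (1\<^sub>m N) $$ (i, j) = (1\<^sub>m N :: complex mat) $$ (i, j)"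
      by (subst adjoint_index[of _ N]) auto
  qed (use adjoint_carrier[of "1\<^sub>m N :: complex mat" N] in auto)
  then show ?thesis by (simp add: unitary_group_def)
qed

lemma unitary_adjoint: "U \<in> unitary_group N \<Longrightarrow> mat_adjoint U \<in> unitary_group N"
  unfolding unitary_group_def mem_Collect_eq
  by (metis adjoint_adjoint adjoint_carrier)

lemma unitary_mult:
  assumes "U \<in> unitary_group N" "V \<in> unitary_group N"
  shows "U * V \<in> unitary_group N"
proof -
  note U = unitaryD[OF assms(1)] and V = unitaryD[OF assms(2)]
  have "(U * V) * (mat_adjoint V * mat_adjoint U) = U * (V * mat_adjoint V) * mat_adjoint U"
    using U(1,2) V(1,2) by (simp add: assoc_mult_mat[of _ N N _ N _ N])
  also have "\<dots> = 1\<^sub>m N" using U V by simp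
  finally have 1: "(U * V) * mat_adjoint (U * V) = 1\<^sub>m N"
    using U V by (simp add: adjoint_mult)
  have "(mat_adjoint V * mat_adjoint U) * (U * V) = mat_adjoint V * (mat_adjoint U * U) * V"
    using U(1,2) V(1,2) by (simp add: assoc_mult_mat[of _ N N _ N _ N])
  also have "\<dots> = 1\<^sub>m N" using U V by simp
  finally have 2: "mat_adjoint (U * V) * (U * V) = 1\<^sub>m N"
    using U V by (simp add: adjoint_mult)
  show ?thesis unfolding unitary_group_def using 1 2 U(1) V(1) by auto
qed

lemma unitary_row_norm:
  assumes "U \<in> unitary_group N" "i < N"
  shows "(\<Sum>j<N. (cmod (U $$ (i, j)))\<^sup>2) = 1"
proof -
  note U = unitaryD[OF assms(1)]
  have "complex_of_real (\<Sum>j<N. (cmod (U $$ (i, j)))\<^sup>2) = (\<Sum>j<N. U $$ (i, j) * cnj (U $$ (i, j)))"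
    by (simp only: of_real_sum complex_norm_square)
  also have "\<dots> = (U * mat_adjoint U) $$ (i, i)"
    using assms U(1,2) by (simp add: mult_index[of _ N] adjoint_index del: index_mult_mat)
  also have "\<dots> = 1" using U(3) assms by simp
  finally show ?thesis using of_real_eq_1_iff by blast
qed

lemma unitary_entry_le: 
  assumes "U \<in> unitary_group N" "i < N" "j < N"
  shows "cmod (U $$ (i, j)) \<le> 1"
proof -
  have "(cmod (U $$ (i, j)))\<^sup>2 \<le> (\<Sum>j<N. (cmod (U $$ (i, j)))\<^sup>2)"
    using assms by (intro member_le_sum) auto
  also have "\<dots> = 1" using unitary_row_norm assms by blast
  finally show ?thesis by (simp add: power2_le_iff_abs_le power_le_one_iff abs_square_le_1)
qed

text \<open>Integer powers of a unitary matrix, its adjoint being its inverse.\<close>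

definition ipow :: "complex mat \<Rightarrow> int \<Rightarrow> complex mat" where
  "ipow U a = (if 0 \<le> a then U ^\<^sub>m nat a else mat_adjoint U ^\<^sub>m nat (- a))"

lemma unitary_pow: "U \<in> unitary_group N \<Longrightarrow> U ^\<^sub>m n \<in> unitary_group N"
proof (induction n)
  case 0
  then show ?case using unitary_one unitaryD(1) by fastforce
next
  case (Suc n)
  then show ?case by (simp add: unitary_mult)
qed

lemma ipow_unitary: "U \<in> unitary_group N \<Longrightarrow> ipow U a \<in> unitary_group N"
  by (simp add: ipow_def unitary_pow unitary_adjoint)

lemma ipow_carrier: "U \<in> unitary_group N \<Longrightarrow> ipow U a \<in> carrier_mat N N"
  using ipow_unitary unitaryD by blast

lemma ipow_0: "U \<in> unitary_group N \<Longrightarrow> ipow U 0 = 1\<^sub>m N"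
  using unitaryD(1) by (fastforce simp: ipow_def)

lemma ipow_1: "U \<in> unitary_group N \<Longrightarrow> ipow U 1 = U"
  using unitaryD(1)[of U N] by (auto simp: ipow_def left_mult_one_mat)

lemma ipow_Suc:
  assumes "U \<in> unitary_group N"
  shows "ipow U (a + 1) = ipow U a * U"
proof (cases "a \<ge> 0")
  case True
  then have "nat (a + 1) = Suc (nat a)" by simp
  then show ?thesis using True by (simp add: ipow_def)
next
  case False
  note U = unitaryD[OF assms]
  define n where "n = nat (- a - 1)"
  have n: "nat (- a) = Suc n" "nat (- (a + 1)) = n" using False by (auto simp: n_def)
  have P: "mat_adjoint U ^\<^sub>m n \<in> carrier_mat N N" using U by simp
  have "ipow U a * U = mat_adjoint U ^\<^sub>m n * (mat_adjoint U * U)"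
    using False n U P by (simp add: ipow_def assoc_mult_mat[of _ N N _ N _ N])
  also have "\<dots> = mat_adjoint U ^\<^sub>m n" using U P by (simp add: right_mult_one_mat[of _ N N])
  also have "\<dots> = ipow U (a + 1)"
  proof (cases "a = -1")
    case True
    then have "n = 0" by (simp add: n_def)
    then show ?thesis using True U by (simp add: ipow_def)
  next
    case F: False
    then show ?thesis using False n by (simp add: ipow_def)
  qed
  finally show ?thesis by simp
qed

lemma ipow_pred:
  assumes "U \<in> unitary_group N"
  shows "ipow U (a - 1) = ipow U a * mat_adjoint U"
proof -
  note U = unitaryD[OF assms]
  have "ipow U a * mat_adjoint U = ipow U (a - 1) * U * mat_adjoint U"
    using ipow_Suc[OF assms, of "a - 1"] by simp
  also have "\<dots> = ipow U (a - 1) * (U * mat_adjoint U)"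
    using U(1,2) ipow_carrier[OF assms] by (simp add: assoc_mult_mat[of _ N N _ N _ N])
  also have "\<dots> = ipow U (a - 1)" using U(3) ipow_carrier[OF assms, of "a - 1"] by (simp add: right_mult_one_mat)
  finally show ?thesis by simp
qed

lemma ipow_add:
  assumes "U \<in> unitary_group N"
  shows "ipow U a * ipow U b = ipow U (a + b)"
proof (induction b rule: int_induct[where k = 0])
  case base
  then show ?case using ipow_0[OF assms] ipow_carrier[OF assms, of a] by (simp add: right_mult_one_mat)
next
  case (step1 b)
  have "ipow U a * ipow U (b + 1) = (ipow U a * ipow U b) * U"
    using ipow_Suc[OF assms] ipow_carrier[OF assms] unitaryD(1)[OF assms] by (simp add: assoc_mult_mat[of _ N N _ N _ N])
  also have "\<dots> = ipow U (a + (b + 1))" using step1 ipow_Suc[OF assms, of "a + b"] by (simp add: add.assoc)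
  finally show ?case .
next
  case (step2 b)
  have "ipow U a * ipow U (b - 1) = (ipow U a * ipow U b) * mat_adjoint U"
    using ipow_pred[OF assms] ipow_carrier[OF assms] unitaryD(2)[OF assms] by (simp add: assoc_mult_mat[of _ N N _ N _ N])
  also have "\<dots> = ipow U (a + (b - 1))" using step2 ipow_pred[OF assms, of "a + b"] by (simp add: algebra_simps)
  finally show ?case .
qed

lemma adjoint_pow: "(A :: complex mat) \<in> carrier_mat N N \<Longrightarrow> mat_adjoint (A ^\<^sub>m n) = mat_adjoint A ^\<^sub>m n \<and> A ^\<^sub>m n * A = A * A ^\<^sub>m n"
proof (induction n)
  case 0
  have "mat_adjoint (1\<^sub>m N) = (1\<^sub>m N :: complex mat)"
    using unitaryD(2,3)[OF unitary_one[of N]] by (simp add: left_mult_one_mat)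
  then show ?case using 0 adjoint_carrier[OF 0] by simp
next
  case (Suc n)
  then have IH: "mat_adjoint (A ^\<^sub>m n) = mat_adjoint A ^\<^sub>m n" "A ^\<^sub>m n * A = A * A ^\<^sub>m n" by auto
  have c: "A ^\<^sub>m n \<in> carrier_mat N N" using Suc.prems by simp
  have "mat_adjoint (A ^\<^sub>m Suc n) = mat_adjoint (A * A ^\<^sub>m n)" using IH by simp
  also have "\<dots> = mat_adjoint A ^\<^sub>m Suc n"
    using adjoint_mult[OF Suc.prems c] IH(1) by simp
  finally show ?case using IH(2) c Suc.prems by (simp add: assoc_mult_mat[of _ N N _ N _ N])
qed

lemma ipow_trace_uminus:
  assumes "U \<in> unitary_group N"
  shows "mat_trace (ipow U (- a)) = cnj (mat_trace (ipow U a))"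
proof -
  note U = unitaryD[OF assms]
  have nn: "mat_trace (mat_adjoint U ^\<^sub>m n) = cnj (mat_trace (U ^\<^sub>m n))" for n
  proof -
    have "mat_adjoint U ^\<^sub>m n = mat_adjoint (U ^\<^sub>m n)" using adjoint_pow[OF U(1)] by simp
    then show ?thesis
      using U(1,2) by (simp add: mat_trace_index[of _ N] adjoint_index[of _ N] adjoint_carrier)
  qed
  show ?thesis
  proof (cases "a = 0")
    case True
    then show ?thesis using U(1) by (simp add: ipow_def mat_trace_def)
  next
    case False
    then show ?thesis using nn[of "nat a"] nn[of "nat (- a)"] by (auto simp: ipow_def)
  qed
qed

lemma upper_triangular_pow:
  assumes "(B :: complex mat) \<in> carrier_mat N N" "upper_triangular B"
  shows "upper_triangular (B ^\<^sub>m n) \<and> (\<forall>i<N. (B ^\<^sub>m n) $$ (i, i) = B $$ (i, i) ^ n)"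
proof (induction n)
  case 0
  then show ?case using assms by auto
next
  case (Suc n)
  have c: "B ^\<^sub>m n \<in> carrier_mat N N" using assms by simp
  have z: "B $$ (i, j) = 0" "(B ^\<^sub>m n) $$ (i, j) = 0" if "j < i" "i < N" for i j
    using that assms Suc c by (auto dest: upper_triangularD)
  have e: "(B ^\<^sub>m Suc n) $$ (i, j) = (\<Sum>k<N. (B ^\<^sub>m n) $$ (i, k) * B $$ (k, j))" if "i < N" "j < N" for i j
    using mult_index[OF c assms(1) that] by simp
  show ?case
  proof (intro conjI allI impI upper_triangularI)
    fix i j assume ij: "j < i" "i < dim_row (B ^\<^sub>m Suc n)"
    then have "i < N" using assms by simp
    then have "(B ^\<^sub>m n) $$ (i, k) * B $$ (k, j) = 0" if "k < N" for k
      using z(1)[of j k] z(2)[of k i] ij that by (cases "k < i") auto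
    then have "(\<Sum>k<N. (B ^\<^sub>m n) $$ (i, k) * B $$ (k, j)) = 0" by (intro sum.neutral) auto
    then show "(B ^\<^sub>m Suc n) $$ (i, j) = 0" using e[of i j] ij \<open>i < N\<close> by (simp del: pow_mat.simps)
  next
    fix i assume i: "i < N"
    have "(\<Sum>k<N. (B ^\<^sub>m n) $$ (i, k) * B $$ (k, i)) = (\<Sum>k\<in>{i}. (B ^\<^sub>m n) $$ (i, k) * B $$ (k, i))"
      using i z(1)[of i] z(2)[of _ i] by (intro sum.mono_neutral_right) (auto, metis linorder_neqE_nat)
    then show "(B ^\<^sub>m Suc n) $$ (i, i) = B $$ (i, i) ^ Suc n"
      using e[OF i i] Suc i by simp
  qed
qed

lemma unitary_eigenvalue:
  assumes U: "U \<in> unitary_group N" and k: "eigenvalue U k"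
  shows "cmod k = 1"
proof -
  note c = unitaryD[OF U]
  from k obtain v where v: "v \<in> carrier_vec N" "v \<noteq> 0\<^sub>v N" "U *\<^sub>v v = k \<cdot>\<^sub>v v"
    using c(1) by (auto simp: eigenvalue_def eigenvector_def)
  let ?s = "\<lambda>v::complex vec. \<Sum>i<N. (cmod (v $ i))\<^sup>2"
  have "complex_of_real (?s (U *\<^sub>v v)) = complex_of_real (?s v)"
  proof -
    have Uv: "(U *\<^sub>v v) $ i = (\<Sum>j<N. U $$ (i, j) * v $ j)" if "i < N" for i
      using that c(1) v(1) by (simp add: scalar_prod_def atLeast0LessThan)
    have "complex_of_real (?s (U *\<^sub>v v)) = (\<Sum>i<N. (\<Sum>j<N. U $$ (i, j) * v $ j) * (\<Sum>l<N. cnj (U $$ (i, l) * v $ l)))"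
      by (simp only: of_real_sum complex_norm_square, intro sum.cong refl)
        (simp add: Uv cnj_sum del: index_mult_mat_vec)
    also have "\<dots> = (\<Sum>i<N. \<Sum>j<N. \<Sum>l<N. (v $ j * cnj (v $ l)) * (cnj (U $$ (i, l)) * U $$ (i, j)))"
      by (simp add: sum_product mult_ac)
    also have "\<dots> = (\<Sum>j<N. \<Sum>l<N. \<Sum>i<N. (v $ j * cnj (v $ l)) * (cnj (U $$ (i, l)) * U $$ (i, j)))"
      by (subst sum.swap, rule sum.cong[OF refl], rule sum.swap)
    also have "\<dots> = (\<Sum>j<N. \<Sum>l<N. (v $ j * cnj (v $ l)) * (mat_adjoint U * U) $$ (l, j))"
      using c(1,2) by (intro sum.cong refl) (simp add: mult_index[of _ N] adjoint_index sum_distrib_left del: index_mult_mat)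
    also have "\<dots> = (\<Sum>j<N. \<Sum>l<N. if l = j then v $ j * cnj (v $ l) else 0)"
      unfolding c(4) by (intro sum.cong refl) auto
    also have "\<dots> = complex_of_real (?s v)"
      by (simp only: of_real_sum complex_norm_square) simp
    finally show ?thesis .
  qed
  then have "?s (U *\<^sub>v v) = ?s v" using of_real_eq_iff by blast
  then have "(cmod k)\<^sup>2 * ?s v = ?s v"
    using v by (simp add: norm_mult power_mult_distrib sum_distrib_left)
  moreover have "?s v \<noteq> 0"
  proof
    assume "?s v = 0"
    then have "\<forall>i<N. v $ i = 0" by (subst (asm) sum_nonneg_eq_0_iff) auto
    then have "v = 0\<^sub>v N" using v(1) by (intro eq_vecI) auto
    then show False using v(2) by simp
  qed
  ultimately have "(cmod k)\<^sup>2 = 1" by simp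
  then show ?thesis by (simp add: power2_eq_1_iff) (use norm_ge_zero[of k] in linarith)
qed

text \<open>The traces of nonnegative powers are read off a triangular form, those of negative powers follow by
  conjugation because the eigenvalues lie on the unit circle.\<close>

lemma unitary_spectrum:
  assumes U: "U \<in> unitary_group N"
  shows "\<exists>x\<in>torus N. \<forall>a. mat_trace (ipow U a) = psum N a x"
proof -
  note c = unitaryD[OF U]
  obtain es where es: "char_poly U = (\<Prod>a\<leftarrow>es. [:- a, 1:])" using char_poly_factorized[OF c(1)] by auto
  obtain B P Q where BPQ: "schur_decomposition U es = (B, P, Q)" by (cases "schur_decomposition U es")
  from schur_decomposition[OF c(1) es BPQ]
  have sim: "similar_mat_wit U B P Q" and ut: "upper_triangular B" and dg: "diag_mat B = es" by auto
  note sd = similar_mat_witD2[OF c(1) sim]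
  define x where "x = (\<lambda>i. B $$ (i, i))"
  have unit: "cmod (x i) = 1" if "i < N" for i
  proof -
    have "x i \<in> set es" unfolding dg[symmetric] diag_mat_def x_def using that sd by auto
    then have "poly (char_poly U) (x i) = 0" unfolding es by (simp add: poly_prod_list_zero_iff)
    then have "eigenvalue U (x i)" using eigenvalue_root_char_poly[OF c(1)] by simp
    then show ?thesis by (rule unitary_eigenvalue[OF U])
  qed
  have pos: "mat_trace (U ^\<^sub>m n) = (\<Sum>i<N. x i ^ n)" for n
  proof -
    have Bc: "B ^\<^sub>m n \<in> carrier_mat N N" using sd by simp
    have "U ^\<^sub>m n = P * B ^\<^sub>m n * Q" by (rule similar_mat_wit_pow_id[OF sim])
    moreover have "mat_trace (P * B ^\<^sub>m n * Q) = mat_trace (Q * (P * B ^\<^sub>m n))"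
      using sd Bc by (intro mat_trace_commute[of _ N]) auto
    ultimately have "mat_trace (U ^\<^sub>m n) = mat_trace (Q * (P * B ^\<^sub>m n))" by simp
    also have "Q * (P * B ^\<^sub>m n) = (Q * P) * B ^\<^sub>m n"
      by (rule assoc_mult_mat[symmetric, of Q N N P N _ N]) (use sd Bc in auto)
    also have "Q * P = 1\<^sub>m N" using sd by simp
    also have "1\<^sub>m N * B ^\<^sub>m n = B ^\<^sub>m n" by (rule left_mult_one_mat[OF Bc])
    finally show ?thesis
      using upper_triangular_pow[OF _ ut] sd Bc by (simp add: mat_trace_index[of _ N] x_def)
  qed
  have "mat_trace (ipow U a) = psum N a x" for a
  proof -
    have nonneg: "mat_trace (ipow U a) = psum N a x" if "a \<ge> 0" for a
      using that pos[of "nat a"] by (simp add: ipow_def psum_def power_int_def)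
    show ?thesis
    proof (cases "a \<ge> 0")
      case False
      then have "mat_trace (ipow U a) = cnj (psum N (- a) x)"
        using ipow_trace_uminus[OF U, of "- a"] nonneg[of "- a"] by simp
      also have "\<dots> = psum N a x"
        unfolding psum_def cnj_sum
      proof (rule sum.cong[OF refl])
        fix r assume "r \<in> {..<N}"
        then have "cnj (x r) = inverse (x r)"
          using unit[of r] complex_norm_square[of "x r"] by (intro inverse_unique[symmetric]) simp
        then show "cnj (x r powi - a) = x r powi a"
          by (simp add: complex_cnj_power_int power_int_minus power_int_inverse)
      qed
      finally show ?thesis .
    qed (rule nonneg)
  qed
  then show ?thesis using unit by (intro bexI[of _ x]) (auto simp: torus_def)
qed

section \<open>Loop equations for Haar measure\<close>

text \<open>Polarization: test with the unit vectors \<open>e\<^sub>p\<close> and \<open>(e\<^sub>p + \<omega> e\<^sub>q) / sqrt 2\<close> for \<open>\<omega> = 1\<close> and \<open>\<omega> = \<i>\<close>.\<close>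

lemma polarization_zero:
  fixes c :: "nat \<Rightarrow> nat \<Rightarrow> complex"
  assumes quad: "\<And>v. (\<Sum>i<N. (cmod (v i))\<^sup>2) = 1 \<Longrightarrow> (\<Sum>p<N. \<Sum>q<N. v p * cnj (v q) * c p q) = 0"
    and p: "p < N" and q: "q < N"
  shows "c p q = 0"
proof -
  have diag: "c p p = 0" if p: "p < N" for p
  proof -
    define v :: "nat \<Rightarrow> complex" where "v = (\<lambda>i. if i = p then 1 else 0)"
    have "(\<Sum>i<N. (cmod (v i))\<^sup>2) = (\<Sum>i<N. if i = p then 1 else 0)"
      by (intro sum.cong) (auto simp: v_def)
    then have "(\<Sum>p<N. \<Sum>q<N. v p * cnj (v q) * c p q) = 0" using p by (intro quad) simp
    moreover have "v i * cnj (v j) * c i j = (if i = p then if j = p then c p p else 0 else 0)" for i j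
      by (auto simp: v_def)
    ultimately have "(\<Sum>i<N. \<Sum>j<N. if i = p then if j = p then c p p else 0 else 0) = 0" by simp
    also have "(\<Sum>i<N. \<Sum>j<N. if i = p then if j = p then c p p else 0 else 0)
       = (\<Sum>i<N. if i = p then (\<Sum>j<N. if j = p then c p p else 0) else 0)"
      by (intro sum.cong) auto
    finally show ?thesis using p by simp
  qed
  have off: "cnj w * c p q + w * c q p = 0" if ne: "p \<noteq> q" and w: "cmod w = 1" for w
  proof -
    define s where "s = complex_of_real (1 / sqrt 2)"
    define v where "v = (\<lambda>i. if i = p then s else if i = q then w * s else 0)"
    have s2: "(cmod s)\<^sup>2 = 1 / 2" by (simp add: s_def norm_divide power_divide)
    have "(\<Sum>i<N. (cmod (v i))\<^sup>2) = (\<Sum>i\<in>{p, q}. (cmod (v i))\<^sup>2)"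
      using p q by (intro sum.mono_neutral_right) (auto simp: v_def)
    also have "\<dots> = 1" using ne s2 w by (simp add: v_def norm_mult power_mult_distrib)
    finally have "0 = (\<Sum>i<N. \<Sum>j<N. v i * cnj (v j) * c i j)" using quad by simp
    also have "\<dots> = (\<Sum>i\<in>{p, q}. \<Sum>j<N. v i * cnj (v j) * c i j)"
      using p q by (intro sum.mono_neutral_right) (auto simp: v_def)
    also have "\<dots> = (\<Sum>i\<in>{p, q}. \<Sum>j\<in>{p, q}. v i * cnj (v j) * c i j)"
      using p q by (intro sum.cong refl sum.mono_neutral_right) (auto simp: v_def)
    also have "\<dots> = (s * cnj s) * (cnj w * c p q + w * c q p)"
      using ne diag p q by (simp add: v_def algebra_simps)
    finally show ?thesis by (simp add: s_def)
  qed
  show ?thesis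
  proof (cases "p = q")
    case True
    then show ?thesis using diag p by simp
  next
    case False
    from off[OF False, of 1] off[OF False, of \<i>] have "c p q + c q p = 0" "- \<i> * c p q + \<i> * c q p = 0" by auto
    then have "\<i> * (c p q + c q p) - (- \<i> * c p q + \<i> * c q p) = 0" by simp
    then have "2 * \<i> * c p q = 0" by (simp add: algebra_simps)
    then show ?thesis by simp
  qed
qed

lemma has_vector_derivative_prod:
  fixes f :: "'i \<Rightarrow> real \<Rightarrow> complex"
  assumes "\<And>i. i \<in> I \<Longrightarrow> (f i has_vector_derivative f' i) (at x)"
  shows "((\<lambda>t. \<Prod>i\<in>I. f i t) has_vector_derivative (\<Sum>i\<in>I. f' i * (\<Prod>j\<in>I-{i}. f j x))) (at x)"
proof -
  have "((\<lambda>t. \<Prod>i\<in>I. f i t) has_derivative (\<lambda>y. \<Sum>i\<in>I. (y *\<^sub>R f' i) * (\<Prod>j\<in>I-{i}. f j x))) (at x)"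
    using assms unfolding has_vector_derivative_def by (rule has_derivative_prod)
  moreover have "(\<lambda>y. \<Sum>i\<in>I. (y *\<^sub>R f' i) * (\<Prod>j\<in>I-{i}. f j x)) = (\<lambda>y. y *\<^sub>R (\<Sum>i\<in>I. f' i * (\<Prod>j\<in>I-{i}. f j x)))"
    by (simp add: scaleR_sum_right)
  ultimately show ?thesis unfolding has_vector_derivative_def by simp
qed

text \<open>The one-parameter group \<open>exp (i t P)\<close> of the rank-one projection \<open>P = v v\<^sup>*\<close>, which is
  \<open>1 + (exp (i t) - 1) P\<close>. Rank-one projections span all matrices, so invariance under these groups gives
  every first-order identity.\<close>

definition rot :: "nat \<Rightarrow> (nat \<Rightarrow> complex) \<Rightarrow> real \<Rightarrow> complex mat" where
  "rot N v t = mat N N (\<lambda>(i, j). (if i = j then 1 else 0) + (cis t - 1) * (v i * cnj (v j)))"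

lemma rot_carrier: "rot N v t \<in> carrier_mat N N"
  by (simp add: rot_def)

lemma rot_index: "i < N \<Longrightarrow> j < N \<Longrightarrow> rot N v t $$ (i, j) = (if i = j then 1 else 0) + (cis t - 1) * (v i * cnj (v j))"
  by (simp add: rot_def)

lemma rot_0: "rot N v 0 = 1\<^sub>m N"
  by (rule eq_matI) (auto simp: rot_def)

lemma rot_add:
  assumes v: "(\<Sum>i<N. (cmod (v i))\<^sup>2) = 1"
  shows "rot N v t * rot N v s = rot N v (t + s)"
proof (rule eq_matI)
  fix i j assume "i < dim_row (rot N v (t + s))" "j < dim_col (rot N v (t + s))"
  then have ij: "i < N" "j < N" by (auto simp: rot_def)
  let ?d = "\<lambda>i j. if i = j then 1 else (0::complex)"
  have vv: "(\<Sum>k<N. v k * cnj (v k)) = 1"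
    using v by (simp only: complex_norm_square[symmetric] of_real_sum[symmetric]) simp
  have "(rot N v t * rot N v s) $$ (i, j) =
    (\<Sum>k<N. (?d i k + (cis t - 1) * (v i * cnj (v k))) * (?d k j + (cis s - 1) * (v k * cnj (v j))))"
    unfolding mult_index[OF rot_carrier rot_carrier ij]
    using ij by (intro sum.cong refl) (simp add: rot_index)
  also have "\<dots> = (\<Sum>k<N. ?d i k * ?d k j) + (cis s - 1) * cnj (v j) * (\<Sum>k<N. ?d i k * v k)
     + (cis t - 1) * v i * (\<Sum>k<N. cnj (v k) * ?d k j)
     + (cis t - 1) * (cis s - 1) * v i * cnj (v j) * (\<Sum>k<N. v k * cnj (v k))"
    by (simp add: distrib_left distrib_right sum.distrib sum_distrib_left mult_ac)
  also have "(\<Sum>k<N. ?d i k * ?d k j) = ?d i j"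
    using ij by (simp add: if_distrib[where f = "\<lambda>z. z * _"] sum.delta cong: if_cong)
  also have "(\<Sum>k<N. ?d i k * v k) = v i"
    using ij by (simp add: if_distrib[where f = "\<lambda>z. z * _"] sum.delta cong: if_cong)
  also have "(\<Sum>k<N. cnj (v k) * ?d k j) = cnj (v j)"
    using ij by (simp add: if_distrib[where f = "\<lambda>z. _ * z"] sum.delta cong: if_cong)
  finally have e: "(rot N v t * rot N v s) $$ (i, j) = ?d i j + (cis s - 1) * cnj (v j) * v i
     + (cis t - 1) * v i * cnj (v j) + (cis t - 1) * (cis s - 1) * v i * cnj (v j) * 1" unfolding vv .
  have "cis (t + s) = cis t * cis s" by (simp add: cis_mult)
  then show "(rot N v t * rot N v s) $$ (i, j) = rot N v (t + s) $$ (i, j)"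
    unfolding e rot_index[OF ij] by (simp add: algebra_simps)
qed (auto simp: rot_def)

lemma rot_adjoint: "mat_adjoint (rot N v t) = rot N v (- t)"
proof (rule eq_matI)
  fix i j assume "i < dim_row (rot N v (- t))" "j < dim_col (rot N v (- t))"
  then have ij: "i < N" "j < N" by (auto simp: rot_def)
  show "mat_adjoint (rot N v t) $$ (i, j) = rot N v (- t) $$ (i, j)"
    using ij by (simp add: adjoint_index[OF rot_carrier] rot_index cis_cnj mult_ac)
qed (use adjoint_carrier[OF rot_carrier, of N v t] in \<open>auto simp: rot_def\<close>)

lemma rot_unitary:
  assumes v: "(\<Sum>i<N. (cmod (v i))\<^sup>2) = 1"
  shows "rot N v t \<in> unitary_group N"
  using rot_add[OF v, of t "- t"] rot_add[OF v, of "- t" t]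
  by (simp add: unitary_group_def rot_carrier rot_adjoint rot_0)

text \<open>Since \<open>P = v v\<^sup>*\<close>, the entries of \<open>W^s P W^(a-s)\<close> factor into an entry of \<open>W^s v\<close> and an entry of
  \<open>v\<^sup>* W^(a-s)\<close>.\<close>

definition lvec :: "nat \<Rightarrow> (nat \<Rightarrow> complex) \<Rightarrow> complex mat \<Rightarrow> int \<Rightarrow> nat \<Rightarrow> complex" where
  "lvec N v W s i = (\<Sum>p<N. ipow W s $$ (i, p) * v p)"

definition rvec :: "nat \<Rightarrow> (nat \<Rightarrow> complex) \<Rightarrow> complex mat \<Rightarrow> int \<Rightarrow> nat \<Rightarrow> complex" where
  "rvec N v W s j = (\<Sum>q<N. cnj (v q) * ipow W s $$ (q, j))"

lemma ipow_add_index: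
  assumes "W \<in> unitary_group N" "i < N" "j < N"
  shows "(\<Sum>k<N. ipow W a $$ (i, k) * ipow W b $$ (k, j)) = ipow W (a + b) $$ (i, j)"
  using mult_index[OF ipow_carrier ipow_carrier assms(2,3), OF assms(1) assms(1)] ipow_add[OF assms(1)] by metis

lemma lvec_step:
  assumes "W \<in> unitary_group N" "i < N"
  shows "(\<Sum>k<N. ipow W a $$ (i, k) * lvec N v W s k) = lvec N v W (a + s) i"
proof -
  have "(\<Sum>k<N. ipow W a $$ (i, k) * lvec N v W s k) = (\<Sum>k<N. \<Sum>p<N. ipow W a $$ (i, k) * ipow W s $$ (k, p) * v p)"
    by (simp add: lvec_def sum_distrib_left mult.assoc)
  also have "\<dots> = (\<Sum>p<N. (\<Sum>k<N. ipow W a $$ (i, k) * ipow W s $$ (k, p)) * v p)"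
    by (subst sum.swap) (simp add: sum_distrib_right)
  finally show ?thesis using assms by (simp add: ipow_add_index lvec_def)
qed

lemma rvec_step:
  assumes "W \<in> unitary_group N" "j < N"
  shows "(\<Sum>k<N. rvec N v W s k * ipow W a $$ (k, j)) = rvec N v W (s + a) j"
proof -
  have "(\<Sum>k<N. rvec N v W s k * ipow W a $$ (k, j)) = (\<Sum>k<N. \<Sum>p<N. cnj (v p) * (ipow W s $$ (p, k) * ipow W a $$ (k, j)))"
    by (simp add: rvec_def sum_distrib_right mult.assoc)
  also have "\<dots> = (\<Sum>p<N. cnj (v p) * (\<Sum>k<N. ipow W s $$ (p, k) * ipow W a $$ (k, j)))"
    by (subst sum.swap) (simp add: sum_distrib_left)
  finally show ?thesis using assms by (simp add: ipow_add_index rvec_def)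
qed

lemma rvec_lvec:
  assumes "W \<in> unitary_group N"
  shows "(\<Sum>k<N. lvec N v W s k * rvec N v W a k) = (\<Sum>p<N. \<Sum>q<N. v p * cnj (v q) * ipow W (a + s) $$ (q, p))"
proof -
  have "(\<Sum>k<N. lvec N v W s k * rvec N v W a k) = (\<Sum>k<N. \<Sum>p<N. rvec N v W a k * ipow W s $$ (k, p) * v p)"
    by (subst lvec_def) (simp add: sum_distrib_left sum_distrib_right mult_ac)
  also have "\<dots> = (\<Sum>p<N. (\<Sum>k<N. rvec N v W a k * ipow W s $$ (k, p)) * v p)"
    by (subst sum.swap) (simp add: sum_distrib_right)
  also have "\<dots> = (\<Sum>p<N. rvec N v W (a + s) p * v p)"
    using assms by (intro sum.cong refl) (simp add: rvec_step)
  also have "\<dots> = (\<Sum>p<N. \<Sum>q<N. v p * cnj (v q) * ipow W (a + s) $$ (q, p))"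
    by (simp add: rvec_def sum_distrib_right sum_distrib_left mult_ac)
  finally show ?thesis .
qed

text \<open>The Leibniz rule, by induction on \<open>a\<close> in both directions from \<open>0\<close>; downwards the new factor is the
  adjoint, whose derivative brings the opposite sign.\<close>

lemma ipow_deriv:
  assumes v: "(\<Sum>i<N. (cmod (v i))\<^sup>2) = 1" and W: "W \<in> unitary_group N" and i: "i < N" and j: "j < N"
  shows "((\<lambda>t. ipow (rot N v t * W) a $$ (i, j)) has_vector_derivative
     \<i> * oriented_sum a (\<lambda>s. lvec N v W s i * rvec N v W (a - s) j)) (at 0)"
  using j
proof (induction a arbitrary: j rule: int_induct[where k = 0])
  case base
  have "ipow (rot N v t * W) 0 $$ (i, j) = 1\<^sub>m N $$ (i, j)" for t
    using ipow_0[OF unitary_mult[OF rot_unitary[OF v] W]] by simp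
  then show ?case by simp
next
  case (step1 a)
  let ?V = "\<lambda>t. rot N v t * W"
  have V: "?V t \<in> unitary_group N" for t by (rule unitary_mult[OF rot_unitary[OF v] W])
  have V0: "?V 0 = W" using unitaryD[OF W] by (simp add: rot_0 left_mult_one_mat)
  have Ve: "?V t $$ (k, j) = W $$ (k, j) + (cis t - 1) * (v k * rvec N v W 1 j)" if "k < N" for t k
  proof -
    have "?V t $$ (k, j) = (\<Sum>l<N. (if k = l then W $$ (l, j) else 0) + (cis t - 1) * (v k * (cnj (v l) * W $$ (l, j))))"
      unfolding mult_index[OF rot_carrier unitaryD(1)[OF W] that step1.prems]
      using that by (intro sum.cong refl) (auto simp: rot_index algebra_simps)
    then show ?thesis using that by (simp add: sum.distrib rvec_def sum_distrib_left ipow_1[OF W])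
  qed
  have dV: "((\<lambda>t. ?V t $$ (k, j)) has_vector_derivative \<i> * (v k * rvec N v W 1 j)) (at 0)" if "k < N" for k
    unfolding Ve[OF that] by (auto intro!: derivative_eq_intros simp: has_vector_derivative_def) 
  have "((\<lambda>t. \<Sum>k<N. ipow (?V t) a $$ (i, k) * ?V t $$ (k, j)) has_vector_derivative
     (\<Sum>k<N. ipow (?V 0) a $$ (i, k) * (\<i> * (v k * rvec N v W 1 j)) +
        (\<i> * oriented_sum a (\<lambda>s. lvec N v W s i * rvec N v W (a - s) k)) * ?V 0 $$ (k, j))) (at 0)"
    by (intro has_vector_derivative_sum has_vector_derivative_mult step1.IH dV) auto
  also have "(\<lambda>t. \<Sum>k<N. ipow (?V t) a $$ (i, k) * ?V t $$ (k, j)) = (\<lambda>t. ipow (?V t) (a + 1) $$ (i, j))"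
    using mult_index[OF ipow_carrier[OF V] unitaryD(1)[OF V] i step1.prems] by (simp only: ipow_Suc[OF V])
  also have "(\<Sum>k<N. ipow (?V 0) a $$ (i, k) * (\<i> * (v k * rvec N v W 1 j)) +
        (\<i> * oriented_sum a (\<lambda>s. lvec N v W s i * rvec N v W (a - s) k)) * ?V 0 $$ (k, j))
     = \<i> * (lvec N v W a i * rvec N v W 1 j + oriented_sum a (\<lambda>s. lvec N v W s i * (\<Sum>k<N. rvec N v W (a - s) k * ipow W 1 $$ (k, j))))"
  proof -
    have "(\<Sum>k<N. oriented_sum a (\<lambda>s. lvec N v W s i * rvec N v W (a - s) k) * W $$ (k, j))
       = (\<Sum>k<N. oriented_sum a (\<lambda>s. lvec N v W s i * (rvec N v W (a - s) k * W $$ (k, j))))"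
      by (intro sum.cong refl) (subst mult.commute, subst oriented_sum_cmult[symmetric], simp add: mult_ac)
    also have "\<dots> = oriented_sum a (\<lambda>s. lvec N v W s i * (\<Sum>k<N. rvec N v W (a - s) k * ipow W 1 $$ (k, j)))"
      unfolding sum_distrib_left oriented_sum_sum ipow_1[OF W] ..
    finally show ?thesis
      unfolding V0 by (simp add: sum.distrib lvec_def sum_distrib_left sum_distrib_right mult_ac distrib_left)
        (simp add: sum_distrib_left[symmetric] mult_ac)
  qed
  also have "\<dots> = \<i> * oriented_sum (a + 1) (\<lambda>s. lvec N v W s i * rvec N v W (a + 1 - s) j)"
    unfolding rvec_step[OF W step1.prems] oriented_sum_Suc by (simp add: algebra_simps)
  finally show ?case .
next
  case (step2 a)
  let ?V = "\<lambda>t. rot N v t * W"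
  have V: "?V t \<in> unitary_group N" for t by (rule unitary_mult[OF rot_unitary[OF v] W])
  have V0: "?V 0 = W" using unitaryD[OF W] by (simp add: rot_0 left_mult_one_mat)
  have Wm: "ipow W (-1) = mat_adjoint W"
    using ipow_pred[OF W, of 0] unitaryD(2)[OF W] ipow_0[OF W] by (simp add: left_mult_one_mat)
  have Ve: "mat_adjoint (?V t) $$ (k, j) = mat_adjoint W $$ (k, j) + (cis (- t) - 1) * (lvec N v W (-1) k * cnj (v j))" if "k < N" for t k
  proof -
    have "mat_adjoint (?V t) = mat_adjoint W * rot N v (- t)"
      by (simp add: adjoint_mult[OF rot_carrier unitaryD(1)[OF W]] rot_adjoint)
    then have "mat_adjoint (?V t) $$ (k, j) = (\<Sum>l<N. (if l = j then mat_adjoint W $$ (k, l) else 0) + (cis (- t) - 1) * (mat_adjoint W $$ (k, l) * v l * cnj (v j)))"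
      using mult_index[OF unitaryD(2)[OF W] rot_carrier that step2.prems]
        step2.prems by (auto simp: rot_index algebra_simps intro!: sum.cong)
    then show ?thesis using that step2.prems by (simp add: sum.distrib lvec_def Wm sum_distrib_left sum_distrib_right mult_ac)
  qed
  have dV: "((\<lambda>t. mat_adjoint (?V t) $$ (k, j)) has_vector_derivative - \<i> * (lvec N v W (-1) k * cnj (v j))) (at 0)" if "k < N" for k
    unfolding Ve[OF that] by (auto intro!: derivative_eq_intros simp: has_vector_derivative_def)
  have r0: "rvec N v W 0 j = cnj (v j)"
    using step2.prems by (simp add: rvec_def ipow_0[OF W] if_distrib[where f = "\<lambda>z. _ * z"] sum.delta cong: if_cong)
  have "((\<lambda>t. \<Sum>k<N. ipow (?V t) a $$ (i, k) * mat_adjoint (?V t) $$ (k, j)) has_vector_derivative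
     (\<Sum>k<N. ipow (?V 0) a $$ (i, k) * (- \<i> * (lvec N v W (-1) k * cnj (v j))) +
        (\<i> * oriented_sum a (\<lambda>s. lvec N v W s i * rvec N v W (a - s) k)) * mat_adjoint (?V 0) $$ (k, j))) (at 0)"
    by (intro has_vector_derivative_sum has_vector_derivative_mult step2.IH dV) auto
  also have "(\<lambda>t. \<Sum>k<N. ipow (?V t) a $$ (i, k) * mat_adjoint (?V t) $$ (k, j)) = (\<lambda>t. ipow (?V t) (a - 1) $$ (i, j))"
    using mult_index[OF ipow_carrier[OF V] unitaryD(2)[OF V] i step2.prems] by (simp only: ipow_pred[OF V])
  also have "(\<Sum>k<N. ipow (?V 0) a $$ (i, k) * (- \<i> * (lvec N v W (-1) k * cnj (v j))) +
        (\<i> * oriented_sum a (\<lambda>s. lvec N v W s i * rvec N v W (a - s) k)) * mat_adjoint (?V 0) $$ (k, j))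
     = \<i> * (oriented_sum a (\<lambda>s. lvec N v W s i * (\<Sum>k<N. rvec N v W (a - s) k * ipow W (-1) $$ (k, j)))
        - (\<Sum>k<N. ipow W a $$ (i, k) * lvec N v W (-1) k) * cnj (v j))"
  proof -
    have "(\<Sum>k<N. oriented_sum a (\<lambda>s. lvec N v W s i * rvec N v W (a - s) k) * mat_adjoint W $$ (k, j))
       = (\<Sum>k<N. oriented_sum a (\<lambda>s. lvec N v W s i * (rvec N v W (a - s) k * mat_adjoint W $$ (k, j))))"
      by (intro sum.cong refl) (subst mult.commute, subst oriented_sum_cmult[symmetric], simp add: mult_ac)
    also have "\<dots> = oriented_sum a (\<lambda>s. lvec N v W s i * (\<Sum>k<N. rvec N v W (a - s) k * ipow W (-1) $$ (k, j)))"
      unfolding sum_distrib_left oriented_sum_sum Wm ..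
    finally have e: "(\<Sum>k<N. oriented_sum a (\<lambda>s. lvec N v W s i * rvec N v W (a - s) k) * mat_adjoint W $$ (k, j))
        = oriented_sum a (\<lambda>s. lvec N v W s i * (\<Sum>k<N. rvec N v W (a - s) k * ipow W (-1) $$ (k, j)))" .
    show ?thesis
      unfolding V0 e[symmetric] by (simp add: sum.distrib sum_subtractf sum_negf sum_distrib_left sum_distrib_right mult_ac right_diff_distrib)
  qed
  also have "\<dots> = \<i> * (oriented_sum a (\<lambda>s. lvec N v W s i * rvec N v W (a - 1 - s) j) - lvec N v W (a - 1) i * rvec N v W 0 j)"
    unfolding r0 lvec_step[OF W i] rvec_step[OF W step2.prems] by (simp add: algebra_simps)
  also have "\<dots> = \<i> * oriented_sum (a - 1) (\<lambda>s. lvec N v W s i * rvec N v W (a - 1 - s) j)"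
    using oriented_sum_Suc[of "a - 1" "\<lambda>s. lvec N v W s i * rvec N v W (a - 1 - s) j"] by simp
  finally show ?case .
qed

text \<open>By cyclicity each of the \<open>a\<close> terms of the Leibniz rule has the trace of \<open>P W^a\<close>.\<close>

lemma trace_deriv:
  assumes v: "(\<Sum>i<N. (cmod (v i))\<^sup>2) = 1" and W: "W \<in> unitary_group N"
  shows "((\<lambda>t. mat_trace (ipow (rot N v t * W) a)) has_vector_derivative
     \<i> * (of_int a * (\<Sum>p<N. \<Sum>q<N. v p * cnj (v q) * ipow W a $$ (q, p)))) (at 0)"
proof -
  let ?V = "\<lambda>t. rot N v t * W"
  have V: "?V t \<in> unitary_group N" for t by (rule unitary_mult[OF rot_unitary[OF v] W])
  have "((\<lambda>t. \<Sum>i<N. ipow (?V t) a $$ (i, i)) has_vector_derivative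
     (\<Sum>i<N. \<i> * oriented_sum a (\<lambda>s. lvec N v W s i * rvec N v W (a - s) i))) (at 0)"
    by (intro has_vector_derivative_sum ipow_deriv v W) auto
  also have "(\<lambda>t. \<Sum>i<N. ipow (?V t) a $$ (i, i)) = (\<lambda>t. mat_trace (ipow (?V t) a))"
    using mat_trace_index[OF ipow_carrier[OF V]] by simp
  also have "(\<Sum>i<N. \<i> * oriented_sum a (\<lambda>s. lvec N v W s i * rvec N v W (a - s) i))
     = \<i> * oriented_sum a (\<lambda>s. \<Sum>i<N. lvec N v W s i * rvec N v W (a - s) i)"
    by (simp add: oriented_sum_sum sum_distrib_left)
  also have "\<dots> = \<i> * (of_int a * (\<Sum>p<N. \<Sum>q<N. v p * cnj (v q) * ipow W a $$ (q, p)))"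
    unfolding rvec_lvec[OF W] by (simp add: oriented_sum_const)
  finally show ?thesis .
qed

lemma integral_sum2:
  fixes F :: "nat \<Rightarrow> nat \<Rightarrow> 'b \<Rightarrow> complex"
  assumes "\<And>p q. p < N \<Longrightarrow> q < N \<Longrightarrow> integrable M (F p q)"
  shows "(LINT W|M. (\<Sum>p<N. \<Sum>q<N. F p q W)) = (\<Sum>p<N. \<Sum>q<N. LINT W|M. F p q W)"
proof -
  have "(LINT W|M. (\<Sum>p<N. \<Sum>q<N. F p q W)) = (\<Sum>p<N. LINT W|M. (\<Sum>q<N. F p q W))"
    using assms by (intro Bochner_Integration.integral_sum Bochner_Integration.integrable_sum) auto
  also have "\<dots> = (\<Sum>p<N. \<Sum>q<N. LINT W|M. F p q W)"
    using assms by (intro sum.cong refl Bochner_Integration.integral_sum) auto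
  finally show ?thesis .
qed

locale haar_measure =
  fixes N :: nat and M :: "complex mat measure"
  assumes haar: "haar_unitary N M"
begin

sublocale prob_space M
  using haar by (simp add: haar_unitary_def)

lemma sets_M: "sets M = sets (borel_unitary N)"
  using haar by (simp add: haar_unitary_def)

lemma space_M: "space M = unitary_group N"
  using sets_eq_imp_space_eq[OF sets_M] by (simp add: borel_unitary_def)

lemma measurable_entry:
  assumes "i < N" "j < N"
  shows "(\<lambda>U. U $$ (i, j)) \<in> borel_measurable M"
proof -
  let ?I = "{..<N} \<times> {..<N}"
  let ?P = "PiM ?I (\<lambda>_. borel :: complex measure)"
  let ?f = "\<lambda>U. \<lambda>ij\<in>?I. U $$ ij"
  have "?f \<in> measurable (borel_unitary N) ?P"
    unfolding borel_unitary_def by (rule measurable_vimage_algebra1) (auto simp: space_PiM)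
  moreover have "(\<lambda>x. x (i, j)) \<in> measurable ?P borel"
    using assms by (intro measurable_component_singleton) auto
  ultimately have "(\<lambda>x. x (i, j)) \<circ> ?f \<in> measurable (borel_unitary N) borel"
    by (rule measurable_comp)
  then have "(\<lambda>U. U $$ (i, j)) \<in> borel_measurable (borel_unitary N)"
    using assms by (simp add: o_def)
  then show ?thesis by (simp add: measurable_cong_sets[OF sets_M refl])
qed

lemma lmult_measurable:
  assumes V: "V \<in> unitary_group N"
  shows "(\<lambda>U. V * U) \<in> measurable M M"
proof -
  let ?I = "{..<N} \<times> {..<N}"
  let ?P = "PiM ?I (\<lambda>_. borel :: complex measure)"
  let ?f = "\<lambda>U. \<lambda>ij\<in>?I. U $$ ij"
  have "(\<lambda>U. V * U) \<in> measurable M (borel_unitary N)"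
    unfolding borel_unitary_def
  proof (rule measurable_vimage_algebra2)
    show "(\<lambda>U. V * U) \<in> space M \<rightarrow> unitary_group N" by (auto simp: space_M intro: unitary_mult V)
    show "(\<lambda>U. ?f (V * U)) \<in> measurable M ?P"
    proof (rule measurable_restrict)
      fix ij assume "ij \<in> ?I"
      then obtain i j where ij: "ij = (i, j)" "i < N" "j < N" by auto
      have "(\<lambda>U. \<Sum>k<N. V $$ (i, k) * U $$ (k, j)) \<in> borel_measurable M"
        using ij measurable_entry by (intro borel_measurable_sum borel_measurable_times) auto
      also have "?this \<longleftrightarrow> (\<lambda>U. (V * U) $$ ij) \<in> borel_measurable M"
        using ij unitaryD(1)[OF V] by (intro measurable_cong) (simp add: space_M unitaryD(1) mult_index[of _ N] del: index_mult_mat)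
      finally show "(\<lambda>U. (V * U) $$ ij) \<in> borel_measurable M" .
    qed
  qed
  then show ?thesis by (simp add: measurable_cong_sets[OF refl sets_M])
qed

text \<open>A class closed under all operations used below whose members are integrable for any probability
  measure on the unitary group.\<close>

definition bdd_meas :: "(complex mat \<Rightarrow> complex) \<Rightarrow> bool" where
  "bdd_meas f \<longleftrightarrow> f \<in> borel_measurable M \<and> (\<exists>B. \<forall>U\<in>unitary_group N. cmod (f U) \<le> B)"

lemma bdd_meas_integrable: "bdd_meas f \<Longrightarrow> integrable M f"
  unfolding bdd_meas_def
proof (elim conjE exE)
  fix B assume "f \<in> borel_measurable M" "\<forall>U\<in>unitary_group N. cmod (f U) \<le> B"
  then show "integrable M f"
    by (intro integrable_const_bound[of f B]) (auto simp: space_M)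
qed

lemma bdd_meas_const: "bdd_meas (\<lambda>U. c)"
  by (auto simp: bdd_meas_def)

lemma bdd_meas_add: "bdd_meas f \<Longrightarrow> bdd_meas g \<Longrightarrow> bdd_meas (\<lambda>U. f U + g U)"
  unfolding bdd_meas_def by (auto, meson add_mono norm_triangle_le)

lemma bdd_meas_mult: 
  assumes "bdd_meas f" "bdd_meas g" shows "bdd_meas (\<lambda>U. f U * g U)"
proof -
  from assms obtain B C where "\<forall>U\<in>unitary_group N. cmod (f U) \<le> B" "\<forall>U\<in>unitary_group N. cmod (g U) \<le> C"
    by (auto simp: bdd_meas_def)
  then have "\<forall>U\<in>unitary_group N. cmod (f U * g U) \<le> B * C"
    by (auto simp: norm_mult intro!: mult_mono elim: order.trans[OF norm_ge_zero])
  then show ?thesis using assms unfolding bdd_meas_def by auto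
qed

lemma bdd_meas_uminus: "bdd_meas f \<Longrightarrow> bdd_meas (\<lambda>U. - f U)"
  using bdd_meas_mult[OF bdd_meas_const[of "-1"]] by simp

lemma bdd_meas_sum: "(\<And>i. i \<in> I \<Longrightarrow> bdd_meas (f i)) \<Longrightarrow> bdd_meas (\<lambda>U. \<Sum>i\<in>I. f i U)"
  by (induction I rule: infinite_finite_induct) (auto intro: bdd_meas_const bdd_meas_add)

lemma bdd_meas_prod: "(\<And>i. i \<in> I \<Longrightarrow> bdd_meas (f i)) \<Longrightarrow> bdd_meas (\<lambda>U. \<Prod>i\<in>I. f i U)"
  by (induction I rule: infinite_finite_induct) (auto intro: bdd_meas_const bdd_meas_mult)

lemma bdd_meas_oriented_sum: "(\<And>s. bdd_meas (f s)) \<Longrightarrow> bdd_meas (\<lambda>U. oriented_sum m (\<lambda>s. f s U))"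
  unfolding oriented_sum_def by (cases "0 \<le> m") (simp_all add: bdd_meas_sum bdd_meas_uminus)

lemma bdd_meas_cong: "(\<And>U. U \<in> unitary_group N \<Longrightarrow> f U = g U) \<Longrightarrow> bdd_meas f \<longleftrightarrow> bdd_meas g"
  unfolding bdd_meas_def using measurable_cong[of M f g borel] by (simp add: space_M)

lemma bdd_meas_pow: "i < N \<Longrightarrow> j < N \<Longrightarrow> bdd_meas (\<lambda>U. (U ^\<^sub>m n) $$ (i, j))"
proof (induction n arbitrary: j)
  case 0
  have "bdd_meas (\<lambda>U. (if i = j then 1 else 0))" by (rule bdd_meas_const)
  then show ?case using 0 by (subst bdd_meas_cong) (auto dest: unitaryD(1))
next
  case (Suc n)
  have "bdd_meas (\<lambda>U. U $$ (k, j))" if "k < N" for k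
    unfolding bdd_meas_def using measurable_entry[OF that Suc.prems(2)] unitary_entry_le[OF _ that Suc.prems(2)] by blast
  then have "bdd_meas (\<lambda>U. \<Sum>k<N. (U ^\<^sub>m n) $$ (i, k) * U $$ (k, j))"
    using Suc by (intro bdd_meas_sum bdd_meas_mult) auto
  then show ?case
    by (subst bdd_meas_cong) (use Suc.prems in \<open>simp_all add: mult_index[of _ N] unitaryD(1) pow_carrier_mat[OF unitaryD(1)] del: index_mult_mat\<close>)
qed

lemma bdd_meas_cnj: "bdd_meas f \<Longrightarrow> bdd_meas (\<lambda>U. cnj (f U))"
  unfolding bdd_meas_def by (auto intro: borel_measurable_continuous_on[OF continuous_on_cnj[OF continuous_on_id]])

lemma bdd_meas_ipow:
  assumes "i < N" "j < N"
  shows "bdd_meas (\<lambda>U. ipow U a $$ (i, j))"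
proof (cases "a \<ge> 0")
  case True
  then show ?thesis using bdd_meas_pow[OF assms] by (simp add: ipow_def)
next
  case False
  have "bdd_meas (\<lambda>U. cnj ((U ^\<^sub>m nat (- a)) $$ (j, i)))" using assms by (intro bdd_meas_cnj bdd_meas_pow)
  then show ?thesis
  proof (subst bdd_meas_cong)
    fix U assume "U \<in> unitary_group N"
    then have U: "U \<in> carrier_mat N N" by (rule unitaryD)
    then show "ipow U a $$ (i, j) = cnj ((U ^\<^sub>m nat (- a)) $$ (j, i))"
      using False adjoint_pow[OF U, of "nat (- a)"] assms by (simp add: ipow_def flip: adjoint_index[of _ N])
  qed
qed

lemma bdd_meas_trace: "bdd_meas (\<lambda>U. mat_trace (ipow U a))"
proof -
  have "bdd_meas (\<lambda>U. \<Sum>i<N. ipow U a $$ (i, i))" by (intro bdd_meas_sum bdd_meas_ipow) auto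
  then show ?thesis by (subst bdd_meas_cong) (auto simp: mat_trace_index[OF ipow_carrier])
qed

lemma left_invariant:
  assumes V: "V \<in> unitary_group N" and f: "bdd_meas f"
  shows "(LINT U|M. f (V * U)) = (LINT U|M. f U)"
proof -
  have "(LINT U|M. f U) = (LINT U|distr M M (\<lambda>U. V * U). f U)"
    using haar V by (simp add: haar_unitary_def)
  also have "\<dots> = (LINT U|M. f (V * U))"
    using f by (intro integral_distr lmult_measurable V) (simp add: bdd_meas_def)
  finally show ?thesis by simp
qed

text \<open>By left invariance every difference quotient along the group integrates to \<open>0\<close>. The quotients are bounded
  by the mean value theorem and converge to the derivative, so dominated convergence applies.\<close>

lemma expectation_derivative_zero:
  assumes v: "(\<Sum>i<N. (cmod (v i))\<^sup>2) = 1" and f: "bdd_meas f" and D: "bdd_meas D"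
    and deriv: "\<And>W. W \<in> unitary_group N \<Longrightarrow> ((\<lambda>t. f (rot N v t * W)) has_vector_derivative D W) (at 0)"
  shows "(LINT U|M. D U) = 0"
proof -
  obtain C where C: "\<And>U. U \<in> unitary_group N \<Longrightarrow> cmod (D U) \<le> C" using D by (auto simp: bdd_meas_def)
  let ?q = "\<lambda>n W. of_nat (Suc n) * (f (rot N v (1 / real (Suc n)) * W) - f W)"
  have mem: "rot N v t * W \<in> unitary_group N" if "W \<in> unitary_group N" for t W
    by (rule unitary_mult[OF rot_unitary[OF v] that])
  have r0: "rot N v 0 * W = W" if "W \<in> unitary_group N" for W
    using unitaryD(1)[OF that] by (simp add: rot_0 left_mult_one_mat)
  have dt: "((\<lambda>t. f (rot N v t * W)) has_vector_derivative D (rot N v t * W)) (at t)"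
    if W: "W \<in> unitary_group N" for t W
  proof -
    have "rot N v (t + s) * W = rot N v s * (rot N v t * W)" for s
      using assoc_mult_mat[OF rot_carrier rot_carrier unitaryD(1)[OF W], of v s v t] rot_add[OF v, of s t]
      by (simp add: add.commute)
    then have "((\<lambda>s. f (rot N v (t + s) * W)) has_vector_derivative D (rot N v t * W)) (at 0)"
      using deriv[OF mem[OF W, of t]] by simp
    then show ?thesis
      unfolding has_vector_derivative_def has_derivative_at by simp
  qed
  have lim: "(\<lambda>n. ?q n W) \<longlonglongrightarrow> D W" if W: "W \<in> unitary_group N" for W
  proof -
    let ?h = "\<lambda>n. 1 / real (Suc n)"
    have "((\<lambda>h. norm (f (rot N v (0 + h) * W) - f (rot N v 0 * W) - h *\<^sub>R D W) / norm h) \<longlongrightarrow> 0) (at 0)"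
      using deriv[OF W] unfolding has_vector_derivative_def has_derivative_at by blast
    moreover have "filterlim ?h (at 0) sequentially"
      unfolding filterlim_at using LIMSEQ_inverse_real_of_nat by (auto simp: inverse_eq_divide)
    ultimately have "(\<lambda>n. norm (f (rot N v (0 + ?h n) * W) - f (rot N v 0 * W) - ?h n *\<^sub>R D W) / norm (?h n)) \<longlonglongrightarrow> 0"
      by (rule filterlim_compose)
    moreover have "norm (f (rot N v (0 + ?h n) * W) - f (rot N v 0 * W) - ?h n *\<^sub>R D W) / norm (?h n) = norm (?q n W - D W)" for n
    proof -
      have "?q n W - D W = of_nat (Suc n) * (f (rot N v (0 + ?h n) * W) - f (rot N v 0 * W) - ?h n *\<^sub>R D W)"
        unfolding r0[OF W] by (simp add: scaleR_conv_of_real right_diff_distrib del: of_nat_Suc)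
      then show ?thesis by (simp add: norm_mult del: of_nat_Suc)
    qed
    ultimately have "(\<lambda>n. norm (?q n W - D W)) \<longlonglongrightarrow> 0" by simp
    then show ?thesis using Lim_null tendsto_norm_zero_iff by blast
  qed
  have bnd: "cmod (?q n W) \<le> C" if W: "W \<in> unitary_group N" for n W
  proof -
    let ?t = "1 / real (Suc n)"
    have "norm (f (rot N v ?t * W) - f (rot N v 0 * W)) \<le> C * norm (?t - 0)"
    proof (rule differentiable_bound[where S = UNIV and f' = "\<lambda>t y. y *\<^sub>R D (rot N v t * W)"])
      show "((\<lambda>t. f (rot N v t * W)) has_derivative (\<lambda>y. y *\<^sub>R D (rot N v x * W))) (at x within UNIV)" for x
        using dt[OF W, of x] by (simp add: has_vector_derivative_def)
      show "onorm (\<lambda>y. y *\<^sub>R D (rot N v x * W)) \<le> C" for x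
        by (rule onorm_le) (auto simp: mult.commute[of C] intro!: mult_left_mono C mem W)
    qed auto
    then have "real (Suc n) * cmod (f (rot N v ?t * W) - f W) \<le> C"
      using r0[OF W] by (simp add: field_simps del: of_nat_Suc)
    then show ?thesis by (simp only: norm_mult norm_of_nat)
  qed
  have qi: "(LINT U|M. ?q n U) = 0" for n
  proof -
    have R: "rot N v (1 / real (Suc n)) \<in> unitary_group N" by (rule rot_unitary[OF v])
    obtain B where B: "\<forall>U\<in>unitary_group N. cmod (f U) \<le> B" using f by (auto simp: bdd_meas_def)
    have "integrable M (\<lambda>U. f (rot N v (1 / real (Suc n)) * U))"
    proof (rule integrable_const_bound)
      show "AE U in M. cmod (f (rot N v (1 / real (Suc n)) * U)) \<le> B"
        using B mem by (intro AE_I2) (auto simp: space_M)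
      show "(\<lambda>U. f (rot N v (1 / real (Suc n)) * U)) \<in> borel_measurable M"
        by (rule measurable_compose[OF lmult_measurable[OF R]]) (use f in \<open>simp add: bdd_meas_def\<close>)
    qed
    then show ?thesis using left_invariant[OF R f] bdd_meas_integrable[OF f] by simp
  qed
  have "(\<lambda>n. LINT U|M. ?q n U) \<longlonglongrightarrow> (LINT U|M. D U)"
  proof (rule integral_dominated_convergence[where w = "\<lambda>_. C"])
    show "D \<in> borel_measurable M" using D by (simp add: bdd_meas_def)
    show "?q n \<in> borel_measurable M" for n
    proof -
      have "(\<lambda>U. f (rot N v (1 / real (Suc n)) * U)) \<in> borel_measurable M"
        by (rule measurable_compose[OF lmult_measurable[OF rot_unitary[OF v]]]) (use f in \<open>simp add: bdd_meas_def\<close>)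
      then show ?thesis using f
        by (intro borel_measurable_times borel_measurable_const borel_measurable_diff) (simp_all add: bdd_meas_def)
    qed
    show "AE U in M. (\<lambda>n. ?q n U) \<longlonglongrightarrow> D U" using lim by (intro AE_I2) (simp add: space_M)
    show "AE U in M. cmod (?q n U) \<le> C" for n using bnd by (intro AE_I2) (simp add: space_M)
  qed simp
  then show ?thesis unfolding qi by (simp add: LIMSEQ_const_iff)
qed

text \<open>The coefficient of \<open>P\<^sub>p\<^sub>q\<close> in the derivative along \<open>P\<close> of \<open>(U^m)\<^sub>j\<^sub>k \<Prod>\<^sub>l tr(U^(a l))\<close>.\<close>

definition loop_integrand :: "int \<Rightarrow> 'i set \<Rightarrow> ('i \<Rightarrow> int) \<Rightarrow> nat \<Rightarrow> nat \<Rightarrow> nat \<Rightarrow> nat \<Rightarrow> complex mat \<Rightarrow> complex" where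
  "loop_integrand m L a j k p q W =
     oriented_sum m (\<lambda>s. ipow W s $$ (j, p) * ipow W (m - s) $$ (q, k)) * (\<Prod>l\<in>L. mat_trace (ipow W (a l)))
     + ipow W m $$ (j, k) * (\<Sum>l\<in>L. of_int (a l) * ipow W (a l) $$ (q, p) * (\<Prod>i\<in>L-{l}. mat_trace (ipow W (a i))))"

lemma bdd_meas_loop_integrand:
  "j < N \<Longrightarrow> k < N \<Longrightarrow> p < N \<Longrightarrow> q < N \<Longrightarrow> bdd_meas (loop_integrand m L a j k p q)"
  unfolding loop_integrand_def[abs_def]
  by (intro bdd_meas_add bdd_meas_mult bdd_meas_oriented_sum bdd_meas_sum bdd_meas_prod bdd_meas_ipow bdd_meas_trace bdd_meas_const)

text \<open>The expectations form a matrix whose quadratic form vanishes on unit vectors.\<close>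

lemma expectation_loop_integrand:
  assumes jk: "j < N" "k < N" and pq: "p < N" "q < N"
  shows "(LINT W|M. loop_integrand m L a j k p q W) = 0"
proof (rule polarization_zero[where c = "\<lambda>p q. LINT W|M. loop_integrand m L a j k p q W", OF _ pq])
  fix v :: "nat \<Rightarrow> complex" assume v: "(\<Sum>i<N. (cmod (v i))\<^sup>2) = 1"
  let ?T = "\<lambda>W a. mat_trace (ipow W a)"
  let ?D = "\<lambda>W. \<i> * (\<Sum>p<N. \<Sum>q<N. v p * cnj (v q) * loop_integrand m L a j k p q W)"
  have nD: "bdd_meas ?D" by (intro bdd_meas_mult bdd_meas_const bdd_meas_sum bdd_meas_loop_integrand jk) auto
  have "(LINT W|M. ?D W) = 0"
  proof (rule expectation_derivative_zero[OF v, where f = "\<lambda>U. ipow U m $$ (j, k) * (\<Prod>l\<in>L. ?T U (a l))"])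
    show "bdd_meas (\<lambda>U. ipow U m $$ (j, k) * (\<Prod>l\<in>L. ?T U (a l)))"
      by (intro bdd_meas_mult bdd_meas_prod bdd_meas_ipow bdd_meas_trace jk)
    fix W assume W: "W \<in> unitary_group N"
    have r0: "rot N v 0 * W = W" using unitaryD(1)[OF W] by (simp add: rot_0 left_mult_one_mat)
    let ?S = "\<lambda>a. \<Sum>p<N. \<Sum>q<N. v p * cnj (v q) * ipow W a $$ (q, p)"
    have "((\<lambda>t. ipow (rot N v t * W) m $$ (j, k) * (\<Prod>l\<in>L. ?T (rot N v t * W) (a l))) has_vector_derivative
       (ipow (rot N v 0 * W) m $$ (j, k) * (\<Sum>l\<in>L. (\<i> * (of_int (a l) * ?S (a l))) * (\<Prod>i\<in>L-{l}. ?T (rot N v 0 * W) (a i)))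
        + (\<i> * oriented_sum m (\<lambda>s. lvec N v W s j * rvec N v W (m - s) k)) * (\<Prod>l\<in>L. ?T (rot N v 0 * W) (a l)))) (at 0)"
      by (intro has_vector_derivative_mult has_vector_derivative_prod trace_deriv ipow_deriv v W jk)
    moreover have "ipow W m $$ (j, k) * (\<Sum>l\<in>L. (\<i> * (of_int (a l) * ?S (a l))) * (\<Prod>i\<in>L-{l}. ?T W (a i)))
        + (\<i> * oriented_sum m (\<lambda>s. lvec N v W s j * rvec N v W (m - s) k)) * (\<Prod>l\<in>L. ?T W (a l)) = ?D W"
    proof -
      have A: "oriented_sum m (\<lambda>s. lvec N v W s j * rvec N v W (m - s) k)
        = (\<Sum>p<N. \<Sum>q<N. v p * cnj (v q) * oriented_sum m (\<lambda>s. ipow W s $$ (j, p) * ipow W (m - s) $$ (q, k)))"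
        unfolding lvec_def rvec_def sum_product oriented_sum_sum
        by (intro sum.cong refl) (simp add: oriented_sum_cmult[symmetric] mult_ac)
      have B: "(\<Sum>l\<in>L. (\<i> * (of_int (a l) * ?S (a l))) * (\<Prod>i\<in>L-{l}. ?T W (a i)))
        = \<i> * (\<Sum>p<N. \<Sum>q<N. v p * cnj (v q) * (\<Sum>l\<in>L. of_int (a l) * ipow W (a l) $$ (q, p) * (\<Prod>i\<in>L-{l}. ?T W (a i))))"
      proof -
        have "(\<Sum>l\<in>L. \<Sum>p<N. \<Sum>q<N. F l p q) = (\<Sum>p<N. \<Sum>q<N. \<Sum>l\<in>L. F l p q)" for F :: "_ \<Rightarrow> nat \<Rightarrow> nat \<Rightarrow> complex"
          by (subst sum.swap, rule sum.cong[OF refl], rule sum.swap)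
        then show ?thesis by (simp add: sum_distrib_left sum_distrib_right mult_ac)
      qed
      show ?thesis unfolding A B loop_integrand_def
        by (simp add: sum_distrib_left sum_distrib_right sum.distrib distrib_left distrib_right mult_ac)
    qed
    ultimately show "((\<lambda>t. ipow (rot N v t * W) m $$ (j, k) * (\<Prod>l\<in>L. ?T (rot N v t * W) (a l))) has_vector_derivative ?D W) (at 0)"
      unfolding r0 by simp
  qed (rule nD)
  also have "(LINT W|M. ?D W) = \<i> * (\<Sum>p<N. \<Sum>q<N. v p * cnj (v q) * (LINT W|M. loop_integrand m L a j k p q W))"
  proof -
    have i: "integrable M (loop_integrand m L a j k p q)" if "p < N" "q < N" for p q
      using that jk by (intro bdd_meas_integrable bdd_meas_loop_integrand)
    have "(LINT W|M. ?D W) = \<i> * (LINT W|M. (\<Sum>p<N. \<Sum>q<N. v p * cnj (v q) * loop_integrand m L a j k p q W))"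
      by (rule integral_mult_right_zero)
    also have "(LINT W|M. (\<Sum>p<N. \<Sum>q<N. v p * cnj (v q) * loop_integrand m L a j k p q W))
       = (\<Sum>p<N. \<Sum>q<N. LINT W|M. v p * cnj (v q) * loop_integrand m L a j k p q W)"
      using i by (intro integral_sum2 integrable_mult_right)
    finally show ?thesis by (simp only: integral_mult_right_zero)
  qed
  finally show "(\<Sum>p<N. \<Sum>q<N. v p * cnj (v q) * (LINT W|M. loop_integrand m L a j k p q W)) = 0" by simp
qed

text \<open>Sum over \<open>j = p\<close> and \<open>k = q\<close>: the Leibniz terms become products of two traces, and a trace factor is
  merged with the opened one.\<close>

lemma loop_equation:
  "(LINT W|M. oriented_sum m (\<lambda>s. mat_trace (ipow W s) * mat_trace (ipow W (m - s))) * (\<Prod>l\<in>L. mat_trace (ipow W (a l)))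
     + (\<Sum>l\<in>L. of_int (a l) * mat_trace (ipow W (m + a l)) * (\<Prod>i\<in>L-{l}. mat_trace (ipow W (a i))))) = 0"
  (is "(LINT W|M. ?F W) = 0")
proof -
  have "(LINT W|M. ?F W) = (LINT W|M. (\<Sum>p<N. \<Sum>q<N. loop_integrand m L a p q p q W))"
  proof (rule Bochner_Integration.integral_cong[OF refl])
    fix W assume "W \<in> space M"
    then have W: "W \<in> unitary_group N" by (simp add: space_M)
    have tr: "mat_trace (ipow W b) = (\<Sum>p<N. ipow W b $$ (p, p))" for b
      by (rule mat_trace_index[OF ipow_carrier[OF W]])
    have A: "(\<Sum>p<N. \<Sum>q<N. oriented_sum m (\<lambda>s. ipow W s $$ (p, p) * ipow W (m - s) $$ (q, q)))
       = oriented_sum m (\<lambda>s. mat_trace (ipow W s) * mat_trace (ipow W (m - s)))"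
      unfolding tr sum_product oriented_sum_sum ..
    have B: "(\<Sum>p<N. \<Sum>q<N. ipow W m $$ (p, q) * (\<Sum>l\<in>L. of_int (a l) * ipow W (a l) $$ (q, p) * (\<Prod>i\<in>L-{l}. mat_trace (ipow W (a i)))))
       = (\<Sum>l\<in>L. of_int (a l) * mat_trace (ipow W (m + a l)) * (\<Prod>i\<in>L-{l}. mat_trace (ipow W (a i))))"
    proof -
      have "mat_trace (ipow W (m + b)) = (\<Sum>p<N. \<Sum>q<N. ipow W m $$ (p, q) * ipow W b $$ (q, p))" for b
        unfolding tr by (intro sum.cong refl) (simp add: ipow_add_index[OF W])
      note t = this
      have "(\<Sum>l\<in>L. \<Sum>p<N. \<Sum>q<N. F l p q) = (\<Sum>p<N. \<Sum>q<N. \<Sum>l\<in>L. F l p q)" for F :: "_ \<Rightarrow> nat \<Rightarrow> nat \<Rightarrow> complex"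
        by (subst sum.swap, rule sum.cong[OF refl], rule sum.swap)
      note this[symmetric]
      then show ?thesis unfolding t by (simp add: sum_distrib_left sum_distrib_right mult_ac)
    qed
    show "?F W = (\<Sum>p<N. \<Sum>q<N. loop_integrand m L a p q p q W)"
      unfolding loop_integrand_def sum.distrib B sum_distrib_right[symmetric] A ..
  qed
  also have "\<dots> = (\<Sum>p<N. \<Sum>q<N. LINT W|M. loop_integrand m L a p q p q W)"
    by (intro integral_sum2 bdd_meas_integrable bdd_meas_loop_integrand)
  also have "\<dots> = 0" by (simp add: expectation_loop_integrand)
  finally show ?thesis .
qed

definition eigvals :: "complex mat \<Rightarrow> nat \<Rightarrow> complex" where
  "eigvals U = (SOME x. x \<in> torus N \<and> (\<forall>a. mat_trace (ipow U a) = psum N a x))"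

lemma eigvals:
  assumes "U \<in> unitary_group N"
  shows "eigvals U \<in> torus N" "psum N a (eigvals U) = mat_trace (ipow U a)"
proof -
  have "eigvals U \<in> torus N \<and> (\<forall>a. mat_trace (ipow U a) = psum N a (eigvals U))"
    unfolding eigvals_def
    by (rule someI_ex[of "\<lambda>x. x \<in> torus N \<and> (\<forall>a. mat_trace (ipow U a) = psum N a x)"])
       (use unitary_spectrum[OF assms] in blast)
  then show "eigvals U \<in> torus N" "psum N a (eigvals U) = mat_trace (ipow U a)" by auto
qed

lemma bdd_meas_symspan: "symspan N g \<Longrightarrow> bdd_meas (\<lambda>U. g (eigvals U))"
proof (induction rule: symspan.induct)
  case (base I a)
  have "bdd_meas (\<lambda>U. \<Prod>i\<in>I. mat_trace (ipow U (a i)))" by (intro bdd_meas_prod bdd_meas_trace)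
  then show ?case by (subst bdd_meas_cong) (auto simp: eigvals)
qed (auto intro: bdd_meas_add bdd_meas_mult bdd_meas_const)

lemma weyl: "weyl_functional N (\<lambda>g. LINT U|M. g (eigvals U))"
proof
  show "(LINT U|M. g (eigvals U) + h (eigvals U)) = (LINT U|M. g (eigvals U)) + (LINT U|M. h (eigvals U))"
    if "symspan N g" "symspan N h" for g h
    using that by (intro Bochner_Integration.integral_add bdd_meas_integrable bdd_meas_symspan)
  show "(LINT U|M. g (eigvals U)) = (LINT U|M. h (eigvals U))" if "\<And>x. x \<in> torus N \<Longrightarrow> g x = h x" for g h
    using that by (intro Bochner_Integration.integral_cong refl) (simp add: space_M eigvals)
  show "(LINT U|M. loop_term N m L a (eigvals U)) = 0" for m and L :: "(nat + nat) set" and a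
  proof -
    have "(LINT U|M. loop_term N m L a (eigvals U)) = (LINT W|M. oriented_sum m (\<lambda>s. mat_trace (ipow W s) * mat_trace (ipow W (m - s))) * (\<Prod>l\<in>L. mat_trace (ipow W (a l)))
     + (\<Sum>l\<in>L. of_int (a l) * mat_trace (ipow W (m + a l)) * (\<Prod>i\<in>L-{l}. mat_trace (ipow W (a i)))))"
      by (intro Bochner_Integration.integral_cong refl) (simp add: space_M eigvals loop_term_def)
    then show ?thesis using loop_equation by metis
  qed
qed (simp_all add: prob_space)

text \<open>Weyl's integration formula for products of traces of powers.\<close>

theorem expectation_trace_prod:
  assumes "finite (I :: (nat + nat) set)" "(\<Sum>i\<in>I. a i) = 0"
  shows "(LINT U|M. (\<Prod>i\<in>I. mat_trace (ipow U (a i)))) = alt_coeff N I a (\<lambda>r. if r < N then int r else 0)"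
proof -
  have "(LINT U|M. (\<Prod>i\<in>I. mat_trace (ipow U (a i)))) = (LINT U|M. (\<Prod>i\<in>I. psum N (a i) (eigvals U)))"
    by (intro Bochner_Integration.integral_cong refl) (simp add: space_M eigvals)
  also have "\<dots> = alt_coeff N I a (\<lambda>r. if r < N then int r else 0)"
    by (rule weyl_functional.E_psum_prod[OF weyl assms])
  finally show ?thesis .
qed

end

section \<open>Alternant coefficients as signed counts of closed walks\<close>

text \<open>The counterpart of \<^const>\<open>D_partial\<close> for integer increments \<open>d\<close> of the blocks.\<close>

definition drift :: "('b \<Rightarrow> 'b) \<Rightarrow> ('b \<Rightarrow> int) \<Rightarrow> 'b \<Rightarrow> nat \<Rightarrow> int" where
  "drift \<sigma> d B j = (\<Sum>a<j. d ((\<sigma> ^^ a) B))"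

text \<open>The same choice of an initial block as in \<^const>\<open>omega_cyc\<close>.\<close>

definition cycle_rep :: "'b set \<Rightarrow> 'b" where
  "cycle_rep C = (SOME B. B \<in> C)"

text \<open>On every cycle of \<open>\<sigma>\<close> such an assignment of levels is a closed walk in a strip of width \<open>N\<close>.\<close>

definition walks :: "nat \<Rightarrow> 'b set \<Rightarrow> ('b \<Rightarrow> 'b) \<Rightarrow> ('b \<Rightarrow> int) \<Rightarrow> ('b \<Rightarrow> nat) set" where
  "walks N \<pi> \<sigma> d = {m \<in> \<pi> \<rightarrow>\<^sub>E {..<N}. \<forall>B\<in>\<pi>. int (m (\<sigma> B)) = int (m B) + d B}"

definition starts :: "nat \<Rightarrow> ('b \<Rightarrow> 'b) \<Rightarrow> ('b \<Rightarrow> int) \<Rightarrow> 'b set \<Rightarrow> nat set" where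
  "starts N \<sigma> d C = {r. r < N \<and> drift \<sigma> d (cycle_rep C) (card C) = 0 \<and>
     (\<forall>j<card C. 0 \<le> int r + drift \<sigma> d (cycle_rep C) j \<and> int r + drift \<sigma> d (cycle_rep C) j < int N)}"

lemma cycle_enum:
  assumes \<sigma>: "permutation \<sigma>" and B: "B \<in> orbit \<sigma> x"
  shows "bij_betw (\<lambda>j. (\<sigma> ^^ j) B) {..<card (orbit \<sigma> x)} (orbit \<sigma> x)"
    and "(\<sigma> ^^ card (orbit \<sigma> x)) B = B" and "0 < card (orbit \<sigma> x)"
proof -
  have self: "B \<in> orbit \<sigma> B" by (rule permutation_self_in_orbit[OF \<sigma>])
  have eq: "orbit \<sigma> B = orbit \<sigma> x"
    by (rule orbit_cyclic_eq3[OF cyclic_on_orbit'[OF \<sigma>] B])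
  let ?n = "funpow_dist1 \<sigma> B B"
  have b: "bij_betw (\<lambda>j. (\<sigma> ^^ j) B) {0..<?n} (orbit \<sigma> B)"
    unfolding bij_betw_def using inj_on_funpow_dist1[OF self] orbit_conv_funpow_dist1[OF self] by simp
  then have "card (orbit \<sigma> B) = ?n" using bij_betw_same_card by fastforce
  then have n: "card (orbit \<sigma> x) = ?n" unfolding eq .
  show "bij_betw (\<lambda>j. (\<sigma> ^^ j) B) {..<card (orbit \<sigma> x)} (orbit \<sigma> x)"
    using b unfolding n eq by (simp only: atLeast0LessThan)
  show "(\<sigma> ^^ card (orbit \<sigma> x)) B = B" unfolding n by (rule funpow_dist1_prop[OF self])
  show "0 < card (orbit \<sigma> x)" unfolding n by simp
qed

lemma cycle_rep_in: "permutation \<sigma> \<Longrightarrow> cycle_rep (orbit \<sigma> x) \<in> orbit \<sigma> x"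
  unfolding cycle_rep_def by (rule someI[of "\<lambda>B. B \<in> orbit \<sigma> x"]) (rule permutation_self_in_orbit)

lemma walks_iterate:
  assumes \<sigma>: "\<sigma> permutes \<pi>" and m: "m \<in> walks N \<pi> \<sigma> d" and B: "B \<in> \<pi>"
  shows "int (m ((\<sigma> ^^ j) B)) = int (m B) + drift \<sigma> d B j"
proof (induction j)
  case 0
  then show ?case by (simp add: drift_def)
next
  case (Suc j)
  have "(\<sigma> ^^ j) B \<in> \<pi>" by (induction j) (use \<sigma> B in \<open>auto simp: permutes_in_image\<close>)
  then have "int (m (\<sigma> ((\<sigma> ^^ j) B))) = int (m ((\<sigma> ^^ j) B)) + d ((\<sigma> ^^ j) B)"
    using m by (simp add: walks_def)
  then show ?case using Suc by (simp add: drift_def)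
qed

text \<open>On a cycle all levels are determined by the level of the initial block, and the walk closes up
  exactly if the total increment is zero; different cycles are independent.\<close>

lemma walks_bij:
  assumes \<sigma>: "\<sigma> permutes \<pi>" and fin: "finite \<pi>"
  shows "bij_betw (\<lambda>m. \<lambda>C\<in>orbit \<sigma> ` \<pi>. m (cycle_rep C)) (walks N \<pi> \<sigma> d)
     (PiE (orbit \<sigma> ` \<pi>) (starts N \<sigma> d))"
proof -
  have perm: "permutation \<sigma>" by (rule permutes_imp_permutation[OF fin \<sigma>])
  note enum = cycle_enum[OF perm]
  let ?O = "orbit \<sigma>"
  have sub: "?O B \<subseteq> \<pi>" if "B \<in> \<pi>" for B by (rule permutes_orbit_subset[OF \<sigma> that])
  have rep: "cycle_rep (?O B) \<in> ?O B" for B by (rule cycle_rep_in[OF perm])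
  have rep\<pi>: "cycle_rep (?O B) \<in> \<pi>" if "B \<in> \<pi>" for B using rep sub that by blast
  have self: "B \<in> ?O B" for B by (rule permutation_self_in_orbit[OF perm])
  have idx: "\<exists>j<card (?O B). (\<sigma> ^^ j) (cycle_rep (?O B)) = B" for B
  proof -
    have "B \<in> (\<lambda>j. (\<sigma> ^^ j) (cycle_rep (?O B))) ` {..<card (?O B)}"
      using enum(1)[OF rep] self[of B] unfolding bij_betw_def by blast
    then show ?thesis by auto
  qed
  define ix where "ix = (\<lambda>B. SOME j. j < card (?O B) \<and> (\<sigma> ^^ j) (cycle_rep (?O B)) = B)"
  have ix: "ix B < card (?O B)" "(\<sigma> ^^ ix B) (cycle_rep (?O B)) = B" for B
    using someI_ex[OF idx[of B]] unfolding ix_def by auto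
  have ixu: "ix B = j" if "j < card (?O B)" "(\<sigma> ^^ j) (cycle_rep (?O B)) = B" for B j
    using enum(1)[OF rep, of B] ix[of B] that unfolding bij_betw_def inj_on_def by auto
  show ?thesis
  proof (rule bij_betwI')
    fix m m' assume m: "m \<in> walks N \<pi> \<sigma> d" and m': "m' \<in> walks N \<pi> \<sigma> d"
    show "((\<lambda>C\<in>?O ` \<pi>. m (cycle_rep C)) = (\<lambda>C\<in>?O ` \<pi>. m' (cycle_rep C))) = (m = m')"
    proof
      assume eq: "(\<lambda>C\<in>?O ` \<pi>. m (cycle_rep C)) = (\<lambda>C\<in>?O ` \<pi>. m' (cycle_rep C))"
      show "m = m'"
      proof
        fix B show "m B = m' B"
        proof (cases "B \<in> \<pi>")
          case True
          have "m (cycle_rep (?O B)) = m' (cycle_rep (?O B))"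
            using fun_cong[OF eq, of "?O B"] True by simp
          then have "int (m ((\<sigma> ^^ ix B) (cycle_rep (?O B)))) = int (m' ((\<sigma> ^^ ix B) (cycle_rep (?O B))))"
            unfolding walks_iterate[OF \<sigma> m rep\<pi>[OF True]] walks_iterate[OF \<sigma> m' rep\<pi>[OF True]] by simp
          then show ?thesis by (simp add: ix)
        next
          case False
          then show ?thesis using m m' by (auto simp: walks_def PiE_def extensional_def)
        qed
      qed
    qed simp
  next
    fix m assume m: "m \<in> walks N \<pi> \<sigma> d"
    show "(\<lambda>C\<in>?O ` \<pi>. m (cycle_rep C)) \<in> PiE (?O ` \<pi>) (starts N \<sigma> d)"
    proof (rule restrict_PiE_iff[THEN iffD2], rule ballI)
      fix C assume "C \<in> ?O ` \<pi>"
      then obtain B where B: "B \<in> \<pi>" "C = ?O B" by auto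
      let ?R = "cycle_rep C"
      have R: "?R \<in> \<pi>" using rep\<pi>[OF B(1)] B(2) by simp
      have mN: "m B' < N" if "B' \<in> \<pi>" for B' using m that by (auto simp: walks_def PiE_iff)
      have in\<pi>: "(\<sigma> ^^ j) ?R \<in> \<pi>" for j
        by (induction j) (use \<sigma> R in \<open>auto simp: permutes_in_image\<close>)
      have "drift \<sigma> d ?R (card C) = 0"
        using walks_iterate[OF \<sigma> m R, of "card C"] enum(2)[OF rep, of B] unfolding B(2) by simp
      moreover have "0 \<le> int (m ?R) + drift \<sigma> d ?R j \<and> int (m ?R) + drift \<sigma> d ?R j < int N" for j
        unfolding walks_iterate[OF \<sigma> m R, symmetric] using mN[OF in\<pi>] by simp
      ultimately show "m ?R \<in> starts N \<sigma> d C" using mN[OF R] by (simp add: starts_def)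
    qed
  next
    fix \<rho> assume \<rho>: "\<rho> \<in> PiE (?O ` \<pi>) (starts N \<sigma> d)"
    define m where "m = (\<lambda>B\<in>\<pi>. nat (int (\<rho> (?O B)) + drift \<sigma> d (cycle_rep (?O B)) (ix B)))"
    have st: "\<rho> (?O B) \<in> starts N \<sigma> d (?O B)" if "B \<in> \<pi>" for B using \<rho> that by (auto simp: PiE_iff)
    have mv: "int (m B) = int (\<rho> (?O B)) + drift \<sigma> d (cycle_rep (?O B)) (ix B) \<and> m B < N" if "B \<in> \<pi>" for B
      using st[OF that] ix(1)[of B] that by (auto simp: m_def starts_def)
    have step: "int (m (\<sigma> B)) = int (m B) + d B" if B: "B \<in> \<pi>" for B
    proof -
      let ?R = "cycle_rep (?O B)"
      have \<sigma>B: "\<sigma> B \<in> \<pi>" using B \<sigma> by (simp add: permutes_in_image)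
      have OB: "?O (\<sigma> B) = ?O B" by (rule permutation_orbit_step[OF perm])
      have s: "(\<sigma> ^^ Suc (ix B)) ?R = \<sigma> B" using ix(2)[of B] by simp
      have D: "drift \<sigma> d ?R (Suc (ix B)) = drift \<sigma> d ?R (ix B) + d B" using ix(2)[of B] by (simp add: drift_def)
      show ?thesis
      proof (cases "Suc (ix B) < card (?O B)")
        case True
        then have "ix (\<sigma> B) = Suc (ix B)" using ixu[of "Suc (ix B)" "\<sigma> B"] s OB by simp
        then show ?thesis using mv[OF \<sigma>B] mv[OF B] D OB by simp
      next
        case False
        then have c: "Suc (ix B) = card (?O B)" using ix(1)[of B] by simp
        then have "\<sigma> B = ?R" using s enum(2)[OF rep, of B] by simp
        then have "ix (\<sigma> B) = 0" using ixu[of 0 "\<sigma> B"] OB enum(3)[OF rep, of B] by simp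
        moreover have "drift \<sigma> d ?R (Suc (ix B)) = 0" unfolding c using st[OF B] by (simp add: starts_def)
        ultimately show ?thesis using mv[OF \<sigma>B] mv[OF B] D OB by (simp add: drift_def)
      qed
    qed
    have "m \<in> walks N \<pi> \<sigma> d"
      unfolding walks_def using step mv by (auto simp: m_def)
    moreover have "\<rho> = (\<lambda>C\<in>?O ` \<pi>. m (cycle_rep C))"
    proof
      fix C show "\<rho> C = (\<lambda>C\<in>?O ` \<pi>. m (cycle_rep C)) C"
      proof (cases "C \<in> ?O ` \<pi>")
        case True
        then obtain B where B: "B \<in> \<pi>" "C = ?O B" by auto
        have OR: "?O (cycle_rep C) = C" unfolding B(2)
          by (rule orbit_cyclic_eq3[OF cyclic_on_orbit'[OF perm] rep])
        have "ix (cycle_rep C) = 0"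
          using ixu[of 0 "cycle_rep C"] OR enum(3)[OF rep, of B] B(2) by simp
        then have "int (m (cycle_rep C)) = int (\<rho> C)"
          using mv[of "cycle_rep C"] rep\<pi>[OF B(1)] B(2) OR by (simp add: drift_def)
        then show ?thesis using True by simp
      next
        case False
        then show ?thesis using \<rho> by (auto simp: PiE_def extensional_def)
      qed
    qed
    ultimately show "\<exists>m\<in>walks N \<pi> \<sigma> d. \<rho> = (\<lambda>C\<in>?O ` \<pi>. m (cycle_rep C))" by blast
  qed
qed

definition drift_span :: "('b \<Rightarrow> 'b) \<Rightarrow> ('b \<Rightarrow> int) \<Rightarrow> 'b set \<Rightarrow> int" where
  "drift_span \<sigma> d C = Max (drift \<sigma> d (cycle_rep C) ` {..<card C}) - Min (drift \<sigma> d (cycle_rep C) ` {..<card C})"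

definition cycle_count :: "nat \<Rightarrow> ('b \<Rightarrow> 'b) \<Rightarrow> ('b \<Rightarrow> int) \<Rightarrow> 'b set \<Rightarrow> nat" where
  "cycle_count N \<sigma> d C = (if drift \<sigma> d (cycle_rep C) (card C) = 0 then nat (int N - drift_span \<sigma> d C) else 0)"

text \<open>The walk stays in the strip if its lowest and its highest point do, so the admissible initial levels form
  an interval, shorter than the strip by the range of the walk.\<close>

lemma card_starts:
  assumes "0 < card C"
  shows "card (starts N \<sigma> d C) = cycle_count N \<sigma> d C"
proof (cases "drift \<sigma> d (cycle_rep C) (card C) = 0")
  case True
  let ?S = "drift \<sigma> d (cycle_rep C) ` {..<card C}"
  have S: "finite ?S" "?S \<noteq> {}" using assms by auto
  have 0: "0 \<in> ?S" using assms by (auto simp: drift_def intro!: image_eqI[of _ _ 0])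
  have m: "Min ?S \<le> 0" "0 \<le> Max ?S" using S 0 by (auto intro: Min_le Max_ge)
  have "starts N \<sigma> d C = {r. \<forall>s\<in>?S. 0 \<le> int r + s \<and> int r + s < int N}"
  proof (intro equalityI subsetI CollectI)
    fix r assume "r \<in> {r. \<forall>s\<in>?S. 0 \<le> int r + s \<and> int r + s < int N}"
    then have *: "\<forall>s\<in>?S. 0 \<le> int r + s \<and> int r + s < int N" by blast
    then have "int r + 0 < int N" using 0 by blast
    with * show "r \<in> starts N \<sigma> d C" using True by (simp add: starts_def)
  qed (auto simp: starts_def)
  also have "\<dots> = {r. 0 \<le> int r + Min ?S \<and> int r + Max ?S < int N}"
  proof (intro Collect_cong iffI conjI ballI)
    fix r s assume a: "0 \<le> int r + Min ?S \<and> int r + Max ?S < int N" "s \<in> ?S"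
    then have "Min ?S \<le> s" "s \<le> Max ?S" using S by auto
    with a show "0 \<le> int r + s" "int r + s < int N" by linarith+
  next
    fix r assume "\<forall>s\<in>?S. 0 \<le> int r + s \<and> int r + s < int N"
    then show "0 \<le> int r + Min ?S" "int r + Max ?S < int N"
      using Min_in[OF S] Max_in[OF S] by blast+
  qed
  also have "\<dots> = {nat (- Min ?S)..<nat (int N - Max ?S)}"
    using m by auto
  finally have "card (starts N \<sigma> d C) = nat (int N - Max ?S) - nat (- Min ?S)" by simp
  also have "\<dots> = nat (int N - drift_span \<sigma> d C)"
    using m by (simp add: drift_span_def nat_diff_distrib' algebra_simps)
  finally show ?thesis using True by (simp add: cycle_count_def)
qed (simp add: starts_def cycle_count_def)

lemma card_walks:
  assumes \<sigma>: "\<sigma> permutes \<pi>" and fin: "finite \<pi>"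
  shows "card (walks N \<pi> \<sigma> d) = (\<Prod>C\<in>orbit \<sigma> ` \<pi>. cycle_count N \<sigma> d C)"
proof -
  have perm: "permutation \<sigma>" by (rule permutes_imp_permutation[OF fin \<sigma>])
  have pos: "0 < card C" if "C \<in> orbit \<sigma> ` \<pi>" for C
    using that cycle_enum(3)[OF perm permutation_self_in_orbit[OF perm]] by auto
  have "card (walks N \<pi> \<sigma> d) = card (PiE (orbit \<sigma> ` \<pi>) (starts N \<sigma> d))"
    by (rule bij_betw_same_card[OF walks_bij[OF assms]])
  also have "\<dots> = (\<Prod>C\<in>orbit \<sigma> ` \<pi>. card (starts N \<sigma> d C))"
    using fin by (intro card_PiE) auto
  finally show ?thesis using card_starts[OF pos] by (simp cong: prod.cong)
qed

lemma sum_Collect_conj: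
  "finite {x. P x} \<Longrightarrow> sum f {x. P x \<and> Q x} = (\<Sum>x | P x. if Q x then f x else 0)"
  using sum.inter_filter[of "{x. P x}" f Q] by simp

text \<open>The determinant of the 0-1 matrix whose entry at \<open>(B, B')\<close> tells whether \<open>m B' = m B + d B\<close>.\<close>

definition signed_count :: "'b set \<Rightarrow> ('b \<Rightarrow> int) \<Rightarrow> ('b \<Rightarrow> nat) \<Rightarrow> int" where
  "signed_count \<pi> d m = (\<Sum>\<sigma> | \<sigma> permutes \<pi> \<and> (\<forall>B\<in>\<pi>. int (m (\<sigma> B)) = int (m B) + d B). sign \<sigma>)"

text \<open>Two blocks with the same level give equal columns of the matrix; composing with their transposition
  pairs the terms of opposite sign.\<close>

lemma signed_count_noninj:
  assumes fin: "finite \<pi>" and ninj: "\<not> inj_on m \<pi>"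
  shows "signed_count \<pi> d m = 0"
proof -
  from ninj obtain B B' where B: "B \<in> \<pi>" "B' \<in> \<pi>" "B \<noteq> B'" "m B = m B'" by (auto simp: inj_on_def)
  let ?t = "Transposition.transpose B B'"
  let ?A = "{\<sigma>. \<sigma> permutes \<pi> \<and> (\<forall>B\<in>\<pi>. int (m (\<sigma> B)) = int (m B) + d B)}"
  have t: "?t permutes \<pi>" using B by (intro permutes_swap_id) auto
  have mt: "m (?t x) = m x" for x using B(4) by (auto simp: Transposition.transpose_def)
  have tt: "?t \<circ> (?t \<circ> \<sigma>) = \<sigma>" for \<sigma> :: "'a \<Rightarrow> 'a" by (simp add: fun_eq_iff)
  have sgn: "sign (?t \<circ> \<sigma>) = - sign \<sigma>" if "\<sigma> \<in> ?A" for \<sigma>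
    using that B fin by (subst sign_compose) (auto simp: sign_swap_id permutation_swap_id intro: permutes_imp_permutation)
  have mem: "?t \<circ> \<sigma> \<in> ?A" if "\<sigma> \<in> ?A" for \<sigma>
    using that t by (auto simp: mt intro: permutes_compose)
  have "(\<Sum>\<sigma>\<in>?A. sign \<sigma>) = (\<Sum>\<sigma>\<in>?A. - sign \<sigma>)"
    by (rule sum.reindex_bij_witness[of _ "\<lambda>\<sigma>. ?t \<circ> \<sigma>" "\<lambda>\<sigma>. ?t \<circ> \<sigma>"]) (use mem sgn tt in auto)
  then have "(\<Sum>\<sigma>\<in>?A. sign \<sigma>) = - (\<Sum>\<sigma>\<in>?A. sign \<sigma>)" by (simp add: sum_negf)
  then show ?thesis unfolding signed_count_def by linarith
qed

definition block_of :: "'i set set \<Rightarrow> 'i \<Rightarrow> 'i set" where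
  "block_of \<pi> i = (THE B. B \<in> \<pi> \<and> i \<in> B)"

definition assign :: "'i set \<Rightarrow> 'i set set \<Rightarrow> ('i set \<Rightarrow> nat) \<Rightarrow> 'i \<Rightarrow> nat" where
  "assign \<Omega> \<pi> m = (\<lambda>i\<in>\<Omega>. m (block_of \<pi> i))"

lemma block_of_eq:
  assumes "partition_on \<Omega> \<pi>" "B \<in> \<pi>" "i \<in> B"
  shows "block_of \<pi> i = B"
  unfolding block_of_def using assms partition_onD2[OF assms(1)] by (intro the_equality) (auto simp: disjoint_def)

lemma block_of_in:
  assumes "partition_on \<Omega> \<pi>" "i \<in> \<Omega>"
  shows "block_of \<pi> i \<in> \<pi>" "i \<in> block_of \<pi> i"
proof -
  obtain B where "B \<in> \<pi>" "i \<in> B" using assms partition_onD1[OF assms(1)] by blast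
  then show "block_of \<pi> i \<in> \<pi>" "i \<in> block_of \<pi> i" using block_of_eq[OF assms(1)] by metis+
qed

text \<open>A permutation \<open>\<tau>\<close> of the exponents that is compatible with \<open>\<phi>\<close> fixes every level not taken by \<open>\<phi>\<close>, so it
  is a permutation of the levels taken; these are in bijection with the fibres of \<open>\<phi>\<close>, the blocks.\<close>

lemma signed_count_eq:
  fixes \<Omega> :: "'i set"
  assumes part: "partition_on \<Omega> \<pi>" and fin: "finite \<Omega>" and m: "m \<in> \<pi> \<rightarrow>\<^sub>E {..<N}" and inj: "inj_on m \<pi>"
  shows "(\<Sum>\<tau> | \<tau> permutes {..<N} \<and> (\<forall>r<N. int (\<tau> r) + (\<Sum>i\<in>\<Omega>. if assign \<Omega> \<pi> m i = r then a i else 0) = int r). sign \<tau>)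
    = signed_count \<pi> (\<lambda>B. - (\<Sum>i\<in>B. a i)) m"
proof -
  let ?\<phi> = "assign \<Omega> \<pi> m"
  let ?s = "\<lambda>r. \<Sum>i\<in>\<Omega>. if ?\<phi> i = r then a i else 0"
  have fin\<pi>: "finite \<pi>" by (rule finite_elements[OF fin part])
  have sum_in: "?s (m B) = (\<Sum>i\<in>B. a i)" if B: "B \<in> \<pi>" for B
  proof -
    have sub: "B \<subseteq> \<Omega>" using part B by (auto simp: partition_on_def)
    have "?\<phi> i = m B \<longleftrightarrow> i \<in> B" if "i \<in> \<Omega>" for i
      using that B inj block_of_in[OF part that] block_of_eq[OF part B] by (auto simp: assign_def inj_on_def)
    then have "?s (m B) = (\<Sum>i\<in>\<Omega>. if i \<in> B then a i else 0)" by (intro sum.cong) auto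
    also have "\<dots> = (\<Sum>i\<in>B. a i)" using fin sub by (simp add: sum.If_cases Int_absorb1)
    finally show ?thesis .
  qed
  have sum_out: "?s r = 0" if "r \<notin> m ` \<pi>" for r
    using that block_of_in[OF part] by (intro sum.neutral) (auto simp: assign_def)
  have sub: "m ` \<pi> \<subseteq> {..<N}" using m by auto
  let ?g = "inv_into \<pi> m"
  have bm: "bij_betw m \<pi> (m ` \<pi>)" and bg: "bij_betw ?g (m ` \<pi>) \<pi>"
    using inj by (auto simp: bij_betw_def inj_on_inv_into)
  have mp: "map_permutation \<pi> m \<sigma> (m B) = m (\<sigma> B)" if "B \<in> \<pi>" for \<sigma> B
    using that inj by (simp add: map_permutation_def restrict_id_def)
  have gp: "map_permutation (m ` \<pi>) ?g \<tau> B = ?g (\<tau> (m B))" if "B \<in> \<pi>" for \<tau> B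
  proof -
    have "B \<in> ?g ` m ` \<pi>" using that inj by force
    moreover have "inv_into (m ` \<pi>) ?g B = m B"
      using that inj bg by (intro inv_into_f_eq) (auto simp: bij_betw_def)
    ultimately show ?thesis by (simp add: map_permutation_def restrict_id_def)
  qed
  let ?S = "{\<tau>. \<tau> permutes {..<N} \<and> (\<forall>r<N. int (\<tau> r) + ?s r = int r)}"
  let ?T = "{\<sigma>. \<sigma> permutes \<pi> \<and> (\<forall>B\<in>\<pi>. int (m (\<sigma> B)) = int (m B) + - (\<Sum>i\<in>B. a i))}"
  have \<tau>m: "\<tau> permutes m ` \<pi>" if "\<tau> \<in> ?S" for \<tau>
  proof (rule permutes_superset)
    show "\<tau> permutes {..<N}" using that by simp
    show "\<tau> r = r" if "r \<in> {..<N} - m ` \<pi>" for r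
      using that \<open>\<tau> \<in> ?S\<close> sum_out[of r] by auto
  qed
  have e1: "map_permutation \<pi> m (map_permutation (m ` \<pi>) ?g \<tau>) = \<tau>" if "\<tau> \<in> ?S" for \<tau>
  proof -
    have tau: "\<tau> permutes m ` \<pi>" by (rule \<tau>m[OF that])
    have "map_permutation \<pi> m (map_permutation (m ` \<pi>) ?g \<tau>) = map_permutation (m ` \<pi>) (m \<circ> ?g) \<tau>"
      by (rule map_permutation_compose[OF bg inj])
    also have "\<dots> = map_permutation (m ` \<pi>) id \<tau>"
      by (rule map_permutation_cong) (use tau in \<open>auto simp: f_inv_into_f inj_on_def\<close>)
    also have "\<dots> = \<tau>" by (rule map_permutation_id[OF tau])
    finally show ?thesis .
  qed
  have e2: "map_permutation (m ` \<pi>) ?g (map_permutation \<pi> m \<sigma>) = \<sigma>" if "\<sigma> \<in> ?T" for \<sigma>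
  proof -
    have sig: "\<sigma> permutes \<pi>" using that by simp
    have "map_permutation (m ` \<pi>) ?g (map_permutation \<pi> m \<sigma>) = map_permutation \<pi> (?g \<circ> m) \<sigma>"
      by (rule map_permutation_compose[OF bm]) (use bg sig in \<open>auto simp: bij_betw_def\<close>)
    also have "\<dots> = map_permutation \<pi> id \<sigma>"
      by (rule map_permutation_cong) (use inj sig in \<open>auto simp: inj_on_def\<close>)
    also have "\<dots> = \<sigma>" by (rule map_permutation_id[OF sig])
    finally show ?thesis .
  qed
  show ?thesis unfolding signed_count_def
  proof (rule sum.reindex_bij_witness[of _ "map_permutation \<pi> m" "map_permutation (m ` \<pi>) ?g"])
    fix \<tau> assume \<tau>: "\<tau> \<in> ?S"
    show "map_permutation \<pi> m (map_permutation (m ` \<pi>) ?g \<tau>) = \<tau>" by (rule e1[OF \<tau>])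
    have p: "map_permutation (m ` \<pi>) ?g \<tau> permutes \<pi>"
      by (rule map_permutation_permutes[OF bg \<tau>m[OF \<tau>]])
    have "int (m (map_permutation (m ` \<pi>) ?g \<tau> B)) = int (m B) + - (\<Sum>i\<in>B. a i)" if B: "B \<in> \<pi>" for B
    proof -
      have "\<tau> (m B) \<in> m ` \<pi>" using permutes_in_image[OF \<tau>m[OF \<tau>]] B by blast
      then have "m (map_permutation (m ` \<pi>) ?g \<tau> B) = \<tau> (m B)" by (simp add: gp[OF B] f_inv_into_f)
      moreover have "m B < N" using m B by auto
      ultimately show ?thesis using \<tau> sum_in[OF B] by force
    qed
    then show "map_permutation (m ` \<pi>) ?g \<tau> \<in> ?T" using p by simp
    show "sign (map_permutation (m ` \<pi>) ?g \<tau>) = sign \<tau>"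
      by (rule sign_map_permutation) (use bg \<tau>m[OF \<tau>] fin\<pi> in \<open>auto simp: bij_betw_def\<close>)
  next
    fix \<sigma> assume \<sigma>: "\<sigma> \<in> ?T"
    show "map_permutation (m ` \<pi>) ?g (map_permutation \<pi> m \<sigma>) = \<sigma>" by (rule e2[OF \<sigma>])
    have p: "map_permutation \<pi> m \<sigma> permutes m ` \<pi>"
      by (rule map_permutation_permutes[OF bm]) (use \<sigma> in simp)
    have "int (map_permutation \<pi> m \<sigma> r) + ?s r = int r" for r
    proof (cases "r \<in> m ` \<pi>")
      case True
      then obtain B where B: "B \<in> \<pi>" "r = m B" by auto
      then show ?thesis using mp[OF B(1), of \<sigma>] \<sigma> sum_in[OF B(1)] by simp
    next
      case False
      then show ?thesis using sum_out permutes_not_in[OF p] by simp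
    qed
    then show "map_permutation \<pi> m \<sigma> \<in> ?S" using permutes_subset[OF p sub] by simp
  qed
qed

text \<open>A map is given by the partition into its fibres and an injective assignment of values to them.\<close>

lemma sum_assign:
  fixes \<Omega> :: "'i set" and F :: "('i \<Rightarrow> nat) \<Rightarrow> int"
  assumes fin: "finite \<Omega>"
  shows "(\<Sum>\<phi>\<in>\<Omega> \<rightarrow>\<^sub>E {..<N}. F \<phi>) =
    (\<Sum>\<pi> | partition_on \<Omega> \<pi>. \<Sum>m\<in>{m \<in> \<pi> \<rightarrow>\<^sub>E {..<N}. inj_on m \<pi>}. F (assign \<Omega> \<pi> m))"
proof -
  let ?P = "{\<pi>. partition_on \<Omega> \<pi>}"
  let ?M = "\<lambda>\<pi>. {m \<in> \<pi> \<rightarrow>\<^sub>E {..<N}. inj_on m \<pi>}"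
  let ?fib = "\<lambda>\<phi>. (\<lambda>r. {i \<in> \<Omega>. \<phi> i = r}) ` (\<phi> ` \<Omega>)"
  let ?val = "\<lambda>\<phi>. \<lambda>B\<in>?fib \<phi>. \<phi> (SOME i. i \<in> B)"
  have finP: "finite ?P" using finitely_many_partition_on[OF fin] .
  have finM: "finite (?M \<pi>)" if "\<pi> \<in> ?P" for \<pi>
    using finite_elements[OF fin] that by (intro finite_subset[OF _ finite_PiE[of \<pi> "\<lambda>_. {..<N}"]]) auto
  have val: "?val \<phi> {i \<in> \<Omega>. \<phi> i = \<phi> j} = \<phi> j" if "j \<in> \<Omega>" for \<phi> and j
  proof -
    have "(SOME i. i \<in> {i \<in> \<Omega>. \<phi> i = \<phi> j}) \<in> {i \<in> \<Omega>. \<phi> i = \<phi> j}"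
      by (rule someI[of _ j]) (use that in simp)
    then show ?thesis using that by simp
  qed
  have part: "partition_on \<Omega> (?fib \<phi>)" for \<phi> :: "'i \<Rightarrow> nat"
    by (rule partition_onI) (auto simp: disjnt_def)
  have "(\<Sum>\<phi>\<in>\<Omega> \<rightarrow>\<^sub>E {..<N}. F \<phi>) = (\<Sum>(\<pi>, m)\<in>Sigma ?P ?M. F (assign \<Omega> \<pi> m))"
  proof (rule sum.reindex_bij_witness[of _ "\<lambda>(\<pi>, m). assign \<Omega> \<pi> m" "\<lambda>\<phi>. (?fib \<phi>, ?val \<phi>)"])
    fix \<phi> assume \<phi>: "\<phi> \<in> \<Omega> \<rightarrow>\<^sub>E {..<N}"
    have eq: "assign \<Omega> (?fib \<phi>) (?val \<phi>) = \<phi>"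
    proof
      fix j show "assign \<Omega> (?fib \<phi>) (?val \<phi>) j = \<phi> j"
      proof (cases "j \<in> \<Omega>")
        case True
        then have "block_of (?fib \<phi>) j = {i \<in> \<Omega>. \<phi> i = \<phi> j}"
          by (intro block_of_eq[OF part]) auto
        then show ?thesis using True val[OF True, of \<phi>] by (simp only: assign_def restrict_apply if_True)
      next
        case False
        then show ?thesis using \<phi> by (auto simp: assign_def PiE_def extensional_def)
      qed
    qed
    then show "(case (?fib \<phi>, ?val \<phi>) of (\<pi>, m) \<Rightarrow> assign \<Omega> \<pi> m) = \<phi>" by simp
    show "(case (?fib \<phi>, ?val \<phi>) of (\<pi>, m) \<Rightarrow> F (assign \<Omega> \<pi> m)) = F \<phi>" using eq by simp
    have "?val \<phi> \<in> ?fib \<phi> \<rightarrow>\<^sub>E {..<N}"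
    proof (rule PiE_I)
      fix B assume "B \<in> ?fib \<phi>"
      then obtain j where "j \<in> \<Omega>" "B = {i \<in> \<Omega>. \<phi> i = \<phi> j}" by auto
      then show "?val \<phi> B \<in> {..<N}" using val[of j \<phi>] \<phi> by auto
    qed simp
    moreover have "inj_on (?val \<phi>) (?fib \<phi>)"
    proof (rule inj_onI)
      fix B B' assume BB: "B \<in> ?fib \<phi>" "B' \<in> ?fib \<phi>" "?val \<phi> B = ?val \<phi> B'"
      then obtain j j' where "j \<in> \<Omega>" "B = {i \<in> \<Omega>. \<phi> i = \<phi> j}" "j' \<in> \<Omega>" "B' = {i \<in> \<Omega>. \<phi> i = \<phi> j'}" by auto
      then show "B = B'" using BB(3) val[of j \<phi>] val[of j' \<phi>] by metis
    qed
    ultimately show "(?fib \<phi>, ?val \<phi>) \<in> Sigma ?P ?M" using part by simp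
  next
    fix z assume "z \<in> Sigma ?P ?M"
    then obtain \<pi> m where z: "z = (\<pi>, m)" "partition_on \<Omega> \<pi>" "m \<in> \<pi> \<rightarrow>\<^sub>E {..<N}" "inj_on m \<pi>" by auto
    let ?\<phi> = "assign \<Omega> \<pi> m"
    have blocks: "{i \<in> \<Omega>. ?\<phi> i = m B} = B" if "B \<in> \<pi>" for B
    proof -
      have "B \<subseteq> \<Omega>" using z(2) that by (auto simp: partition_on_def)
      then show ?thesis
      proof (intro equalityI subsetI)
        fix x assume "x \<in> {i \<in> \<Omega>. ?\<phi> i = m B}"
        then have x: "x \<in> \<Omega>" "m (block_of \<pi> x) = m B" by (auto simp: assign_def)
        then have "block_of \<pi> x = B" using z(4) that block_of_in(1)[OF z(2) x(1)] by (auto dest: inj_onD)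
        then show "x \<in> B" using block_of_in(2)[OF z(2) x(1)] by simp
      next
        fix x assume "x \<in> B"
        then show "x \<in> {i \<in> \<Omega>. ?\<phi> i = m B}"
          using \<open>B \<subseteq> \<Omega>\<close> block_of_eq[OF z(2) that, of x] by (auto simp: assign_def)
      qed
    qed
    have img: "?\<phi> ` \<Omega> = m ` \<pi>"
    proof (intro equalityI subsetI)
      fix r assume "r \<in> ?\<phi> ` \<Omega>"
      then show "r \<in> m ` \<pi>" using block_of_in[OF z(2)] by (auto simp: assign_def)
    next
      fix r assume "r \<in> m ` \<pi>"
      then obtain B where B: "B \<in> \<pi>" "r = m B" by auto
      then obtain i where "i \<in> B" using partition_onD3[OF z(2)] by (metis ex_in_conv)
      then have "i \<in> {i \<in> \<Omega>. ?\<phi> i = m B}" using blocks[OF B(1)] by simp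
      then show "r \<in> ?\<phi> ` \<Omega>" using B by (intro image_eqI[of _ _ i]) auto
    qed
    have fib: "?fib ?\<phi> = \<pi>" unfolding img image_image using blocks by simp
    have "?val ?\<phi> = m"
    proof
      fix B show "?val ?\<phi> B = m B"
      proof (cases "B \<in> \<pi>")
        case True
        then obtain i where i: "i \<in> B" using partition_onD3[OF z(2)] by (metis ex_in_conv)
        then have "i \<in> \<Omega>" "?\<phi> i = m B" using blocks[OF True] by auto
        then show ?thesis using val[of i ?\<phi>] blocks[OF True] by simp
      next
        case False
        then show ?thesis unfolding fib using z(3) by (auto simp: PiE_def extensional_def)
      qed
    qed
    then show "(?fib (case z of (\<pi>, m) \<Rightarrow> assign \<Omega> \<pi> m), ?val (case z of (\<pi>, m) \<Rightarrow> assign \<Omega> \<pi> m)) = z"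
      unfolding z(1) prod.case fib by simp
    show "(case z of (\<pi>, m) \<Rightarrow> assign \<Omega> \<pi> m) \<in> \<Omega> \<rightarrow>\<^sub>E {..<N}"
      unfolding z(1) prod.case assign_def using z(3) block_of_in[OF z(2)] by auto
  qed
  also have "\<dots> = (\<Sum>\<pi>\<in>?P. \<Sum>m\<in>?M \<pi>. F (assign \<Omega> \<pi> m))"
    using finP finM by (subst sum.Sigma) auto
  finally show ?thesis by simp
qed

text \<open>Group the choices \<open>\<phi>\<close> by their fibres. The levels of the blocks are then injective, but by
  antisymmetry the noninjective assignments may be added, and only after that do the cycles of \<open>\<sigma>\<close> become
  independent.\<close>

theorem alt_coeff_eq_cycles:
  fixes \<Omega> :: "'i set"
  assumes fin: "finite \<Omega>"
  shows "alt_coeff N \<Omega> a (\<lambda>r. if r < N then int r else 0) =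
    of_int (\<Sum>\<pi> | partition_on \<Omega> \<pi>. \<Sum>\<sigma> | \<sigma> permutes \<pi>. sign \<sigma> *
       int (\<Prod>C\<in>orbit \<sigma> ` \<pi>. cycle_count N \<sigma> (\<lambda>B. - (\<Sum>i\<in>B. a i)) C))"
proof -
  let ?d = "\<lambda>B. - (\<Sum>i\<in>B. a i)"
  let ?F = "\<lambda>\<phi>. \<Sum>\<tau> | \<tau> permutes {..<N} \<and> (\<forall>r<N. int (\<tau> r) + (\<Sum>i\<in>\<Omega>. if \<phi> i = r then a i else 0) = int r). sign \<tau>"
  have eq: "exponents N \<Omega> a \<tau> \<phi> = (\<lambda>r. if r < N then int r else 0) \<longleftrightarrow>
     (\<forall>r<N. int (\<tau> r) + (\<Sum>i\<in>\<Omega>. if \<phi> i = r then a i else 0) = int r)" for \<tau> \<phi>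
    by (auto simp: exponents_def fun_eq_iff)
  have "alt_coeff N \<Omega> a (\<lambda>r. if r < N then int r else 0) = of_int (\<Sum>\<phi>\<in>\<Omega> \<rightarrow>\<^sub>E {..<N}. ?F \<phi>)"
  proof -
    have "?F \<phi> = (\<Sum>\<tau> | \<tau> permutes {..<N}. if (\<forall>r<N. int (\<tau> r) + (\<Sum>i\<in>\<Omega>. if \<phi> i = r then a i else 0) = int r) then sign \<tau> else 0)" for \<phi>
      by (subst sum.inter_filter[symmetric]) (auto simp: finite_permutations)
    then show ?thesis
      unfolding alt_coeff_def alt_index_def eq
      by (simp add: sum.cartesian_product[symmetric] if_distrib[of of_int] cong: if_cong)
  qed
  also have "(\<Sum>\<phi>\<in>\<Omega> \<rightarrow>\<^sub>E {..<N}. ?F \<phi>) = (\<Sum>\<pi> | partition_on \<Omega> \<pi>. \<Sum>m\<in>{m \<in> \<pi> \<rightarrow>\<^sub>E {..<N}. inj_on m \<pi>}. ?F (assign \<Omega> \<pi> m))"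
    by (rule sum_assign[OF fin])
  also have "\<dots> = (\<Sum>\<pi> | partition_on \<Omega> \<pi>. \<Sum>\<sigma> | \<sigma> permutes \<pi>. sign \<sigma> *
       int (\<Prod>C\<in>orbit \<sigma> ` \<pi>. cycle_count N \<sigma> ?d C))"
  proof (rule sum.cong[OF refl])
    fix \<pi> assume "\<pi> \<in> {\<pi>. partition_on \<Omega> \<pi>}"
    then have part: "partition_on \<Omega> \<pi>" by simp
    have fin\<pi>: "finite \<pi>" by (rule finite_elements[OF fin part])
    have finM: "finite (\<pi> \<rightarrow>\<^sub>E {..<N})" using fin\<pi> by (intro finite_PiE) auto
    have "(\<Sum>m\<in>{m \<in> \<pi> \<rightarrow>\<^sub>E {..<N}. inj_on m \<pi>}. ?F (assign \<Omega> \<pi> m)) = (\<Sum>m\<in>{m \<in> \<pi> \<rightarrow>\<^sub>E {..<N}. inj_on m \<pi>}. signed_count \<pi> ?d m)"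
      by (intro sum.cong refl signed_count_eq part fin) auto
    also have "\<dots> = (\<Sum>m\<in>\<pi> \<rightarrow>\<^sub>E {..<N}. signed_count \<pi> ?d m)"
      using finM signed_count_noninj[OF fin\<pi>] by (intro sum.mono_neutral_left) auto
    also have "\<dots> = (\<Sum>m\<in>\<pi> \<rightarrow>\<^sub>E {..<N}. \<Sum>\<sigma> | \<sigma> permutes \<pi>. if (\<forall>B\<in>\<pi>. int (m (\<sigma> B)) = int (m B) + ?d B) then sign \<sigma> else 0)"
      unfolding signed_count_def
      by (rule sum.cong[OF refl], rule sum_Collect_conj) (use fin\<pi> in \<open>simp add: finite_permutations\<close>)
    also have "\<dots> = (\<Sum>\<sigma> | \<sigma> permutes \<pi>. \<Sum>m\<in>\<pi> \<rightarrow>\<^sub>E {..<N}. if (\<forall>B\<in>\<pi>. int (m (\<sigma> B)) = int (m B) + ?d B) then sign \<sigma> else 0)"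
      by (rule sum.swap)
    also have "\<dots> = (\<Sum>\<sigma> | \<sigma> permutes \<pi>. sign \<sigma> * int (card (walks N \<pi> \<sigma> ?d)))"
      unfolding walks_def using finM
      by (intro sum.cong refl, subst sum.inter_filter[symmetric]) (auto simp: mult.commute)
    also have "\<dots> = (\<Sum>\<sigma> | \<sigma> permutes \<pi>. sign \<sigma> *
       int (\<Prod>C\<in>orbit \<sigma> ` \<pi>. cycle_count N \<sigma> ?d C))"
      using fin\<pi> by (intro sum.cong refl) (simp add: card_walks)
    finally show "(\<Sum>m\<in>{m \<in> \<pi> \<rightarrow>\<^sub>E {..<N}. inj_on m \<pi>}. ?F (assign \<Omega> \<pi> m)) = (\<Sum>\<sigma> | \<sigma> permutes \<pi>. sign \<sigma> *
       int (\<Prod>C\<in>orbit \<sigma> ` \<pi>. cycle_count N \<sigma> ?d C))" .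
  qed
  finally show ?thesis .
qed

section \<open>The exact formula for the matrix integral\<close>

lemma finite_compositions: "finite (compositions k n)"
proof (rule finite_subset)
  show "compositions k n \<subseteq> {1..k} \<rightarrow>\<^sub>E {..n}"
  proof
    fix j assume j: "j \<in> compositions k n"
    have "j i \<le> n" if "i \<in> {1..k}" for i
    proof -
      have "j i \<le> (\<Sum>i=1..k. j i)" using that by (intro member_le_sum) auto
      then show ?thesis using j by (simp add: compositions_def)
    qed
    then show "j \<in> {1..k} \<rightarrow>\<^sub>E {..n}" using j by (auto simp: compositions_def PiE_def)
  qed
qed (auto intro: finite_PiE)

lemma finite_Omega: "finite (Omega k)"
  by (simp add: Omega_def)

text \<open>The labels \<open>i\<^sup>+\<close> come from the complex conjugate factor of the squared modulus. This makes the increments of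
  the walks equal to \<^const>\<open>d_block\<close>, and not to its negative.\<close>

definition label_exp :: "(nat \<Rightarrow> nat) \<Rightarrow> (nat \<Rightarrow> nat) \<Rightarrow> nat + nat \<Rightarrow> int" where
  "label_exp u v = case_sum (\<lambda>i. - int (u i)) (\<lambda>j. int (v j))"

lemma d_block_label_exp:
  assumes "finite B"
  shows "d_block (\<lambda>i. real (u i)) (\<lambda>j. real (v j)) B = of_int (- (\<Sum>x\<in>B. label_exp u v x))"
proof -
  have B: "B = Inl ` plus_idx B \<union> Inr ` minus_idx B"
  proof (intro equalityI subsetI)
    fix x assume "x \<in> B" then show "x \<in> Inl ` plus_idx B \<union> Inr ` minus_idx B"
      by (cases x) (auto simp: plus_idx_def minus_idx_def)
  qed (auto simp: plus_idx_def minus_idx_def)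
  have "finite (Inl ` plus_idx B :: (nat + nat) set)" "finite (Inr ` minus_idx B :: (nat + nat) set)"
    using assms B by (metis finite_Un)+
  then have "(\<Sum>x\<in>B. label_exp u v x) = (\<Sum>x\<in>Inl ` plus_idx B. label_exp u v x) + (\<Sum>x\<in>Inr ` minus_idx B. label_exp u v x)"
    by (subst B, intro sum.union_disjoint) auto
  also have "\<dots> = (\<Sum>i\<in>plus_idx B. - int (u i)) + (\<Sum>j\<in>minus_idx B. int (v j))"
    by (simp add: sum.reindex label_exp_def)
  finally show ?thesis by (simp add: d_block_def sum_negf)
qed

text \<open>The discrete analogue, with a strip of width \<open>h\<close>, of the weight of a cycle: the Dirac delta becomes the
  condition that the total increment vanishes.\<close>

definition cycle_weight :: "real \<Rightarrow> (block \<Rightarrow> block) \<Rightarrow> (nat \<Rightarrow> real) \<Rightarrow> (nat \<Rightarrow> real) \<Rightarrow> block set \<Rightarrow> real" where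
  "cycle_weight h \<sigma> u v C = (if D_partial \<sigma> u v (cycle_rep C) (card C) = 0 then max 0 (h - omega_cyc \<sigma> u v C) else 0)"

definition lattice_sum :: "nat \<Rightarrow> nat \<Rightarrow> nat \<Rightarrow> block set \<Rightarrow> (block \<Rightarrow> block) \<Rightarrow> real" where
  "lattice_sum k n N \<pi> \<sigma> = (\<Sum>u\<in>compositions k n. \<Sum>v\<in>compositions k n.
     \<Prod>C\<in>Cyc \<pi> \<sigma>. cycle_weight (real N) \<sigma> (\<lambda>i. real (u i)) (\<lambda>j. real (v j)) C)"

lemma cycle_weight_int:
  assumes part: "partition_on (Omega k) \<pi>" and \<sigma>: "\<sigma> permutes \<pi>" and C: "C \<in> Cyc \<pi> \<sigma>"
  shows "cycle_weight (real N) \<sigma> (\<lambda>i. real (u i)) (\<lambda>j. real (v j)) C =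
    real (cycle_count N \<sigma> (\<lambda>B. - (\<Sum>x\<in>B. label_exp u v x)) C)"
proof -
  let ?d = "\<lambda>B. - (\<Sum>x\<in>B. label_exp u v x)"
  let ?R = "cycle_rep C"
  have fin: "finite \<pi>" by (rule finite_elements[OF finite_Omega part])
  have perm: "permutation \<sigma>" by (rule permutes_imp_permutation[OF fin \<sigma>])
  obtain B where B: "B \<in> \<pi>" "C = orbit \<sigma> B" using C by (auto simp: Cyc_def)
  have R: "?R \<in> \<pi>" using cycle_rep_in[OF perm, of B] permutes_orbit_subset[OF \<sigma> B(1)] B(2) by auto
  have it: "(\<sigma> ^^ j) ?R \<in> \<pi>" for j
    by (induction j) (use \<sigma> R in \<open>auto simp: permutes_in_image\<close>)
  have finB: "finite B" if "B \<in> \<pi>" for B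
    using part that finite_Omega by (auto simp: partition_on_def intro: finite_subset)
  have D: "D_partial \<sigma> (\<lambda>i. real (u i)) (\<lambda>j. real (v j)) ?R = (\<lambda>j. of_int (drift \<sigma> ?d ?R j))"
    unfolding D_partial_def drift_def using d_block_label_exp[OF finB[OF it]] by auto
  have "0 < card C" using cycle_enum(3)[OF perm permutation_self_in_orbit[OF perm], of B] B(2) by simp
  then have S: "finite (drift \<sigma> ?d ?R ` {..<card C})" "drift \<sigma> ?d ?R ` {..<card C} \<noteq> {}" by auto
  have "omega_cyc \<sigma> (\<lambda>i. real (u i)) (\<lambda>j. real (v j)) C = of_int (drift_span \<sigma> ?d C)"
  proof -
    have im: "D_partial \<sigma> (\<lambda>i. real (u i)) (\<lambda>j. real (v j)) ?R ` {..<card C} = real_of_int ` (drift \<sigma> ?d ?R ` {..<card C})"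
      unfolding D by auto
    have "Max (real_of_int ` (drift \<sigma> ?d ?R ` {..<card C})) = of_int (Max (drift \<sigma> ?d ?R ` {..<card C}))"
      using S by (intro mono_Max_commute[symmetric]) (auto simp: mono_def)
    moreover have "Min (real_of_int ` (drift \<sigma> ?d ?R ` {..<card C})) = of_int (Min (drift \<sigma> ?d ?R ` {..<card C}))"
      using S by (intro mono_Min_commute[symmetric]) (auto simp: mono_def)
    ultimately show ?thesis
      unfolding omega_cyc_def Let_def cycle_rep_def[symmetric] im drift_span_def by simp
  qed
  then show ?thesis unfolding cycle_weight_def cycle_count_def D by (simp add: max_def nat_eq_iff)
qed

lemma trace_product_expand:
  assumes U: "U \<in> unitary_group N"
  shows "complex_of_real ((cmod (\<Sum>j\<in>compositions k n. \<Prod>i=1..k. mat_trace (U ^\<^sub>m j i)))\<^sup>2) =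
    (\<Sum>u\<in>compositions k n. \<Sum>v\<in>compositions k n. \<Prod>x\<in>Omega k. mat_trace (ipow U (label_exp u v x)))"
proof -
  have nat: "mat_trace (U ^\<^sub>m j) = mat_trace (ipow U (int j))" for j by (simp add: ipow_def)
  let ?S = "\<Sum>j\<in>compositions k n. \<Prod>i=1..k. mat_trace (ipow U (int (j i)))"
  have "complex_of_real ((cmod ?S)\<^sup>2) = cnj ?S * ?S" unfolding complex_norm_square by (rule mult.commute)
  also have "\<dots> = (\<Sum>u\<in>compositions k n. \<Sum>v\<in>compositions k n.
     (\<Prod>i=1..k. mat_trace (ipow U (- int (u i)))) * (\<Prod>j=1..k. mat_trace (ipow U (int (v j)))))"
    by (simp add: cnj_sum cnj_prod sum_product ipow_trace_uminus[OF U])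
  also have "\<dots> = (\<Sum>u\<in>compositions k n. \<Sum>v\<in>compositions k n. \<Prod>x\<in>Omega k. mat_trace (ipow U (label_exp u v x)))"
    unfolding Omega_def by (intro sum.cong refl) (simp add: prod.Plus label_exp_def)
  finally show ?thesis unfolding nat .
qed

lemma sum_label_exp:
  assumes "u \<in> compositions k n" "v \<in> compositions k n"
  shows "(\<Sum>x\<in>Omega k. label_exp u v x) = 0"
proof -
  have "(\<Sum>x\<in>Omega k. label_exp u v x) = - int (\<Sum>i=1..k. u i) + int (\<Sum>i=1..k. v i)"
    unfolding Omega_def by (simp add: sum.Plus label_exp_def sum_negf)
  moreover have "(\<Sum>i=1..k. u i) = n" "(\<Sum>i=1..k. v i) = n"
    using assms by (auto simp: compositions_def)
  ultimately show ?thesis by (simp only:)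
qed

theorem I_int_exact:
  assumes haar: "haar_unitary N (\<mu> N)"
  shows "I_int \<mu> k n N = (\<Sum>(\<pi>, \<sigma>)\<in>J_set k. of_int (sign \<sigma>) * lattice_sum k n N \<pi> \<sigma>)"
proof -
  interpret haar_measure N "\<mu> N" by unfold_locales (rule haar)
  let ?M = "\<mu> N" and ?c = "compositions k n" and ?P = "{\<pi>. partition_on (Omega k) \<pi>}"
  let ?w = "\<lambda>u v C. \<lambda>\<sigma>. cycle_weight (real N) \<sigma> (\<lambda>i. real (u i)) (\<lambda>j. real (v j)) C"
  have finP: "finite ?P" by (rule finitely_many_partition_on[OF finite_Omega])
  have finS: "finite {\<sigma>. \<sigma> permutes \<pi>}" if "\<pi> \<in> ?P" for \<pi>
    using finite_elements[OF finite_Omega, of k \<pi>] that by (simp add: finite_permutations)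
  have one: "(LINT U|?M. (\<Prod>x\<in>Omega k. mat_trace (ipow U (label_exp u v x)))) =
     complex_of_real (\<Sum>\<pi>\<in>?P. \<Sum>\<sigma> | \<sigma> permutes \<pi>. of_int (sign \<sigma>) * (\<Prod>C\<in>Cyc \<pi> \<sigma>. ?w u v C \<sigma>))"
    if uv: "u \<in> ?c" "v \<in> ?c" for u v
  proof -
    let ?d = "\<lambda>B. - (\<Sum>i\<in>B. label_exp u v i)"
    have "(LINT U|?M. (\<Prod>x\<in>Omega k. mat_trace (ipow U (label_exp u v x)))) =
       of_int (\<Sum>\<pi>\<in>?P. \<Sum>\<sigma> | \<sigma> permutes \<pi>. sign \<sigma> *
       int (\<Prod>C\<in>orbit \<sigma> ` \<pi>. cycle_count N \<sigma> ?d C))"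
      unfolding expectation_trace_prod[OF finite_Omega sum_label_exp[OF uv]]
      by (rule alt_coeff_eq_cycles[OF finite_Omega])
    also have "\<dots> = complex_of_real (of_int (\<Sum>\<pi>\<in>?P. \<Sum>\<sigma> | \<sigma> permutes \<pi>. sign \<sigma> *
       int (\<Prod>C\<in>orbit \<sigma> ` \<pi>. cycle_count N \<sigma> ?d C)))"
      by (rule of_real_of_int_eq[symmetric])
    also have "real_of_int (\<Sum>\<pi>\<in>?P. \<Sum>\<sigma> | \<sigma> permutes \<pi>. sign \<sigma> *
       int (\<Prod>C\<in>orbit \<sigma> ` \<pi>. cycle_count N \<sigma> ?d C)) =
       (\<Sum>\<pi>\<in>?P. \<Sum>\<sigma> | \<sigma> permutes \<pi>. of_int (sign \<sigma>) * (\<Prod>C\<in>Cyc \<pi> \<sigma>. ?w u v C \<sigma>))"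
    proof -
      have inner: "real_of_int (int (\<Prod>C\<in>orbit \<sigma> ` \<pi>. cycle_count N \<sigma> ?d C))
        = (\<Prod>C\<in>Cyc \<pi> \<sigma>. ?w u v C \<sigma>)" if ps: "partition_on (Omega k) \<pi>" "\<sigma> permutes \<pi>" for \<pi> \<sigma>
        unfolding Cyc_def[symmetric]
        by (rule trans[OF of_int_of_nat_eq], rule trans[OF of_nat_prod], rule prod.cong[OF refl])
          (simp only: cycle_weight_int[OF ps])
      show ?thesis unfolding of_int_sum of_int_mult
        by (rule sum.cong[OF refl], rule sum.cong[OF refl], rule arg_cong2[where f = "(*)", OF refl], rule inner) auto
    qed
    finally show ?thesis .
  qed
  have int: "integrable ?M (\<lambda>U. \<Prod>x\<in>Omega k. mat_trace (ipow U (a x)))" for a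
    by (intro bdd_meas_integrable bdd_meas_prod bdd_meas_trace)
  have "complex_of_real (I_int \<mu> k n N) = (LINT U|?M. complex_of_real ((cmod (\<Sum>j\<in>compositions k n. \<Prod>i=1..k. mat_trace (U ^\<^sub>m j i)))\<^sup>2))"
    unfolding I_int_def by (rule integral_complex_of_real[symmetric])
  also have "\<dots> = (LINT U|?M. (\<Sum>u\<in>?c. \<Sum>v\<in>?c. \<Prod>x\<in>Omega k. mat_trace (ipow U (label_exp u v x))))"
    by (intro Bochner_Integration.integral_cong refl trace_product_expand) (simp add: space_M)
  also have "\<dots> = (\<Sum>u\<in>?c. LINT U|?M. (\<Sum>v\<in>?c. \<Prod>x\<in>Omega k. mat_trace (ipow U (label_exp u v x))))"
    by (intro Bochner_Integration.integral_sum Bochner_Integration.integrable_sum int)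
  also have "\<dots> = (\<Sum>u\<in>?c. \<Sum>v\<in>?c. LINT U|?M. (\<Prod>x\<in>Omega k. mat_trace (ipow U (label_exp u v x))))"
    by (intro sum.cong refl Bochner_Integration.integral_sum int)
  also have "\<dots> = (\<Sum>u\<in>?c. \<Sum>v\<in>?c. complex_of_real (\<Sum>\<pi>\<in>?P. \<Sum>\<sigma> | \<sigma> permutes \<pi>. of_int (sign \<sigma>) * (\<Prod>C\<in>Cyc \<pi> \<sigma>. ?w u v C \<sigma>)))"
    by (intro sum.cong refl one)
  also have "\<dots> = complex_of_real (\<Sum>u\<in>?c. \<Sum>v\<in>?c. \<Sum>\<pi>\<in>?P. \<Sum>\<sigma> | \<sigma> permutes \<pi>. of_int (sign \<sigma>) * (\<Prod>C\<in>Cyc \<pi> \<sigma>. ?w u v C \<sigma>))"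
    by simp
  finally have "I_int \<mu> k n N = (\<Sum>u\<in>?c. \<Sum>v\<in>?c. \<Sum>\<pi>\<in>?P. \<Sum>\<sigma> | \<sigma> permutes \<pi>. of_int (sign \<sigma>) * (\<Prod>C\<in>Cyc \<pi> \<sigma>. ?w u v C \<sigma>))"
    by (simp only: of_real_eq_iff)
  also have "\<dots> = (\<Sum>u\<in>?c. \<Sum>v\<in>?c. \<Sum>(\<pi>, \<sigma>)\<in>J_set k. of_int (sign \<sigma>) * (\<Prod>C\<in>Cyc \<pi> \<sigma>. ?w u v C \<sigma>))"
  proof -
    have "J_set k = Sigma ?P (\<lambda>\<pi>. {\<sigma>. \<sigma> permutes \<pi>})" by (auto simp: J_set_def)
    then show ?thesis using finP finS by (simp add: sum.Sigma)
  qed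
  also have "\<dots> = (\<Sum>u\<in>?c. \<Sum>z\<in>J_set k. \<Sum>v\<in>?c. case z of (\<pi>, \<sigma>) \<Rightarrow> of_int (sign \<sigma>) * (\<Prod>C\<in>Cyc \<pi> \<sigma>. ?w u v C \<sigma>))"
    by (intro sum.cong refl sum.swap)
  also have "\<dots> = (\<Sum>z\<in>J_set k. \<Sum>u\<in>?c. \<Sum>v\<in>?c. case z of (\<pi>, \<sigma>) \<Rightarrow> of_int (sign \<sigma>) * (\<Prod>C\<in>Cyc \<pi> \<sigma>. ?w u v C \<sigma>))"
    by (rule sum.swap)
  also have "\<dots> = (\<Sum>(\<pi>, \<sigma>)\<in>J_set k. of_int (sign \<sigma>) * lattice_sum k n N \<pi> \<sigma>)"
    by (intro sum.cong refl) (auto simp: lattice_sum_def sum_distrib_left)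
  finally show ?thesis .
qed

section \<open>Riemann sums with a positivity constraint\<close>

text \<open>Each variable \<open>u\<^sub>i\<close>, \<open>v\<^sub>j\<close> is a form of this kind in \<open>c\<close> and the free variables. The last
  condition says that it either depends on some free variable or equals \<open>c\<close>; in both cases it is small only on
  a set of small measure.\<close>

definition signed_form :: "'l set \<Rightarrow> (real \<Rightarrow> ('l \<Rightarrow> real) \<Rightarrow> real) \<Rightarrow> bool" where
  "signed_form L z \<longleftrightarrow> (\<exists>\<alpha> \<kappa>. (\<forall>c y. z c y = \<alpha> * c + (\<Sum>x\<in>L. \<kappa> x * y x)) \<and>
     (\<forall>x\<in>L. \<kappa> x \<in> {-1, 0, 1}) \<and> (\<alpha> = 1 \<or> \<alpha> = 0 \<and> (\<exists>x\<in>L. \<kappa> x \<noteq> 0)))"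

lemma signed_formE:
  assumes "signed_form L z"
  obtains \<alpha> \<kappa> where "\<And>c y. z c y = \<alpha> * c + (\<Sum>x\<in>L. \<kappa> x * y x)"
    "\<And>x. x \<in> L \<Longrightarrow> \<kappa> x \<in> {-1, 0, 1}" "\<alpha> = 1 \<or> \<alpha> = 0 \<and> (\<exists>x\<in>L. \<kappa> x \<noteq> 0)"
  using assms unfolding signed_form_def by blast

lemma signed_form_measurable:
  assumes "signed_form L z"
  shows "z c \<in> borel_measurable (PiM L (\<lambda>_. lborel))"
proof -
  obtain \<alpha> \<kappa> where z: "\<And>c y. z c y = \<alpha> * c + (\<Sum>x\<in>L. \<kappa> x * y x)"
    by (rule signed_formE[OF assms]) blast
  have "(\<lambda>y. y x) \<in> borel_measurable (PiM L (\<lambda>_. lborel :: real measure))" if "x \<in> L" for x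
    using measurable_component_singleton[OF that, of "\<lambda>_. lborel :: real measure"] by simp
  then have "(\<lambda>y. \<alpha> * c + (\<Sum>x\<in>L. \<kappa> x * y x)) \<in> borel_measurable (PiM L (\<lambda>_. lborel))"
    by (intro borel_measurable_add borel_measurable_const borel_measurable_sum borel_measurable_times) auto
  then show ?thesis using z by (simp add: fun_eq_iff[symmetric] cong: measurable_cong)
qed

lemma signed_form_lipschitz:
  assumes "signed_form L z"
  shows "\<bar>z c y - z c' y'\<bar> \<le> \<bar>c - c'\<bar> + (\<Sum>x\<in>L. \<bar>y x - y' x\<bar>)"
proof -
  obtain \<alpha> \<kappa> where z: "\<And>c y. z c y = \<alpha> * c + (\<Sum>x\<in>L. \<kappa> x * y x)"
    and \<kappa>: "\<And>x. x \<in> L \<Longrightarrow> \<kappa> x \<in> {-1, 0, 1}" and \<alpha>: "\<alpha> = 1 \<or> \<alpha> = 0"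
    by (rule signed_formE[OF assms]) blast
  have "z c y - z c' y' = \<alpha> * (c - c') + (\<Sum>x\<in>L. \<kappa> x * (y x - y' x))"
    by (simp add: z algebra_simps sum_subtractf)
  also have "\<bar>\<dots>\<bar> \<le> \<bar>\<alpha> * (c - c')\<bar> + (\<Sum>x\<in>L. \<bar>\<kappa> x * (y x - y' x)\<bar>)"
    by (intro order.trans[OF abs_triangle_ineq] add_mono sum_abs) auto
  also have "\<dots> \<le> \<bar>c - c'\<bar> + (\<Sum>x\<in>L. \<bar>y x - y' x\<bar>)"
    using \<alpha> \<kappa> by (intro add_mono sum_mono) (force simp: abs_mult)+
  finally show ?thesis .
qed

lemma signed_form_cong:
  assumes "signed_form L z" "\<And>x. x \<in> L \<Longrightarrow> y x = y' x"
  shows "z c y = z c y'"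
  using signed_form_lipschitz[OF assms(1), of c y c y'] assms(2) by simp

interpretation lborel_prod: product_sigma_finite "\<lambda>_. lborel :: real measure"
  by unfold_locales

definition box_set :: "'l set \<Rightarrow> real \<Rightarrow> ('l \<Rightarrow> real) set" where
  "box_set L B = L \<rightarrow>\<^sub>E {0<..B}"

lemma box_set_measurable: "finite L \<Longrightarrow> box_set L B \<in> sets (PiM L (\<lambda>_. lborel))"
  unfolding box_set_def by (intro sets_PiM_I_finite) auto

lemma emeasure_box_set:
  assumes "finite L" "0 \<le> B"
  shows "emeasure (PiM L (\<lambda>_. lborel)) (box_set L B) = ennreal (B ^ card L)"
proof -
  have "emeasure (PiM L (\<lambda>_. lborel)) (box_set L B) = (\<Prod>x\<in>L. emeasure lborel {0<..B})"
    unfolding box_set_def using assms by (intro lborel_prod.emeasure_PiM) auto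
  also have "\<dots> = ennreal (B ^ card L)"
    using assms by (simp add: ennreal_power)
  finally show ?thesis .
qed

definition slab :: "'l set \<Rightarrow> (real \<Rightarrow> ('l \<Rightarrow> real) \<Rightarrow> real) \<Rightarrow> real \<Rightarrow> real \<Rightarrow> real \<Rightarrow> ('l \<Rightarrow> real) set" where
  "slab L z c B \<epsilon> = {y \<in> box_set L B. \<bar>z c y\<bar> \<le> \<epsilon>}"

lemma slab_measurable:
  assumes "finite L" "signed_form L z"
  shows "slab L z c B \<epsilon> \<in> sets (PiM L (\<lambda>_. lborel))"
proof -
  have sub: "box_set L B \<subseteq> space (PiM L (\<lambda>_. lborel))" using sets.sets_into_space[OF box_set_measurable[OF assms(1)]] .
  have "{y \<in> space (PiM L (\<lambda>_. lborel)). \<bar>z c y\<bar> \<le> \<epsilon>} \<in> sets (PiM L (\<lambda>_. lborel))"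
    using signed_form_measurable[OF assms(2), of c] by measurable
  moreover have "slab L z c B \<epsilon> = box_set L B \<inter> {y \<in> space (PiM L (\<lambda>_. lborel)). \<bar>z c y\<bar> \<le> \<epsilon>}"
    using sub by (auto simp: slab_def)
  ultimately show ?thesis using box_set_measurable[OF assms(1), of B] by auto
qed

text \<open>Integrate first over a variable with coefficient \<open>\<plusminus>1\<close>, which is confined to an interval of length \<open>2 \<epsilon>\<close>.
  If there is none, the form is the constant \<open>c > \<epsilon>\<close> and the slab is empty.\<close>

lemma emeasure_slab:
  assumes L: "finite L" and z: "signed_form L z" and \<epsilon>: "0 \<le> \<epsilon>" "\<epsilon> < c" and B: "0 \<le> B"
  shows "emeasure (PiM L (\<lambda>_. lborel)) (slab L z c B \<epsilon>) \<le> ennreal (2 * \<epsilon> * B ^ (card L - 1))"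
proof -
  obtain \<alpha> \<kappa> where label_val: "\<And>c y. z c y = \<alpha> * c + (\<Sum>x\<in>L. \<kappa> x * y x)"
    and \<kappa>: "\<And>x. x \<in> L \<Longrightarrow> \<kappa> x \<in> {-1, 0, 1}" and \<alpha>: "\<alpha> = 1 \<or> \<alpha> = 0 \<and> (\<exists>x\<in>L. \<kappa> x \<noteq> 0)"
    by (rule signed_formE[OF z]) blast
  show ?thesis
  proof (cases "\<exists>x\<in>L. \<kappa> x \<noteq> 0")
    case False
    then have "\<alpha> = 1" using \<alpha> by auto
    then have "z c y = c" for y using False by (simp add: label_val)
    then have "slab L z c B \<epsilon> = {}" using \<epsilon> by (auto simp: slab_def)
    then show ?thesis by simp
  next
    case True
    then obtain x0 where x0: "x0 \<in> L" "\<kappa> x0 \<noteq> 0" by auto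
    define L' where "L' = L - {x0}"
    have L': "finite L'" "x0 \<notin> L'" "insert x0 L' = L" using L x0 by (auto simp: L'_def)
    let ?S = "slab L z c B \<epsilon>"
    let ?h = "\<lambda>y. \<alpha> * c + (\<Sum>x\<in>L'. \<kappa> x * y x)"
    have zt: "z c (y(x0 := t)) = \<kappa> x0 * t + ?h y" for y t
    proof -
      have "(\<Sum>x\<in>L'. \<kappa> x * (y(x0 := t)) x) = (\<Sum>x\<in>L'. \<kappa> x * y x)"
        using L'(2) by (intro sum.cong) auto
      then show ?thesis unfolding label_val L'(3)[symmetric] using L'(1,2) by simp
    qed
    have "emeasure (PiM L (\<lambda>_. lborel)) ?S = (\<integral>\<^sup>+y. indicator ?S y \<partial>PiM (insert x0 L') (\<lambda>_. lborel))"
      unfolding L'(3) using slab_measurable[OF L z] by simp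
    also have "\<dots> = (\<integral>\<^sup>+y. (\<integral>\<^sup>+t. indicator ?S (y(x0 := t)) \<partial>lborel) \<partial>PiM L' (\<lambda>_. lborel))"
      using slab_measurable[OF L z, of c B \<epsilon>]
      by (intro lborel_prod.product_nn_integral_insert L'(1,2)) (simp add: L'(3))
    also have "\<dots> \<le> (\<integral>\<^sup>+y. ennreal (2 * \<epsilon>) * indicator (box_set L' B) y \<partial>PiM L' (\<lambda>_. lborel))"
    proof (rule nn_integral_mono)
      fix y assume y: "y \<in> space (PiM L' (\<lambda>_. lborel :: real measure))"
      define a where "a = - (?h y) * \<kappa> x0"
      have k: "\<kappa> x0 = 1 \<or> \<kappa> x0 = -1" using \<kappa>[OF x0(1)] x0(2) by auto
      have "indicator ?S (y(x0 := t)) \<le> indicator {a - \<epsilon>..a + \<epsilon>} t * (indicator (box_set L' B) y :: ennreal)" for t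
      proof (cases "y(x0 := t) \<in> ?S")
        case True
        then have "\<bar>\<kappa> x0 * t + ?h y\<bar> \<le> \<epsilon>" by (simp add: slab_def zt)
        then have "t \<in> {a - \<epsilon>..a + \<epsilon>}" using k by (auto simp: a_def abs_le_iff)
        moreover have "y \<in> box_set L' B"
        proof -
          have b: "y(x0 := t) \<in> box_set L B" using True by (simp add: slab_def)
          have "y x \<in> {0<..B}" if "x \<in> L'" for x
            using b that L' by (auto simp: box_set_def PiE_iff fun_upd_def split: if_splits)
          moreover have "y \<in> extensional L'" using y by (simp add: space_PiM PiE_def)
          ultimately show ?thesis by (auto simp: box_set_def PiE_def)
        qed
        ultimately show ?thesis using True by simp
      qed simp
      then have "(\<integral>\<^sup>+t. indicator ?S (y(x0 := t)) \<partial>lborel) \<le> (\<integral>\<^sup>+t. indicator {a - \<epsilon>..a + \<epsilon>} t * indicator (box_set L' B) y \<partial>lborel)"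
        by (rule nn_integral_mono)
      also have "\<dots> = ennreal (2 * \<epsilon>) * indicator (box_set L' B) y"
        using \<epsilon>(1) by (simp add: nn_integral_multc)
      finally show "(\<integral>\<^sup>+t. indicator ?S (y(x0 := t)) \<partial>lborel) \<le> ennreal (2 * \<epsilon>) * indicator (box_set L' B) y" .
    qed
    also have "\<dots> = ennreal (2 * \<epsilon>) * ennreal (B ^ card L')"
      using box_set_measurable[OF L'(1), of B] emeasure_box_set[OF L'(1) B] by (simp add: nn_integral_cmult)
    also have "\<dots> = ennreal (2 * \<epsilon> * B ^ (card L - 1))"
      using \<epsilon>(1) B L x0 by (simp add: ennreal_mult L'_def)
    finally show ?thesis .
  qed
qed

text \<open>The cube of side \<open>1/N\<close> whose points are rounded up to \<open>w/N\<close>. Rounding up respects positivity: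
  a coordinate is positive exactly if its rounded value is.\<close>

definition cell :: "'l set \<Rightarrow> nat \<Rightarrow> ('l \<Rightarrow> nat) \<Rightarrow> ('l \<Rightarrow> real) set" where
  "cell L N w = (\<Pi>\<^sub>E x\<in>L. {(real (w x) - 1) / real N<..real (w x) / real N})"

lemma cell_measurable: "finite L \<Longrightarrow> cell L N w \<in> sets (PiM L (\<lambda>_. lborel))"
  unfolding cell_def by (intro sets_PiM_I_finite) auto

lemma emeasure_cell:
  assumes "finite L" "N > 0"
  shows "emeasure (PiM L (\<lambda>_. lborel)) (cell L N w) = ennreal ((1 / real N) ^ card L)"
proof -
  have "emeasure (PiM L (\<lambda>_. lborel)) (cell L N w) = (\<Prod>x\<in>L. emeasure lborel {(real (w x) - 1) / real N<..real (w x) / real N})"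
    unfolding cell_def using assms by (intro lborel_prod.emeasure_PiM) auto
  also have "\<dots> = (\<Prod>x\<in>L. ennreal (1 / real N))"
    using assms by (intro prod.cong refl) (simp add: divide_right_mono diff_divide_distrib)
  finally show ?thesis by (simp add: ennreal_power)
qed

lemma cell_iff:
  assumes N: "N > 0" and y: "y \<in> extensional L"
  shows "y \<in> cell L N w \<longleftrightarrow> (\<forall>x\<in>L. \<lceil>real N * y x\<rceil> = int (w x))"
proof -
  have "y x \<in> {(real (w x) - 1) / real N<..real (w x) / real N} \<longleftrightarrow> \<lceil>real N * y x\<rceil> = int (w x)" for x
    using N by (simp add: ceiling_eq_iff divide_less_eq le_divide_eq mult.commute)
  then show ?thesis using y by (auto simp: cell_def PiE_def Pi_def)
qed

text \<open>An integrand that is Lipschitz in finitely many signed forms \<open>z i\<close> and is cut off to \<open>0\<close> unless all of them are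
  positive. The free variables are among the forms, and positivity of all forms confines them to \<open>(0, c]\<close>.\<close>

locale lattice_riemann =
  fixes L :: "'l set" and I :: "'i set" and z :: "'i \<Rightarrow> real \<Rightarrow> ('l \<Rightarrow> real) \<Rightarrow> real"
    and \<Phi> :: "('i \<Rightarrow> real) \<Rightarrow> real" and \<Lambda> :: real
  assumes L: "finite L" and I: "finite I"
    and form: "\<And>i. i \<in> I \<Longrightarrow> signed_form L (z i)"
    and coord: "\<And>x. x \<in> L \<Longrightarrow> \<exists>i\<in>I. \<forall>c y. z i c y = y x"
    and bounded: "\<And>c y x. \<forall>i\<in>I. 0 < z i c y \<Longrightarrow> x \<in> L \<Longrightarrow> y x \<le> c"
    and \<Phi>_range: "\<And>a. 0 \<le> \<Phi> a \<and> \<Phi> a \<le> 1"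
    and \<Phi>_lip: "\<And>a b. \<bar>\<Phi> a - \<Phi> b\<bar> \<le> \<Lambda> * (\<Sum>i\<in>I. \<bar>a i - b i\<bar>)"
    and \<Lambda>: "0 \<le> \<Lambda>"
    and \<Phi>_meas: "\<And>c. (\<lambda>y. \<Phi> (\<lambda>i. z i c y)) \<in> borel_measurable (PiM L (\<lambda>_. lborel))"
begin

abbreviation "M \<equiv> PiM L (\<lambda>_. lborel :: real measure)"

definition integrand :: "real \<Rightarrow> ('l \<Rightarrow> real) \<Rightarrow> real" where
  "integrand c y = (if \<forall>i\<in>I. 0 < z i c y then \<Phi> (\<lambda>i. z i c y) else 0)"

abbreviation sample :: "nat \<Rightarrow> nat \<Rightarrow> ('l \<Rightarrow> nat) \<Rightarrow> real" where
  "sample n N w \<equiv> integrand (real n / real N) (\<lambda>x. real (w x) / real N)"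

lemma integrand_measurable: "integrand c \<in> borel_measurable M"
proof -
  have "{y \<in> space M. \<forall>i\<in>I. 0 < z i c y} \<in> sets M"
    using I signed_form_measurable[OF form] by measurable
  then show ?thesis unfolding integrand_def[abs_def] using \<Phi>_meas by (intro measurable_If) auto
qed

lemma integrand_range: "0 \<le> integrand c y" "integrand c y \<le> 1"
  using \<Phi>_range by (auto simp: integrand_def)

lemma z_cong: "i \<in> I \<Longrightarrow> (\<And>x. x \<in> L \<Longrightarrow> y x = y' x) \<Longrightarrow> z i c y = z i c y'"
  by (rule signed_form_cong[OF form])

lemma \<Phi>_cong: "(\<And>i. i \<in> I \<Longrightarrow> a i = b i) \<Longrightarrow> \<Phi> a = \<Phi> b"
  using \<Phi>_lip[of a b] by simp

lemma integrand_cong: 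
  assumes "\<And>x. x \<in> L \<Longrightarrow> y x = y' x" shows "integrand c y = integrand c y'"
  using z_cong[OF _ assms] \<Phi>_cong[of "\<lambda>i. z i c y" "\<lambda>i. z i c y'"] by (simp add: integrand_def)

lemma pos_coord: "\<forall>i\<in>I. 0 < z i c y \<Longrightarrow> x \<in> L \<Longrightarrow> 0 < y x"
  using coord by metis

lemma pos_box:
  assumes "\<forall>i\<in>I. 0 < z i c y" "c \<le> B" "y \<in> extensional L"
  shows "y \<in> box_set L B"
  using pos_coord[OF assms(1)] bounded[OF assms(1)] assms(2,3) by (force simp: box_set_def PiE_def)

definition approx_const :: "real \<Rightarrow> real" where
  "approx_const B = \<Lambda> * real (card I) * (1 + real (card L)) * B ^ card L
     + real (card I) * (2 * (1 + real (card L)) * B ^ (card L - 1))"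

text \<open>Write the sum as an integral by rounding each point up to the lattice. Where both the point and its rounded
  version satisfy the positivity constraints, the integrands differ by \<open>O(1/N)\<close> because of the Lipschitz
  condition. Where only one of them does, some form changes sign under a perturbation of size \<open>O(1/N)\<close>, so
  the point lies in one of finitely many slabs of measure \<open>O(1/N)\<close>.\<close>

lemma riemann_sum:
  assumes N: "N > 0" and c: "0 < c" "c \<le> B" and small: "(1 + real (card L)) / real N < c"
  defines "n \<equiv> nat \<lfloor>c * real N\<rfloor>"
  shows "\<bar>(\<Sum>w\<in>L \<rightarrow>\<^sub>E {1..n}. sample n N w) - real N ^ card L * (LINT y|M. integrand c y)\<bar>
     \<le> approx_const B * real N ^ card L / real N"
proof -
  \<comment> \<open>A bound for the change of a signed form when \<open>c\<close> and every free variable move by at most \<open>1/N\<close>.\<close>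
  define \<epsilon> where "\<epsilon> = (1 + real (card L)) / real N"
  let ?W = "L \<rightarrow>\<^sub>E {1..n}"
  have finW: "finite ?W" using L by (intro finite_PiE) auto
  have nN: "real n / N \<le> c" "c - 1 / N < real n / N"
  proof -
    have n: "real n = of_int \<lfloor>c * real N\<rfloor>" using c by (simp add: n_def)
    have "of_int \<lfloor>c * real N\<rfloor> \<le> c * real N" by (rule of_int_floor_le)
    then show "real n / N \<le> c" using n N by (simp add: divide_le_eq)
    have "c * real N < of_int \<lfloor>c * real N\<rfloor> + 1" by linarith
    then have "c < (real n + 1) / N" using n N by (simp add: less_divide_eq)
    then show "c - 1 / N < real n / N" by (simp add: add_divide_distrib)
  qed
  have B: "0 \<le> B" using c by simp
  have \<epsilon>: "0 \<le> \<epsilon>" "\<epsilon> < c" using small by (auto simp: \<epsilon>_def)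
  \<comment> \<open>The sum is the integral of the integrand at the points rounded up to the lattice.\<close>
  let ?r = "\<lambda>y x. real_of_int \<lceil>real N * y x\<rceil> / N"
  define G where "G = (\<lambda>y. integrand (real n / real N) (?r y))"
  have G_eq: "G y = (\<Sum>w\<in>?W. sample n N w * indicator (cell L N w) y)" if y: "y \<in> space M" for y
  proof -
    have ext: "y \<in> extensional L" using y by (simp add: space_PiM PiE_def)
    note ci = cell_iff[OF N ext]
    show ?thesis
    proof (cases "\<exists>w\<in>?W. y \<in> cell L N w")
      case True
      then obtain w where w: "w \<in> ?W" "y \<in> cell L N w" by auto
      have uniq: "w' = w" if "w' \<in> ?W" "y \<in> cell L N w'" for w'
      proof (rule PiE_ext[OF that(1) w(1)])
        fix x assume "x \<in> L"
        then have "\<lceil>real N * y x\<rceil> = int (w' x)" "\<lceil>real N * y x\<rceil> = int (w x)"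
          using w(2) that(2) unfolding ci by blast+
        then show "w' x = w x" by simp
      qed
      have "(\<Sum>w\<in>?W. sample n N w * indicator (cell L N w) y) =
        (\<Sum>w'\<in>{w}. sample n N w' * indicator (cell L N w') y)"
      proof (rule sum.mono_neutral_right[OF finW])
        show "{w} \<subseteq> ?W" using w(1) by simp
        show "\<forall>w'\<in>?W - {w}. sample n N w' * indicator (cell L N w') y = 0"
        proof
          fix w' assume "w' \<in> ?W - {w}"
          then have "y \<notin> cell L N w'" using uniq[of w'] by blast
          then show "sample n N w' * indicator (cell L N w') y = 0" by simp
        qed
      qed
      also have "\<dots> = sample n N w" using w by simp
      also have "\<dots> = G y" unfolding G_def using w(2) ci by (intro integrand_cong) simp
      finally show ?thesis by simp
    next
      case False
      have "G y = 0"
      proof (rule ccontr)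
        assume "G y \<noteq> 0"
        then have p: "\<forall>i\<in>I. 0 < z i (n / N) (?r y)" by (auto simp: G_def integrand_def split: if_splits)
        define w where "w = (\<lambda>x\<in>L. nat \<lceil>real N * y x\<rceil>)"
        have w1: "1 \<le> \<lceil>real N * y x\<rceil> \<and> \<lceil>real N * y x\<rceil> \<le> int n" if "x \<in> L" for x
        proof -
          have "0 < ?r y x" "?r y x \<le> n / N" using pos_coord[OF p that] bounded[OF p that] by auto
          then have "0 < real_of_int \<lceil>real N * y x\<rceil>" "real_of_int \<lceil>real N * y x\<rceil> \<le> real n"
            using N by (simp_all add: zero_less_divide_iff divide_le_cancel)
          then show ?thesis by linarith
        qed
        have "w \<in> ?W" unfolding w_def
        proof (intro restrict_PiE_iff[THEN iffD2] ballI)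
          fix x assume "x \<in> L"
          then have "1 \<le> nat \<lceil>real N * y x\<rceil> \<and> nat \<lceil>real N * y x\<rceil> \<le> n" using w1[of x] by linarith
          then show "nat \<lceil>real N * y x\<rceil> \<in> {1..n}" by simp
        qed
        moreover have "y \<in> cell L N w" unfolding ci w_def using w1 by fastforce
        ultimately show False using False by blast
      qed
      moreover have "(\<Sum>w\<in>?W. sample n N w * indicator (cell L N w) y) = 0"
        using False by (intro sum.neutral) auto
      ultimately show ?thesis by simp
    qed
  qed
  have cell_int: "integrable M (indicator (cell L N w) :: _ \<Rightarrow> real)"
    "(LINT y|M. indicator (cell L N w) y) = (1 / real N) ^ card L" for w
    using cell_measurable[OF L, of N w] emeasure_cell[OF L N, of w]
    by (auto simp: integrable_indicator_iff measure_def)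
  let ?GS = "\<lambda>y. \<Sum>w\<in>?W. sample n N w * indicator (cell L N w) y"
  have GS_int: "integrable M ?GS"
    by (intro Bochner_Integration.integrable_sum integrable_mult_right cell_int)
  have G_int: "integrable M G"
    using GS_int G_eq by (simp cong: Bochner_Integration.integrable_cong)
  have G_lint: "(LINT y|M. G y) = (\<Sum>w\<in>?W. sample n N w) * (1 / real N) ^ card L"
  proof -
    have "(LINT y|M. G y) = (LINT y|M. ?GS y)"
      using G_eq by (intro Bochner_Integration.integral_cong) auto
    also have "\<dots> = (\<Sum>w\<in>?W. LINT y|M. sample n N w * indicator (cell L N w) y)"
      by (intro Bochner_Integration.integral_sum integrable_mult_right cell_int)
    finally show ?thesis by (simp only: integral_mult_right_zero cell_int sum_distrib_right)
  qed
  have box_int: "integrable M (indicator (box_set L B) :: _ \<Rightarrow> real)"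
    "(LINT y|M. indicator (box_set L B) y) = B ^ card L"
    using box_set_measurable[OF L, of B] emeasure_box_set[OF L B] B
    by (auto simp: integrable_indicator_iff measure_def)
  have integrand_int: "integrable M (integrand c)"
  proof (rule Bochner_Integration.integrable_bound[OF box_int(1) integrand_measurable])
    show "AE y in M. norm (integrand c y) \<le> norm (indicator (box_set L B) y :: real)"
    proof (rule AE_I2)
      fix y assume "y \<in> space M"
      then have ext: "y \<in> extensional L" by (simp add: space_PiM PiE_def)
      show "norm (integrand c y) \<le> norm (indicator (box_set L B) y :: real)"
      proof (cases "\<forall>i\<in>I. 0 < z i c y")
        case True
        then show ?thesis using pos_box[OF True c(2) ext] integrand_range[of c y] by simp
      next
        case False
        then have "integrand c y = 0" unfolding integrand_def by (rule if_not_P)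
        then show ?thesis by simp
      qed
    qed
  qed
  let ?sl = "\<lambda>i. slab L (z i) c B \<epsilon>"
  have slab_int: "integrable M (indicator (?sl i) :: _ \<Rightarrow> real)"
    "(LINT y|M. indicator (?sl i) y) \<le> 2 * \<epsilon> * B ^ (card L - 1)" if "i \<in> I" for i
  proof -
    note e = emeasure_slab[OF L form[OF that] \<epsilon> B]
    have m: "?sl i \<in> sets M" by (rule slab_measurable[OF L form[OF that]])
    have fin: "emeasure M (?sl i) < \<infinity>" using e by (simp add: le_less_trans)
    then show "integrable M (indicator (?sl i) :: _ \<Rightarrow> real)" using m by (simp add: integrable_indicator_iff)
    have "measure M (?sl i) \<le> 2 * \<epsilon> * B ^ (card L - 1)"
      using e \<epsilon> B unfolding measure_def by (intro enn2real_leI) auto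
    then show "(LINT y|M. indicator (?sl i) y) \<le> 2 * \<epsilon> * B ^ (card L - 1)"
      using m sets.sets_into_space[OF m] by (simp add: Int_absorb2)
  qed
  have close: "\<bar>z i (n / N) (?r y) - z i c y\<bar> \<le> \<epsilon>" if "i \<in> I" for i y
  proof -
    have "\<bar>?r y x - y x\<bar> \<le> 1 / N" for x
    proof -
      have "?r y x - y x = (of_int \<lceil>real N * y x\<rceil> - real N * y x) / N" using N by (simp add: field_simps)
      moreover have "0 \<le> of_int \<lceil>real N * y x\<rceil> - real N * y x" "of_int \<lceil>real N * y x\<rceil> - real N * y x \<le> 1"
        by linarith+
      ultimately show ?thesis using N by (simp add: divide_right_mono)
    qed
    then have "(\<Sum>x\<in>L. \<bar>?r y x - y x\<bar>) \<le> real (card L) * (1 / N)"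
      by (intro sum_bounded_above) simp
    moreover have "\<bar>n / N - c\<bar> \<le> 1 / N" using nN by linarith
    ultimately show ?thesis
      using signed_form_lipschitz[OF form[OF that], of "n / N" "?r y" c y]
      by (simp add: \<epsilon>_def add_divide_distrib)
  qed
  let ?U = "\<lambda>y. \<Lambda> * (real (card I) * \<epsilon>) * indicator (box_set L B) y + (\<Sum>i\<in>I. indicator (?sl i) y)"
  have diff: "\<bar>G y - integrand c y\<bar> \<le> ?U y" if y: "y \<in> space M" for y
  proof -
    have ext: "y \<in> extensional L" using y by (simp add: space_PiM PiE_def)
    let ?P1 = "\<forall>i\<in>I. 0 < z i (n / N) (?r y)" and ?P2 = "\<forall>i\<in>I. 0 < z i c y"
    have U0: "0 \<le> ?U y" using \<Lambda> \<epsilon> by (intro add_nonneg_nonneg sum_nonneg mult_nonneg_nonneg) auto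
    have mismatch: "\<bar>G y - integrand c y\<bar> \<le> ?U y" if box: "y \<in> box_set L B" and i: "i \<in> I" and zi: "\<bar>z i c y\<bar> \<le> \<epsilon>" for i
    proof -
      have "\<bar>G y - integrand c y\<bar> \<le> 1" using integrand_range[of c y] integrand_range[of "n / N" "?r y"] by (simp add: G_def abs_le_iff)
      also have "1 = (indicator (?sl i) y :: real)" using box zi by (simp add: slab_def)
      also have "\<dots> \<le> (\<Sum>i\<in>I. indicator (?sl i) y)" using i I by (intro member_le_sum) auto
      also have "\<dots> \<le> ?U y" using \<Lambda> \<epsilon> by simp
      finally show ?thesis .
    qed
    show ?thesis
    proof (cases ?P1)
      case P1: True
      have box: "y \<in> box_set L B"
      proof -
        have "0 < y x \<and> y x \<le> B" if "x \<in> L" for x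
        proof -
          have a: "0 < ?r y x" "?r y x \<le> n / N" using pos_coord[OF P1 that] bounded[OF P1 that] by auto
          then have "0 < real_of_int \<lceil>real N * y x\<rceil>" using N by (simp add: zero_less_divide_iff)
          then have "0 < real N * y x" by (simp only: of_int_0_less_iff zero_less_ceiling)
          moreover have "y x \<le> ?r y x" using N by (simp add: le_divide_eq mult.commute)
          ultimately show ?thesis using a nN(1) c(2) N by (simp add: zero_less_mult_iff)
        qed
        then show ?thesis using ext by (auto simp: box_set_def PiE_def)
      qed
      show ?thesis
      proof (cases ?P2)
        case P2: True
        have "\<bar>G y - integrand c y\<bar> = \<bar>\<Phi> (\<lambda>i. z i (n / N) (?r y)) - \<Phi> (\<lambda>i. z i c y)\<bar>"
          using P1 P2 by (simp add: G_def integrand_def)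
        also have "\<dots> \<le> \<Lambda> * (\<Sum>i\<in>I. \<bar>z i (n / N) (?r y) - z i c y\<bar>)" by (rule \<Phi>_lip)
        also have "\<dots> \<le> \<Lambda> * (real (card I) * \<epsilon>)"
          using close \<Lambda> by (intro mult_left_mono sum_bounded_above) auto
        also have "\<dots> \<le> ?U y" using box by (simp add: sum_nonneg)
        finally show ?thesis .
      next
        case False
        then obtain i where i: "i \<in> I" "z i c y \<le> 0" by force
        moreover have "0 < z i (n / N) (?r y)" using P1 i by blast
        ultimately have "\<bar>z i c y\<bar> \<le> \<epsilon>" using close[OF i(1), of y] by linarith
        then show ?thesis using mismatch[OF box i(1)] by blast
      qed
    next
      case P1: False
      show ?thesis
      proof (cases ?P2)
        case P2: True
        have box: "y \<in> box_set L B" by (rule pos_box[OF P2 c(2) ext])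
        obtain i where i: "i \<in> I" "z i (n / N) (?r y) \<le> 0" using P1 by force
        moreover have "0 < z i c y" using P2 i by blast
        ultimately have "\<bar>z i c y\<bar> \<le> \<epsilon>" using close[OF i(1), of y] by linarith
        then show ?thesis using mismatch[OF box i(1)] by blast
      next
        case False
        then have "integrand c y = 0" unfolding integrand_def by (rule if_not_P)
        moreover have "G y = 0" using P1 unfolding G_def integrand_def by (rule if_not_P)
        ultimately show ?thesis using U0 by simp
      qed
    qed
  qed
  have U_int: "integrable M ?U"
    using box_int slab_int by (intro Bochner_Integration.integrable_add integrable_mult_right Bochner_Integration.integrable_sum)
  have U_lint: "(LINT y|M. ?U y) \<le> approx_const B / N"
  proof -
    have "(LINT y|M. ?U y) = \<Lambda> * (real (card I) * \<epsilon>) * B ^ card L + (\<Sum>i\<in>I. LINT y|M. indicator (?sl i) y)"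
      using box_int slab_int
      by (simp add: Bochner_Integration.integral_add Bochner_Integration.integral_sum Bochner_Integration.integrable_sum)
    also have "\<dots> \<le> \<Lambda> * (real (card I) * \<epsilon>) * B ^ card L + real (card I) * (2 * \<epsilon> * B ^ (card L - 1))"
      using slab_int(2) by (intro add_left_mono sum_bounded_above) auto
    also have "\<dots> = approx_const B / N"
      by (simp add: approx_const_def \<epsilon>_def add_divide_distrib algebra_simps)
    finally show ?thesis .
  qed
  have "\<bar>(LINT y|M. G y) - (LINT y|M. integrand c y)\<bar> = \<bar>LINT y|M. G y - integrand c y\<bar>"
    using G_int integrand_int by simp
  also have "\<dots> \<le> (LINT y|M. \<bar>G y - integrand c y\<bar>)" using integral_norm_bound[of M "\<lambda>y. G y - integrand c y"] by simp
  also have "\<dots> \<le> (LINT y|M. ?U y)"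
    using G_int integrand_int U_int diff by (intro integral_mono) auto
  also note U_lint
  finally have main: "\<bar>(\<Sum>w\<in>?W. sample n N w) * (1 / real N) ^ card L - (LINT y|M. integrand c y)\<bar> \<le> approx_const B / N"
    unfolding G_lint .
  have "\<bar>(\<Sum>w\<in>?W. sample n N w) - real N ^ card L * (LINT y|M. integrand c y)\<bar> =
     real N ^ card L * \<bar>(\<Sum>w\<in>?W. sample n N w) * (1 / real N) ^ card L - (LINT y|M. integrand c y)\<bar>"
  proof -
    have "(\<Sum>w\<in>?W. sample n N w) - real N ^ card L * (LINT y|M. integrand c y) =
      real N ^ card L * ((\<Sum>w\<in>?W. sample n N w) * (1 / real N) ^ card L - (LINT y|M. integrand c y))"
      using N by (simp add: right_diff_distrib power_one_over field_simps)
    then show ?thesis by (simp add: abs_mult)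
  qed
  also have "\<dots> \<le> real N ^ card L * (approx_const B / N)"
    using main by (intro mult_left_mono) auto
  finally show ?thesis by (simp add: mult.commute)
qed

end

section \<open>Cycle weights and the elimination of variables\<close>

lemma Max_image_lipschitz:
  fixes f h :: "'j \<Rightarrow> real"
  assumes J: "finite J" "J \<noteq> {}" and e: "\<And>j. j \<in> J \<Longrightarrow> \<bar>f j - h j\<bar> \<le> e"
  shows "\<bar>Max (f ` J) - Max (h ` J)\<bar> \<le> e" and "\<bar>Min (f ` J) - Min (h ` J)\<bar> \<le> e"
proof -
  have up: "Max (f ` J) \<le> Max (h ` J) + e" if "\<And>j. j \<in> J \<Longrightarrow> \<bar>f j - h j\<bar> \<le> e" for f h :: "'j \<Rightarrow> real"
  proof (intro Max.boundedI)
    fix x assume "x \<in> f ` J"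
    then obtain j where j: "j \<in> J" "x = f j" by auto
    have "h j \<le> Max (h ` J)" using J j by simp
    then show "x \<le> Max (h ` J) + e" using that[OF j(1)] j(2) by linarith
  qed (use J in auto)
  have lo: "Min (h ` J) - e \<le> Min (f ` J)" if "\<And>j. j \<in> J \<Longrightarrow> \<bar>f j - h j\<bar> \<le> e" for f h :: "'j \<Rightarrow> real"
  proof (intro Min.boundedI)
    fix x assume "x \<in> f ` J"
    then obtain j where j: "j \<in> J" "x = f j" by auto
    have "Min (h ` J) \<le> h j" using J j by simp
    then show "Min (h ` J) - e \<le> x" using that[OF j(1)] j(2) by linarith
  qed (use J in auto)
  have e': "\<bar>h j - f j\<bar> \<le> e" if "j \<in> J" for j using e[OF that] by (simp add: abs_minus_commute)
  show "\<bar>Max (f ` J) - Max (h ` J)\<bar> \<le> e" using up[of f h, OF e] up[of h f, OF e'] by linarith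
  show "\<bar>Min (f ` J) - Min (h ` J)\<bar> \<le> e" using lo[of f h, OF e] lo[of h f, OF e'] by linarith
qed

lemma signed_formI:
  assumes L: "finite L" "P \<subseteq> L" "Q \<subseteq> L" "P \<inter> Q = {}" and \<alpha>: "\<alpha> = 1 \<or> \<alpha> = 0 \<and> P \<noteq> {}"
    and z: "\<And>c y. z c y = \<alpha> * c + (\<Sum>x\<in>P. y x) - (\<Sum>x\<in>Q. y x)"
  shows "signed_form L z"
  unfolding signed_form_def
proof (intro exI conjI allI ballI)
  let ?\<kappa> = "\<lambda>x. (if x \<in> P then 1 else 0) - (if x \<in> Q then 1 else (0::real))"
  fix c y
  have "(\<Sum>x\<in>L. ?\<kappa> x * y x) = (\<Sum>x\<in>L. if x \<in> P then y x else 0) - (\<Sum>x\<in>L. if x \<in> Q then y x else 0)"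
    unfolding sum_subtractf[symmetric] by (intro sum.cong) auto
  also have "\<dots> = (\<Sum>x\<in>P. y x) - (\<Sum>x\<in>Q. y x)"
    using L by (simp add: sum.If_cases Int_absorb1)
  finally show "z c y = \<alpha> * c + (\<Sum>x\<in>L. ?\<kappa> x * y x)" by (simp add: z)
  show "?\<kappa> x \<in> {- 1, 0, 1}" for x using L(4) by auto
  show "\<alpha> = 1 \<or> \<alpha> = 0 \<and> (\<exists>x\<in>L. ?\<kappa> x \<noteq> 0)"
  proof (cases "P = {}")
    case True
    then show ?thesis using \<alpha> by blast
  next
    case False
    then obtain x where x: "x \<in> P" by blast
    then have "x \<in> L" "x \<notin> Q" using L by blast+
    with x have "\<exists>x\<in>L. ?\<kappa> x \<noteq> 0" by (intro bexI[of _ x]) simp_all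
    then show ?thesis using \<alpha> by blast
  qed
qed

locale block_permutation =
  fixes k :: nat and \<pi> :: "block set" and \<sigma> :: "block \<Rightarrow> block"
  assumes k: "k \<ge> 1" and part: "partition_on (Omega k) \<pi>" and \<sigma>: "\<sigma> permutes \<pi>"
begin

lemma fin\<pi>: "finite \<pi>"
  by (rule finite_elements[OF finite_Omega part])

lemma perm: "permutation \<sigma>"
  by (rule permutes_imp_permutation[OF fin\<pi> \<sigma>])

lemma finCyc: "finite (Cyc \<pi> \<sigma>)"
  using fin\<pi> by (simp add: Cyc_def)

lemma cycle_sub: "C \<in> Cyc \<pi> \<sigma> \<Longrightarrow> C \<subseteq> \<pi>"
  using permutes_orbit_subset[OF \<sigma>] by (auto simp: Cyc_def)

lemma cycle_eq: "C \<in> Cyc \<pi> \<sigma> \<Longrightarrow> B \<in> C \<Longrightarrow> C = orbit \<sigma> B"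
  using orbit_cyclic_eq3[OF cyclic_on_orbit'[OF perm]] by (auto simp: Cyc_def)

lemma cycle_rep_mem: "C \<in> Cyc \<pi> \<sigma> \<Longrightarrow> cycle_rep C \<in> C"
  using cycle_rep_in[OF perm] by (auto simp: Cyc_def)

lemma cycle_card: "C \<in> Cyc \<pi> \<sigma> \<Longrightarrow> 0 < card C"
  using cycle_enum(3)[OF perm permutation_self_in_orbit[OF perm]] by (auto simp: Cyc_def)

lemma cycle_card_le: "C \<in> Cyc \<pi> \<sigma> \<Longrightarrow> card C \<le> card \<pi>"
  using cycle_sub fin\<pi> by (intro card_mono)

lemma iter_in: "C \<in> Cyc \<pi> \<sigma> \<Longrightarrow> (\<sigma> ^^ j) (cycle_rep C) \<in> \<pi>"
proof (induction j)
  case 0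
  then show ?case using cycle_rep_mem cycle_sub by auto
next
  case (Suc j)
  then show ?case using \<sigma> by (simp add: permutes_in_image)
qed

definition cyc_of :: "nat + nat \<Rightarrow> block set" where
  "cyc_of x = orbit \<sigma> (block_of \<pi> x)"

lemma cyc_of_in: "x \<in> Omega k \<Longrightarrow> cyc_of x \<in> Cyc \<pi> \<sigma>"
  using block_of_in(1)[OF part] by (auto simp: cyc_of_def Cyc_def)

lemma cyc_of_iff:
  assumes "x \<in> Omega k" "C \<in> Cyc \<pi> \<sigma>"
  shows "x \<in> \<Union>C \<longleftrightarrow> C = cyc_of x"
proof
  assume "x \<in> \<Union>C"
  then obtain B where B: "B \<in> C" "x \<in> B" by auto
  then have "block_of \<pi> x = B" using block_of_eq[OF part] cycle_sub[OF assms(2)] by auto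
  then show "C = cyc_of x" using cycle_eq[OF assms(2) B(1)] by (simp add: cyc_of_def)
next
  assume "C = cyc_of x"
  then show "x \<in> \<Union>C"
    using permutation_self_in_orbit[OF perm, of "block_of \<pi> x"] block_of_in(2)[OF part assms(1)] by (auto simp: cyc_of_def)
qed

lemma block_sub: "B \<in> \<pi> \<Longrightarrow> B \<subseteq> Omega k"
  using part by (auto simp: partition_on_def)

lemma cycle_labels: "C \<in> Cyc \<pi> \<sigma> \<Longrightarrow> x \<in> \<Union>C \<Longrightarrow> x \<in> Omega k"
  using cycle_sub block_sub by blast

abbreviation "cplus C \<equiv> plus_idx (\<Union>C)"
abbreviation "cminus C \<equiv> minus_idx (\<Union>C)"

lemma Omega_iff [simp]: "Inl i \<in> Omega k \<longleftrightarrow> i \<in> {1..k}" "Inr i \<in> Omega k \<longleftrightarrow> i \<in> {1..k}"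
  by (auto simp: Omega_def)

lemma plus_sub: "C \<in> Cyc \<pi> \<sigma> \<Longrightarrow> cplus C \<subseteq> {1..k}"
proof
  fix i assume "C \<in> Cyc \<pi> \<sigma>" "i \<in> cplus C"
  then have "Inl i \<in> Omega k" by (intro cycle_labels[of C]) (simp_all add: plus_idx_def)
  then show "i \<in> {1..k}" by simp
qed

lemma minus_sub: "C \<in> Cyc \<pi> \<sigma> \<Longrightarrow> cminus C \<subseteq> {1..k}"
proof
  fix i assume "C \<in> Cyc \<pi> \<sigma>" "i \<in> cminus C"
  then have "Inr i \<in> Omega k" by (intro cycle_labels[of C]) (simp_all add: minus_idx_def)
  then show "i \<in> {1..k}" by simp
qed

lemma plus_iff: "C \<in> Cyc \<pi> \<sigma> \<Longrightarrow> i \<in> {1..k} \<Longrightarrow> i \<in> cplus C \<longleftrightarrow> C = cyc_of (Inl i)"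
  using cyc_of_iff[of "Inl i" C] by (simp add: plus_idx_def)

lemma minus_iff: "C \<in> Cyc \<pi> \<sigma> \<Longrightarrow> i \<in> {1..k} \<Longrightarrow> i \<in> cminus C \<longleftrightarrow> C = cyc_of (Inr i)"
  using cyc_of_iff[of "Inr i" C] by (simp add: minus_idx_def)

lemma fin_plus: "C \<in> Cyc \<pi> \<sigma> \<Longrightarrow> finite (cplus C)"
  by (rule finite_subset[OF plus_sub]) simp_all

lemma fin_minus: "C \<in> Cyc \<pi> \<sigma> \<Longrightarrow> finite (cminus C)"
  by (rule finite_subset[OF minus_sub]) simp_all

lemma sum_over_plus: "(\<Sum>C\<in>Cyc \<pi> \<sigma>. \<Sum>i\<in>cplus C. f i) = (\<Sum>i=1..k. f i)"
proof -
  have "(\<Sum>i\<in>(\<Union>C\<in>Cyc \<pi> \<sigma>. cplus C). f i) = (\<Sum>C\<in>Cyc \<pi> \<sigma>. \<Sum>i\<in>cplus C. f i)"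
  proof (intro sum.UNION_disjoint ballI impI)
    fix C C' assume C: "C \<in> Cyc \<pi> \<sigma>" "C' \<in> Cyc \<pi> \<sigma>" "C \<noteq> C'"
    show "cplus C \<inter> cplus C' = {}"
    proof (rule equals0I)
      fix i assume i: "i \<in> cplus C \<inter> cplus C'"
      then have "i \<in> {1..k}" using plus_sub[OF C(1)] by blast
      then have "C = cyc_of (Inl i)" "C' = cyc_of (Inl i)" using plus_iff C(1,2) i by (metis IntD1, metis IntD2)
      then show False using C(3) by simp
    qed
  qed (use finCyc fin_plus in auto)
  moreover have "(\<Union>C\<in>Cyc \<pi> \<sigma>. cplus C) = {1..k}"
  proof (intro equalityI subsetI)
    fix i assume i: "i \<in> {1..k}"
    then have "cyc_of (Inl i) \<in> Cyc \<pi> \<sigma>" by (intro cyc_of_in) simp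
    then show "i \<in> (\<Union>C\<in>Cyc \<pi> \<sigma>. cplus C)" using plus_iff i by blast
  qed (use plus_sub in blast)
  ultimately show ?thesis by simp
qed

lemma sum_over_minus: "(\<Sum>C\<in>Cyc \<pi> \<sigma>. \<Sum>i\<in>cminus C. f i) = (\<Sum>i=1..k. f i)"
proof -
  have "(\<Sum>i\<in>(\<Union>C\<in>Cyc \<pi> \<sigma>. cminus C). f i) = (\<Sum>C\<in>Cyc \<pi> \<sigma>. \<Sum>i\<in>cminus C. f i)"
  proof (intro sum.UNION_disjoint ballI impI)
    fix C C' assume C: "C \<in> Cyc \<pi> \<sigma>" "C' \<in> Cyc \<pi> \<sigma>" "C \<noteq> C'"
    show "cminus C \<inter> cminus C' = {}"
    proof (rule equals0I)
      fix i assume i: "i \<in> cminus C \<inter> cminus C'"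
      then have "i \<in> {1..k}" using minus_sub[OF C(1)] by blast
      then have "C = cyc_of (Inr i)" "C' = cyc_of (Inr i)" using minus_iff C(1,2) i by (metis IntD1, metis IntD2)
      then show False using C(3) by simp
    qed
  qed (use finCyc fin_minus in auto)
  moreover have "(\<Union>C\<in>Cyc \<pi> \<sigma>. cminus C) = {1..k}"
  proof (intro equalityI subsetI)
    fix i assume i: "i \<in> {1..k}"
    then have "cyc_of (Inr i) \<in> Cyc \<pi> \<sigma>" by (intro cyc_of_in) simp
    then show "i \<in> (\<Union>C\<in>Cyc \<pi> \<sigma>. cminus C)" using minus_iff i by blast
  qed (use minus_sub in blast)
  ultimately show ?thesis by simp
qed

text \<open>Every label of the cycle lies in exactly one of its blocks.\<close>

lemma D_partial_total:
  assumes C: "C \<in> Cyc \<pi> \<sigma>"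
  shows "D_partial \<sigma> u v (cycle_rep C) (card C) = (\<Sum>i\<in>cplus C. u i) - (\<Sum>j\<in>cminus C. v j)"
proof -
  have O: "C = orbit \<sigma> (cycle_rep C)" by (rule cycle_eq[OF C cycle_rep_mem[OF C]])
  have bij: "bij_betw (\<lambda>j. (\<sigma> ^^ j) (cycle_rep C)) {..<card C} C"
    using cycle_enum(1)[OF perm, of "cycle_rep C" "cycle_rep C"] O cycle_rep_mem[OF C] by metis
  have finC: "finite C" using cycle_sub[OF C] fin\<pi> by (rule finite_subset)
  have disj: "B \<inter> B' = {}" if "B \<in> C" "B' \<in> C" "B \<noteq> B'" for B B'
    using that cycle_sub[OF C] partition_onD2[OF part] by (auto simp: disjoint_def)
  have disj': "plus_idx B \<inter> plus_idx B' = {}" "minus_idx B \<inter> minus_idx B' = {}" if "B \<in> C" "B' \<in> C" "B \<noteq> B'" for B B'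
    using disj[OF that] by (auto simp: plus_idx_def minus_idx_def)
  have finB: "finite (plus_idx B)" "finite (minus_idx B)" if "B \<in> C" for B
  proof -
    have "plus_idx B \<subseteq> cplus C" "minus_idx B \<subseteq> cminus C" using that by (auto simp: plus_idx_def minus_idx_def)
    then show "finite (plus_idx B)" "finite (minus_idx B)" using fin_plus[OF C] fin_minus[OF C] finite_subset by blast+
  qed
  have "D_partial \<sigma> u v (cycle_rep C) (card C) = (\<Sum>B\<in>C. d_block u v B)"
    unfolding D_partial_def by (rule sum.reindex_bij_betw[OF bij])
  also have "\<dots> = (\<Sum>B\<in>C. \<Sum>i\<in>plus_idx B. u i) - (\<Sum>B\<in>C. \<Sum>j\<in>minus_idx B. v j)"
    by (simp add: d_block_def sum_subtractf)
  also have "(\<Sum>B\<in>C. \<Sum>i\<in>plus_idx B. u i) = (\<Sum>i\<in>(\<Union>B\<in>C. plus_idx B). u i)"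
    using finC finB disj' by (intro sum.UNION_disjoint[symmetric]) simp_all
  also have "(\<Union>B\<in>C. plus_idx B) = cplus C" by (auto simp: plus_idx_def)
  also have "(\<Sum>B\<in>C. \<Sum>j\<in>minus_idx B. v j) = (\<Sum>j\<in>(\<Union>B\<in>C. minus_idx B). v j)"
    using finC finB disj' by (intro sum.UNION_disjoint[symmetric]) simp_all
  also have "(\<Union>B\<in>C. minus_idx B) = cminus C" by (auto simp: minus_idx_def)
  finally show ?thesis .
qed

lemma d_block_cong:
  assumes B: "B \<in> \<pi>" and "\<And>i. i \<in> {1..k} \<Longrightarrow> u i = u' i" "\<And>i. i \<in> {1..k} \<Longrightarrow> v i = v' i"
  shows "d_block u v B = d_block u' v' B"
proof -
  have "plus_idx B \<subseteq> {1..k}" "minus_idx B \<subseteq> {1..k}"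
    using block_sub[OF B] Omega_iff by (auto simp: plus_idx_def minus_idx_def simp del: Omega_iff)
  then show ?thesis using assms(2,3) unfolding d_block_def by (intro arg_cong2[where f = "(-)"] sum.cong) auto
qed

lemma omega_rep: "omega_cyc \<sigma> u v C = Max (D_partial \<sigma> u v (cycle_rep C) ` {..<card C}) - Min (D_partial \<sigma> u v (cycle_rep C) ` {..<card C})"
  by (simp add: omega_cyc_def cycle_rep_def Let_def)

lemma omega_cong:
  assumes C: "C \<in> Cyc \<pi> \<sigma>" and eq: "\<And>i. i \<in> {1..k} \<Longrightarrow> u i = u' i" "\<And>i. i \<in> {1..k} \<Longrightarrow> v i = v' i"
  shows "omega_cyc \<sigma> u v C = omega_cyc \<sigma> u' v' C"
proof -
  have "D_partial \<sigma> u v (cycle_rep C) = D_partial \<sigma> u' v' (cycle_rep C)"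
    unfolding D_partial_def by (intro ext sum.cong refl d_block_cong iter_in[OF C] eq)
  then show ?thesis by (simp add: omega_rep)
qed

lemma omega_nonneg:
  assumes C: "C \<in> Cyc \<pi> \<sigma>"
  shows "0 \<le> omega_cyc \<sigma> u v C"
proof -
  have "finite (D_partial \<sigma> u v (cycle_rep C) ` {..<card C})" "D_partial \<sigma> u v (cycle_rep C) 0 \<in> D_partial \<sigma> u v (cycle_rep C) ` {..<card C}"
    using cycle_card[OF C] by auto
  then have "Min (D_partial \<sigma> u v (cycle_rep C) ` {..<card C}) \<le> D_partial \<sigma> u v (cycle_rep C) 0"
    "D_partial \<sigma> u v (cycle_rep C) 0 \<le> Max (D_partial \<sigma> u v (cycle_rep C) ` {..<card C})" by (auto intro: Min_le Max_ge)
  then show ?thesis by (simp add: omega_rep)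
qed

lemma omega_scale:
  assumes C: "C \<in> Cyc \<pi> \<sigma>" and t: "0 \<le> t"
  shows "omega_cyc \<sigma> (\<lambda>i. t * u i) (\<lambda>i. t * v i) C = t * omega_cyc \<sigma> u v C"
proof -
  let ?D = "D_partial \<sigma> u v (cycle_rep C)"
  have "D_partial \<sigma> (\<lambda>i. t * u i) (\<lambda>i. t * v i) (cycle_rep C) = (\<lambda>j. t * ?D j)"
    by (simp add: D_partial_def d_block_def sum_distrib_left right_diff_distrib fun_eq_iff)
  then have im: "D_partial \<sigma> (\<lambda>i. t * u i) (\<lambda>i. t * v i) (cycle_rep C) ` {..<card C} = (*) t ` (?D ` {..<card C})"
    by (auto simp: image_image)
  have S: "finite (?D ` {..<card C})" "?D ` {..<card C} \<noteq> {}" using cycle_card[OF C] by auto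
  have m: "mono ((*) t)" using t by (simp add: mono_def mult_left_mono)
  show ?thesis
    unfolding omega_rep im using mono_Max_commute[OF m S] mono_Min_commute[OF m S] by (simp add: right_diff_distrib)
qed

text \<open>Each partial sum of the cycle changes by at most \<open>card \<pi>\<close> times the total perturbation of the labels.\<close>

lemma omega_lipschitz:
  fixes a b :: "nat + nat \<Rightarrow> real"
  assumes C: "C \<in> Cyc \<pi> \<sigma>"
  shows "\<bar>omega_cyc \<sigma> (\<lambda>i. a (Inl i)) (\<lambda>i. a (Inr i)) C - omega_cyc \<sigma> (\<lambda>i. b (Inl i)) (\<lambda>i. b (Inr i)) C\<bar>
     \<le> 2 * real (card \<pi>) * (\<Sum>x\<in>Omega k. \<bar>a x - b x\<bar>)"
proof -
  let ?\<Delta> = "\<Sum>x\<in>Omega k. \<bar>a x - b x\<bar>"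
  let ?d = "\<lambda>a B. d_block (\<lambda>i. a (Inl i)) (\<lambda>i. a (Inr i)) B"
  let ?D = "\<lambda>a. D_partial \<sigma> (\<lambda>i. a (Inl i)) (\<lambda>i. a (Inr i)) (cycle_rep C)"
  have d: "\<bar>?d a B - ?d b B\<bar> \<le> ?\<Delta>" if B: "B \<in> \<pi>" for B
  proof -
    have sub: "Inl ` plus_idx B \<union> Inr ` minus_idx B \<subseteq> Omega k"
      using block_sub[OF B] by (auto simp: plus_idx_def minus_idx_def)
    have fin: "finite (Inl ` plus_idx B :: (nat + nat) set)" "finite (Inr ` minus_idx B :: (nat + nat) set)"
      using sub finite_Omega finite_subset by blast+
    have "?d a B - ?d b B = (\<Sum>i\<in>plus_idx B. a (Inl i) - b (Inl i)) - (\<Sum>i\<in>minus_idx B. a (Inr i) - b (Inr i))"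
      by (simp add: d_block_def sum_subtractf)
    also have "\<bar>\<dots>\<bar> \<le> (\<Sum>i\<in>plus_idx B. \<bar>a (Inl i) - b (Inl i)\<bar>) + (\<Sum>i\<in>minus_idx B. \<bar>a (Inr i) - b (Inr i)\<bar>)"
      by (intro order.trans[OF abs_triangle_ineq4] add_mono sum_abs)
    also have "\<dots> = (\<Sum>x\<in>Inl ` plus_idx B. \<bar>a x - b x\<bar>) + (\<Sum>x\<in>Inr ` minus_idx B. \<bar>a x - b x\<bar>)"
      by (simp add: sum.reindex)
    also have "\<dots> = (\<Sum>x\<in>Inl ` plus_idx B \<union> Inr ` minus_idx B. \<bar>a x - b x\<bar>)"
      using fin by (intro sum.union_disjoint[symmetric]) auto
    also have "\<dots> \<le> ?\<Delta>" using sub finite_Omega by (intro sum_mono2) auto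
    finally show ?thesis .
  qed
  have D: "\<bar>?D a j - ?D b j\<bar> \<le> card \<pi> * ?\<Delta>" if j: "j \<in> {..<card C}" for j
  proof -
    have "?D a j - ?D b j = (\<Sum>i<j. ?d a ((\<sigma> ^^ i) (cycle_rep C)) - ?d b ((\<sigma> ^^ i) (cycle_rep C)))"
      by (simp add: D_partial_def sum_subtractf)
    also have "\<bar>\<dots>\<bar> \<le> (\<Sum>i<j. \<bar>?d a ((\<sigma> ^^ i) (cycle_rep C)) - ?d b ((\<sigma> ^^ i) (cycle_rep C))\<bar>)" by (rule sum_abs)
    also have "\<dots> \<le> (\<Sum>i<j. ?\<Delta>)" by (intro sum_mono d iter_in[OF C])
    also have "\<dots> = real j * ?\<Delta>" by simp
    also have "\<dots> \<le> card \<pi> * ?\<Delta>"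
      using j cycle_card_le[OF C] by (intro mult_right_mono sum_nonneg) auto
    finally show ?thesis .
  qed
  have J: "finite {..<card C}" "{..<card C} \<noteq> {}" using cycle_card[OF C] by auto
  show ?thesis
    unfolding omega_rep
    using Max_image_lipschitz[of "{..<card C}" "?D a" "?D b", OF J D]
    by (simp add: abs_le_iff)
qed

definition weight_prod :: "(nat + nat \<Rightarrow> real) \<Rightarrow> real" where
  "weight_prod a = (\<Prod>C\<in>Cyc \<pi> \<sigma>. max 0 (1 - omega_cyc \<sigma> (\<lambda>i. a (Inl i)) (\<lambda>i. a (Inr i)) C))"

lemma weight_prod_range: "0 \<le> weight_prod a \<and> weight_prod a \<le> 1"
  unfolding weight_prod_def using omega_nonneg by (auto intro!: prod_nonneg prod_le_1)

lemma weight_prod_lipschitz: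
  "\<bar>weight_prod a - weight_prod b\<bar> \<le> real (card (Cyc \<pi> \<sigma>)) * (2 * real (card \<pi>)) * (\<Sum>x\<in>Omega k. \<bar>a x - b x\<bar>)"
proof -
  let ?w = "\<lambda>a C. max 0 (1 - omega_cyc \<sigma> (\<lambda>i. a (Inl i)) (\<lambda>i. a (Inr i)) C)"
  have "norm (weight_prod a - weight_prod b) \<le> (\<Sum>C\<in>Cyc \<pi> \<sigma>. norm (?w a C - ?w b C))"
    unfolding weight_prod_def using omega_nonneg by (intro norm_prod_diff) auto
  also have "\<dots> \<le> (\<Sum>C\<in>Cyc \<pi> \<sigma>. 2 * real (card \<pi>) * (\<Sum>x\<in>Omega k. \<bar>a x - b x\<bar>))"
  proof (rule sum_mono)
    fix C assume C: "C \<in> Cyc \<pi> \<sigma>"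
    have "norm (?w a C - ?w b C) \<le> \<bar>omega_cyc \<sigma> (\<lambda>i. a (Inl i)) (\<lambda>i. a (Inr i)) C - omega_cyc \<sigma> (\<lambda>i. b (Inl i)) (\<lambda>i. b (Inr i)) C\<bar>"
      by (auto simp: max_def abs_if)
    also note omega_lipschitz[OF C, of a b]
    finally show "norm (?w a C - ?w b C) \<le> 2 * real (card \<pi>) * (\<Sum>x\<in>Omega k. \<bar>a x - b x\<bar>)" .
  qed
  finally show ?thesis by (simp add: mult.assoc)
qed

end

text \<open>The pairs \<open>(\<pi>, \<sigma>)\<close> for which every cycle carries labels of both signs; on the others both the lattice sum and
  the integral vanish.\<close>

locale balanced_permutation = block_permutation +
  assumes balanced: "\<And>C. C \<in> Cyc \<pi> \<sigma> \<Longrightarrow> plus_idx (\<Union>C) \<noteq> {} \<and> minus_idx (\<Union>C) \<noteq> {}"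
begin

abbreviation "L \<equiv> free_labels k \<pi> \<sigma>"

definition label_val :: "nat + nat \<Rightarrow> real \<Rightarrow> (nat + nat \<Rightarrow> real) \<Rightarrow> real" where
  "label_val x c y = (case x of Inl i \<Rightarrow> u_of k c y i | Inr j \<Rightarrow> v_of k c \<pi> \<sigma> y j)"

lemma label_val_Inl: "(\<lambda>i. label_val (Inl i) c y) = u_of k c y" and label_val_Inr: "(\<lambda>i. label_val (Inr i) c y) = v_of k c \<pi> \<sigma> y"
  by (simp_all add: label_val_def)

lemma finL: "finite L"
  unfolding free_labels_def using finite_Omega by blast

lemma L_sub: "L \<subseteq> Omega k"
  by (auto simp: free_labels_def)

lemma elim_in: "C \<in> Cyc \<pi> \<sigma> \<Longrightarrow> elim_idx C \<in> cminus C"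
  unfolding elim_idx_def by (rule LeastI_ex[of "\<lambda>j. j \<in> cminus C"]) (use balanced[of C] in blast)

lemma elim_in_k: "C \<in> Cyc \<pi> \<sigma> \<Longrightarrow> elim_idx C \<in> {1..k}"
  by (rule subsetD[OF minus_sub elim_in])

lemma elim_cyc: "C \<in> Cyc \<pi> \<sigma> \<Longrightarrow> cyc_of (Inr (elim_idx C)) = C"
  using minus_iff[OF _ elim_in_k, of C C] elim_in[of C] by simp

lemma elim_inj: "inj_on (\<lambda>C. Inr (elim_idx C) :: nat + nat) (Cyc \<pi> \<sigma>)"
  by (rule inj_on_inverseI[where g = cyc_of]) (rule elim_cyc)

lemma Inl_L: "Inl i \<in> L \<longleftrightarrow> i \<in> {2..k}"
  by (auto simp: free_labels_def)

lemma Inr_L: "Inr j \<in> L \<longleftrightarrow> j \<in> {1..k} \<and> (\<forall>C\<in>Cyc \<pi> \<sigma>. j \<noteq> elim_idx C)"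
  by (auto simp: free_labels_def)

lemma minus_L: 
  assumes C: "C \<in> Cyc \<pi> \<sigma>" and l: "l \<in> cminus C - {elim_idx C}"
  shows "Inr l \<in> L"
proof -
  have lk: "l \<in> {1..k}" using minus_sub[OF C] l by auto
  have "l \<noteq> elim_idx C'" if "C' \<in> Cyc \<pi> \<sigma>" for C'
  proof
    assume "l = elim_idx C'"
    then have "C' = cyc_of (Inr l)" using elim_cyc[OF that] by simp
    moreover have "C = cyc_of (Inr l)" using minus_iff[OF C lk] l by simp
    ultimately show False using l \<open>l = elim_idx C'\<close> by simp
  qed
  then show ?thesis using lk Inr_L by blast
qed

text \<open>The \<open>2k\<close> labels lose \<open>u\<^sub>1\<close> and one \<open>v\<^sub>j\<close> for each cycle. Each cycle contributes a factor \<open>N\<close> to the lattice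
  sum, each free label a further one, which gives the exponent \<open>2k - 1\<close>.\<close>

lemma card_L: "card L + 1 + card (Cyc \<pi> \<sigma>) = 2 * k"
proof -
  let ?E = "(\<lambda>C. Inr (elim_idx C) :: nat + nat) ` Cyc \<pi> \<sigma>"
  have E: "?E \<subseteq> Omega k - {Inl 1}" using elim_in_k by auto
  have cE: "card ?E = card (Cyc \<pi> \<sigma>)" by (rule card_image[OF elim_inj])
  have cO: "card (Omega k) = 2 * k" unfolding Omega_def by (subst card_Plus) auto
  have "Inl 1 \<in> Omega k" using k by simp
  then have c1: "card (Omega k - {Inl 1}) = 2 * k - 1" using cO finite_Omega by simp
  have "card L = 2 * k - 1 - card (Cyc \<pi> \<sigma>)"
  proof -
    have "card (Omega k - {Inl 1} - ?E) = card (Omega k - {Inl 1}) - card ?E"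
      using finCyc E by (intro card_Diff_subset) auto
    then show ?thesis unfolding free_labels_def c1 cE .
  qed
  moreover have "card (Cyc \<pi> \<sigma>) \<le> 2 * k - 1" using card_mono[OF _ E] c1 cE finite_Omega by simp
  ultimately show ?thesis using k by simp
qed

lemma u_of_simps: "u_of k c y 1 = c - (\<Sum>l=2..k. y (Inl l))" "i \<noteq> 1 \<Longrightarrow> u_of k c y i = y (Inl i)"
  by (auto simp: u_of_def)

lemma sum_u_of: "(\<Sum>i=1..k. u_of k c y i) = c"
proof -
  have "{1..k} = insert 1 {2..k}" using k by auto
  then have "(\<Sum>i=1..k. u_of k c y i) = u_of k c y 1 + (\<Sum>i=2..k. u_of k c y i)" by simp
  also have "(\<Sum>i=2..k. u_of k c y i) = (\<Sum>i=2..k. y (Inl i))"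
    by (intro sum.cong refl u_of_simps) auto
  finally show ?thesis unfolding u_of_simps(1) by simp
qed

lemma v_of_free: "Inr j \<in> L \<Longrightarrow> v_of k c \<pi> \<sigma> y j = y (Inr j)"
  by (simp add: v_of_def)

lemma v_of_elim:
  assumes C: "C \<in> Cyc \<pi> \<sigma>"
  shows "v_of k c \<pi> \<sigma> y (elim_idx C) = (\<Sum>i\<in>cplus C. u_of k c y i) - (\<Sum>l\<in>cminus C - {elim_idx C}. y (Inr l))"
proof -
  have "(THE C'. C' \<in> Cyc \<pi> \<sigma> \<and> elim_idx C' = elim_idx C) = C"
  proof (rule the_equality)
    fix C' assume C': "C' \<in> Cyc \<pi> \<sigma> \<and> elim_idx C' = elim_idx C"
    then have "C' \<in> Cyc \<pi> \<sigma>" and e: "elim_idx C' = elim_idx C" by auto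
    from elim_cyc[OF this(1)] show "C' = C" unfolding e elim_cyc[OF C] ..
  qed (use C in simp)
  moreover have "Inr (elim_idx C) \<notin> L" unfolding Inr_L using C by blast
  ultimately show ?thesis by (simp add: v_of_def)
qed

lemma v_of_minus: "C \<in> Cyc \<pi> \<sigma> \<Longrightarrow> l \<in> cminus C - {elim_idx C} \<Longrightarrow> v_of k c \<pi> \<sigma> y l = y (Inr l)"
  by (rule v_of_free, rule minus_L)

lemma balance:
  assumes C: "C \<in> Cyc \<pi> \<sigma>"
  shows "(\<Sum>j\<in>cminus C. v_of k c \<pi> \<sigma> y j) = (\<Sum>i\<in>cplus C. u_of k c y i)"
proof -
  have "(\<Sum>j\<in>cminus C. v_of k c \<pi> \<sigma> y j) = v_of k c \<pi> \<sigma> y (elim_idx C) + (\<Sum>j\<in>cminus C - {elim_idx C}. v_of k c \<pi> \<sigma> y j)"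
    by (rule sum.remove[OF fin_minus[OF C] elim_in[OF C]])
  also have "(\<Sum>j\<in>cminus C - {elim_idx C}. v_of k c \<pi> \<sigma> y j) = (\<Sum>l\<in>cminus C - {elim_idx C}. y (Inr l))"
    by (rule sum.cong[OF refl], rule v_of_minus[OF C])
  finally show ?thesis by (simp add: v_of_elim[OF C])
qed

lemma elim_or_free:
  assumes "j \<in> {1..k}" obtains "Inr j \<in> L" | C where "C \<in> Cyc \<pi> \<sigma>" "j = elim_idx C"
proof (cases "Inr j \<in> L")
  case False
  then obtain C where "C \<in> Cyc \<pi> \<sigma>" "j = elim_idx C" unfolding Inr_L using assms by blast
  then show ?thesis by (rule that(2))
qed (rule that(1))

lemma label_val_free: "x \<in> L \<Longrightarrow> label_val x c y = y x"
  using Inl_L by (cases x) (auto simp: label_val_def v_of_free u_of_def)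

lemma form_free: "x \<in> L \<Longrightarrow> signed_form L (label_val x)"
  by (rule signed_formI[OF finL, of "{x}" "{}" 0]) (auto simp: label_val_free)

text \<open>For the eliminated \<open>v\<^sub>j\<close> two cases arise. If \<open>u\<^sub>1\<close> occurs in its cycle, then the sum of the \<open>u\<^sub>i\<close> of the cycle
  is \<open>c\<close> minus the other \<open>u\<^sub>i\<close>, so \<open>c\<close> has coefficient \<open>1\<close>. Otherwise the cycle contains a free \<open>u\<^sub>i\<close>,
  which has coefficient \<open>1\<close>.\<close>

lemma form:
  assumes x: "x \<in> Omega k"
  shows "signed_form L (label_val x)"
proof (cases x)
  case (Inl i)
  show ?thesis
  proof (cases "i = 1")
    case False
    then show ?thesis using x Inl by (intro form_free) (auto simp: Inl_L)
  next
    case True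
    show ?thesis
    proof (rule signed_formI[OF finL, of "{}" "Inl ` {2..k}" 1])
      show "label_val x c y = 1 * c + (\<Sum>x\<in>{}. y x) - (\<Sum>x\<in>Inl ` {2..k}. y x)" for c y
        using Inl True by (simp add: label_val_def u_of_simps(1)[simplified] sum.reindex)
    qed (auto simp: Inl_L)
  qed
next
  case (Inr j)
  then have "j \<in> {1..k}" using x by simp
  then show ?thesis
  proof (cases rule: elim_or_free)
    case 1
    then show ?thesis using Inr by (auto intro: form_free)
  next
    case (2 C)
    note C = 2(1)
    let ?M = "cminus C - {elim_idx C}"
    have MinL: "Inr ` ?M \<subseteq> L" using minus_L[OF C] by auto
    have sM: "(\<Sum>x\<in>Inr ` ?M. y x) = (\<Sum>l\<in>?M. y (Inr l))" for y :: "nat + nat \<Rightarrow> real" by (simp add: sum.reindex)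
    show ?thesis
    proof (cases "1 \<in> cplus C")
      case False
      have P: "cplus C \<subseteq> {2..k}"
      proof
        fix i assume i: "i \<in> cplus C"
        then have "i \<in> {1..k}" "i \<noteq> 1" using plus_sub[OF C] False by blast+
        then show "i \<in> {2..k}" by simp
      qed
      show ?thesis
      proof (rule signed_formI[OF finL, of "Inl ` cplus C" "Inr ` ?M" 0])
        show "Inl ` cplus C \<subseteq> L" using P Inl_L by blast
        show "(0::real) = 1 \<or> (0::real) = 0 \<and> Inl ` cplus C \<noteq> {}" using balanced[OF C] by auto
        fix c y
        have "(\<Sum>i\<in>cplus C. u_of k c y i) = (\<Sum>i\<in>cplus C. y (Inl i))"
          using False by (intro sum.cong refl u_of_simps(2)) auto
        then show "label_val x c y = 0 * c + (\<Sum>x\<in>Inl ` cplus C. y x) - (\<Sum>x\<in>Inr ` ?M. y x)"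
          unfolding sM using Inr 2 by (simp add: label_val_def v_of_elim[OF C] sum.reindex)
      qed (use MinL in auto)
    next
      case True
      let ?Q = "{2..k} - cplus C"
      show ?thesis
      proof (rule signed_formI[OF finL, of "{}" "Inl ` ?Q \<union> Inr ` ?M" 1])
        show "Inl ` ?Q \<union> Inr ` ?M \<subseteq> L" using MinL Inl_L by blast
        fix c y
        have split: "{1..k} = cplus C \<union> ?Q"
        proof (intro equalityI subsetI)
          fix i assume "i \<in> {1..k}"
          then show "i \<in> cplus C \<union> ?Q" using True by (cases "i = 1") auto
        next
          fix i assume "i \<in> cplus C \<union> ?Q"
          then show "i \<in> {1..k}" using plus_sub[OF C] by auto
        qed
        have "c = (\<Sum>i\<in>cplus C \<union> ?Q. u_of k c y i)" using sum_u_of[of c y] split by simp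
        also have "\<dots> = (\<Sum>i\<in>cplus C. u_of k c y i) + (\<Sum>i\<in>?Q. u_of k c y i)"
          using fin_plus[OF C] by (intro sum.union_disjoint) auto
        also have "(\<Sum>i\<in>?Q. u_of k c y i) = (\<Sum>i\<in>?Q. y (Inl i))"
          by (intro sum.cong refl u_of_simps(2)) auto
        finally have "(\<Sum>i\<in>cplus C. u_of k c y i) = c - (\<Sum>i\<in>?Q. y (Inl i))" by simp
        moreover have "(\<Sum>x\<in>Inl ` ?Q \<union> Inr ` ?M. y x) = (\<Sum>i\<in>?Q. y (Inl i)) + (\<Sum>l\<in>?M. y (Inr l))"
          using fin_minus[OF C] by (subst sum.union_disjoint) (auto simp: sum.reindex)
        ultimately show "label_val x c y = 1 * c + (\<Sum>x\<in>{}. y x) - (\<Sum>x\<in>Inl ` ?Q \<union> Inr ` ?M. y x)"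
          using Inr 2 by (simp add: label_val_def v_of_elim[OF C])
      qed auto
    qed
  qed
qed

lemma label_val_pos_iff: "(\<forall>x\<in>Omega k. 0 < label_val x c y) \<longleftrightarrow> (\<forall>i\<in>{1..k}. 0 < u_of k c y i \<and> 0 < v_of k c \<pi> \<sigma> y i)"
proof (intro iffI ballI conjI)
  fix i assume a: "\<forall>x\<in>Omega k. 0 < label_val x c y" and i: "i \<in> {1..k}"
  show "0 < u_of k c y i" using bspec[OF a, of "Inl i"] i by (simp add: label_val_def)
  show "0 < v_of k c \<pi> \<sigma> y i" using bspec[OF a, of "Inr i"] i by (simp add: label_val_def)
next
  fix x assume "\<forall>i\<in>{1..k}. 0 < u_of k c y i \<and> 0 < v_of k c \<pi> \<sigma> y i" "x \<in> Omega k"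
  then show "0 < label_val x c y" by (cases x) (auto simp: label_val_def)
qed

lemma bounded:
  assumes pos: "\<forall>x\<in>Omega k. 0 < label_val x c y" and x: "x \<in> L"
  shows "y x \<le> c"
proof -
  have p: "0 < u_of k c y i" "0 < v_of k c \<pi> \<sigma> y i" if "i \<in> {1..k}" for i
    using pos that unfolding label_val_pos_iff by auto
  show ?thesis
  proof (cases x)
    case (Inl i)
    then have i: "i \<in> {1..k}" using x L_sub by auto
    have "y x = u_of k c y i" using label_val_free[OF x, of c y] Inl by (simp add: label_val_def)
    also have "\<dots> \<le> (\<Sum>i=1..k. u_of k c y i)"
      using p i by (intro member_le_sum) (auto intro: less_imp_le)
    finally show ?thesis unfolding sum_u_of .
  next
    case (Inr j)
    then have j: "j \<in> {1..k}" using x L_sub by auto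
    let ?C = "cyc_of (Inr j)"
    have C: "?C \<in> Cyc \<pi> \<sigma>" using j by (intro cyc_of_in) simp
    have jC: "j \<in> cminus ?C" using minus_iff[OF C j] by simp
    have "y x = v_of k c \<pi> \<sigma> y j" using label_val_free[OF x, of c y] Inr by (simp add: label_val_def)
    also have "\<dots> \<le> (\<Sum>j\<in>cminus ?C. v_of k c \<pi> \<sigma> y j)"
      using p minus_sub[OF C] jC fin_minus[OF C] by (intro member_le_sum) (auto intro!: less_imp_le)
    also have "\<dots> = (\<Sum>i\<in>cplus ?C. u_of k c y i)" by (rule balance[OF C])
    also have "\<dots> \<le> (\<Sum>i=1..k. u_of k c y i)"
      using p plus_sub[OF C] by (intro sum_mono2) (auto intro!: less_imp_le)
    finally show ?thesis unfolding sum_u_of .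
  qed
qed

lemma weight_prod_measurable: "(\<lambda>y. weight_prod (\<lambda>x. label_val x c y)) \<in> borel_measurable (PiM L (\<lambda>_. lborel))"
proof -
  let ?M = "PiM L (\<lambda>_. lborel :: real measure)"
  have z: "(\<lambda>y. label_val x c y) \<in> borel_measurable ?M" if "x \<in> Omega k" for x
    using signed_form_measurable[OF form[OF that], of c] by simp
  have D: "(\<lambda>y. D_partial \<sigma> (\<lambda>i. label_val (Inl i) c y) (\<lambda>i. label_val (Inr i) c y) (cycle_rep C) j) \<in> borel_measurable ?M"
    if C: "C \<in> Cyc \<pi> \<sigma>" for C j
    unfolding D_partial_def d_block_def
  proof (intro borel_measurable_sum borel_measurable_diff z)
    fix a i
    show "Inl i \<in> Omega k" if "i \<in> plus_idx ((\<sigma> ^^ a) (cycle_rep C))"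
      using that block_sub[OF iter_in[OF C, of a]] by (auto simp: plus_idx_def)
    show "Inr i \<in> Omega k" if "i \<in> minus_idx ((\<sigma> ^^ a) (cycle_rep C))"
      using that block_sub[OF iter_in[OF C, of a]] by (auto simp: minus_idx_def)
  qed
  show ?thesis
    unfolding weight_prod_def omega_rep
    by (intro borel_measurable_prod borel_measurable_max borel_measurable_const borel_measurable_diff
        borel_measurable_Max borel_measurable_Min D) auto
qed

sublocale R: lattice_riemann L "Omega k" label_val weight_prod "real (card (Cyc \<pi> \<sigma>)) * (2 * real (card \<pi>))"
proof
  show "\<exists>i\<in>Omega k. \<forall>c y. label_val i c y = y x" if "x \<in> L" for x
    using that L_sub label_val_free by blast
qed (use finL finite_Omega form bounded weight_prod_range weight_prod_lipschitz weight_prod_measurable in auto)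

lemma cycle_integral_eq: "cycle_integral k c \<pi> \<sigma> = (LINT y|PiM L (\<lambda>_. lborel). R.integrand c y)"
proof -
  have "\<not> (\<exists>C\<in>Cyc \<pi> \<sigma>. plus_idx (\<Union>C) = {} \<or> minus_idx (\<Union>C) = {})" using balanced by blast
  then show ?thesis
    unfolding cycle_integral_def R.integrand_def label_val_pos_iff weight_prod_def Let_def label_val_Inl label_val_Inr by (simp only: if_False)
qed

lemma label_val_scale:
  assumes "x \<in> Omega k"
  shows "label_val x (t * c) (\<lambda>l. t * y l) = t * label_val x c y"
  by (rule signed_formE[OF form[OF assms]]) (simp add: distrib_left sum_distrib_left mult_ac)

lemma label_val_int:
  assumes "x \<in> Omega k"
  shows "label_val x (real n) (\<lambda>l. real (w l)) \<in> \<int>"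
proof (rule signed_formE[OF form[OF assms]])
  fix \<alpha> \<kappa> assume z: "\<And>c y. label_val x c y = \<alpha> * c + (\<Sum>x\<in>L. \<kappa> x * y x)"
    and \<kappa>: "\<And>x. x \<in> L \<Longrightarrow> \<kappa> x \<in> {-1, 0, 1}" and \<alpha>: "\<alpha> = 1 \<or> \<alpha> = 0 \<and> (\<exists>x\<in>L. \<kappa> x \<noteq> 0)"
  have "\<alpha> \<in> \<int>" using \<alpha> by auto
  moreover have "\<kappa> x \<in> \<int>" if "x \<in> L" for x using \<kappa>[OF that] by auto
  ultimately show ?thesis unfolding z by (intro Ints_add Ints_mult Ints_sum Ints_of_nat)
qed

definition lattice_weight :: "nat \<Rightarrow> (nat + nat \<Rightarrow> real) \<Rightarrow> real" where
  "lattice_weight N a = (\<Prod>C\<in>Cyc \<pi> \<sigma>. max 0 (real N - omega_cyc \<sigma> (\<lambda>i. a (Inl i)) (\<lambda>i. a (Inr i)) C))"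

lemma lattice_weight_scale:
  assumes N: "N > 0" and ab: "\<And>x. x \<in> Omega k \<Longrightarrow> a x = real N * b x"
  shows "lattice_weight N a = real N ^ card (Cyc \<pi> \<sigma>) * weight_prod b"
proof -
  have "max 0 (real N - omega_cyc \<sigma> (\<lambda>i. a (Inl i)) (\<lambda>i. a (Inr i)) C)
      = real N * max 0 (1 - omega_cyc \<sigma> (\<lambda>i. b (Inl i)) (\<lambda>i. b (Inr i)) C)" if C: "C \<in> Cyc \<pi> \<sigma>" for C
  proof -
    have "omega_cyc \<sigma> (\<lambda>i. a (Inl i)) (\<lambda>i. a (Inr i)) C = omega_cyc \<sigma> (\<lambda>i. real N * b (Inl i)) (\<lambda>i. real N * b (Inr i)) C"
      by (rule omega_cong[OF C]) (simp_all add: ab)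
    also have "\<dots> = real N * omega_cyc \<sigma> (\<lambda>i. b (Inl i)) (\<lambda>i. b (Inr i)) C" by (rule omega_scale[OF C]) simp
    finally show ?thesis by (simp add: max_mult_distrib_left right_diff_distrib)
  qed
  then show ?thesis unfolding lattice_weight_def weight_prod_def by (simp add: prod.distrib)
qed

definition free_part :: "(nat \<Rightarrow> nat) \<Rightarrow> (nat \<Rightarrow> nat) \<Rightarrow> nat + nat \<Rightarrow> nat" where
  "free_part u v = (\<lambda>x\<in>L. case_sum u v x)"

lemma label_val_free_part:
  assumes u: "(\<Sum>i=1..k. u i) = n"
    and bal: "\<And>C. C \<in> Cyc \<pi> \<sigma> \<Longrightarrow> (\<Sum>i\<in>cplus C. u i) = (\<Sum>j\<in>cminus C. v j)"
    and x: "x \<in> Omega k"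
  shows "label_val x (real n) (\<lambda>l. real (free_part u v l)) = real (case_sum u v x)"
proof -
  let ?w = "\<lambda>l. real (free_part u v l)"
  have uu: "u_of k (real n) ?w i = real (u i)" if i: "i \<in> {1..k}" for i
  proof (cases "i = 1")
    case False
    then show ?thesis using i Inl_L by (auto simp: u_of_simps free_part_def)
  next
    case True
    have "{1..k} = insert 1 {2..k}" using k by auto
    then have "n = u 1 + (\<Sum>l=2..k. u l)" using u by simp
    moreover have "(\<Sum>l=2..k. ?w (Inl l)) = (\<Sum>l=2..k. real (u l))"
      using Inl_L by (intro sum.cong refl) (auto simp: free_part_def)
    ultimately show ?thesis unfolding True u_of_simps(1) by simp
  qed
  have vv: "v_of k (real n) \<pi> \<sigma> ?w j = real (v j)" if j: "j \<in> {1..k}" for j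
    using j
  proof (cases rule: elim_or_free)
    case 1
    then show ?thesis by (simp add: v_of_free free_part_def)
  next
    case (2 C)
    note C = 2(1)
    have "(\<Sum>i\<in>cplus C. u_of k (real n) ?w i) = (\<Sum>i\<in>cplus C. real (u i))"
      using plus_sub[OF C] uu by (intro sum.cong) auto
    moreover have "(\<Sum>l\<in>cminus C - {elim_idx C}. ?w (Inr l)) = (\<Sum>l\<in>cminus C - {elim_idx C}. real (v l))"
      using minus_L[OF C] by (intro sum.cong refl) (auto simp: free_part_def)
    moreover have "(\<Sum>i\<in>cplus C. real (u i)) = (\<Sum>l\<in>cminus C. real (v l))"
      using bal[OF C] by (metis of_nat_sum)
    moreover have "(\<Sum>l\<in>cminus C. real (v l)) = real (v (elim_idx C)) + (\<Sum>l\<in>cminus C - {elim_idx C}. real (v l))"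
      by (rule sum.remove[OF fin_minus[OF C] elim_in[OF C]])
    ultimately show ?thesis unfolding 2(2) v_of_elim[OF C] by simp
  qed
  show ?thesis using x uu vv by (cases x) (auto simp: label_val_def)
qed

text \<open>Pairs of compositions that balance every cycle are determined by their free part, and a free part extends to
  such a pair exactly if the eliminated variables come out positive. The values of the \<open>v\<^sub>j\<close> sum to
  \<open>n\<close> automatically, since they balance the \<open>u\<^sub>i\<close> on each cycle.\<close>

lemma lattice_sum_free:
  "lattice_sum k n N \<pi> \<sigma> = (\<Sum>w\<in>L \<rightarrow>\<^sub>E {1..n}. if \<forall>x\<in>Omega k. 0 < label_val x (real n) (\<lambda>l. real (w l))
      then lattice_weight N (\<lambda>x. label_val x (real n) (\<lambda>l. real (w l))) else 0)"
proof -
  let ?c = "compositions k n"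
  let ?bal = "\<lambda>u v. \<forall>C\<in>Cyc \<pi> \<sigma>. (\<Sum>i\<in>cplus C. u i) = (\<Sum>j\<in>cminus C. v j :: nat)"
  let ?A = "{(u, v). u \<in> ?c \<and> v \<in> ?c \<and> ?bal u v}"
  let ?B = "{w \<in> L \<rightarrow>\<^sub>E {1..n}. \<forall>x\<in>Omega k. 0 < label_val x (real n) (\<lambda>l. real (w l))}"
  let ?h = "\<lambda>u v. \<Prod>C\<in>Cyc \<pi> \<sigma>. cycle_weight (real N) \<sigma> (\<lambda>i. real (u i)) (\<lambda>j. real (v j)) C"
  have c1: "(\<Sum>i=1..k. u i) = n" "u \<in> extensional {1..k}" "\<And>i. i \<in> {1..k} \<Longrightarrow> 1 \<le> u i" if "u \<in> ?c" for u
    using that by (auto simp: compositions_def PiE_iff)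
  have A_sub: "?A \<subseteq> ?c \<times> ?c" by auto
  have h0: "?h u v = 0" if nb: "\<not> ?bal u v" for u v
  proof -
    obtain C where C: "C \<in> Cyc \<pi> \<sigma>" "(\<Sum>i\<in>cplus C. u i) \<noteq> (\<Sum>j\<in>cminus C. v j)" using nb by blast
    then have "(\<Sum>i\<in>cplus C. real (u i)) - (\<Sum>j\<in>cminus C. real (v j)) \<noteq> 0"
      by (metis of_nat_eq_iff of_nat_sum right_minus_eq)
    then have "cycle_weight (real N) \<sigma> (\<lambda>i. real (u i)) (\<lambda>j. real (v j)) C = 0"
      unfolding cycle_weight_def D_partial_total[OF C(1)] by simp
    then show ?thesis using finCyc C(1) by (intro prod_zero) auto
  qed
  have "lattice_sum k n N \<pi> \<sigma> = (\<Sum>(u, v)\<in>?c \<times> ?c. ?h u v)"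
    unfolding lattice_sum_def by (rule sum.cartesian_product)
  also have "\<dots> = (\<Sum>(u, v)\<in>?A. ?h u v)"
    using h0 A_sub finite_compositions by (intro sum.mono_neutral_right) auto
  also have "\<dots> = (\<Sum>w\<in>?B. lattice_weight N (\<lambda>x. label_val x (real n) (\<lambda>l. real (w l))))"
  proof (rule sum.reindex_bij_witness[of _
        "\<lambda>w. (\<lambda>i\<in>{1..k}. nat \<lfloor>label_val (Inl i) (real n) (\<lambda>l. real (w l))\<rfloor>, \<lambda>j\<in>{1..k}. nat \<lfloor>label_val (Inr j) (real n) (\<lambda>l. real (w l))\<rfloor>)"
        "\<lambda>(u, v). free_part u v"])
    fix p assume "p \<in> ?A"
    then obtain u v where p: "p = (u, v)" "u \<in> ?c" "v \<in> ?c" "?bal u v" by auto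
    have z: "label_val x (real n) (\<lambda>l. real (free_part u v l)) = real (case_sum u v x)" if "x \<in> Omega k" for x
      using label_val_free_part[OF c1(1)[OF p(2)] _ that] p(4) by blast
    have pos: "1 \<le> case_sum u v x \<and> case_sum u v x \<le> n" if "x \<in> Omega k" for x
    proof -
      have "1 \<le> f i \<and> f i \<le> n" if "f \<in> ?c" "i \<in> {1..k}" for f i
        using c1[OF that(1)] that(2) member_le_sum[of i "{1..k}" f] by auto
      then show ?thesis using that p(2,3) by (cases x) auto
    qed
    show "(case (case p of (u, v) \<Rightarrow> free_part u v) of w \<Rightarrow> (\<lambda>i\<in>{1..k}. nat \<lfloor>label_val (Inl i) (real n) (\<lambda>l. real (w l))\<rfloor>, \<lambda>j\<in>{1..k}. nat \<lfloor>label_val (Inr j) (real n) (\<lambda>l. real (w l))\<rfloor>)) = p"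
    proof -
      have "(\<lambda>i\<in>{1..k}. nat \<lfloor>label_val (Inl i) (real n) (\<lambda>l. real (free_part u v l))\<rfloor>) = u"
        by (rule extensionalityI[OF restrict_extensional c1(2)[OF p(2)]]) (simp add: z)
      moreover have "(\<lambda>j\<in>{1..k}. nat \<lfloor>label_val (Inr j) (real n) (\<lambda>l. real (free_part u v l))\<rfloor>) = v"
        by (rule extensionalityI[OF restrict_extensional c1(2)[OF p(3)]]) (simp add: z)
      ultimately show ?thesis unfolding p(1) by simp
    qed
    have "free_part u v \<in> L \<rightarrow>\<^sub>E {1..n}"
      unfolding free_part_def using pos L_sub by (intro restrict_PiE_iff[THEN iffD2]) fastforce
    then show "(case p of (u, v) \<Rightarrow> free_part u v) \<in> ?B"
      using z pos unfolding p(1) by fastforce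
    have "cycle_weight (real N) \<sigma> (\<lambda>i. real (u i)) (\<lambda>j. real (v j)) C =
       max 0 (real N - omega_cyc \<sigma> (\<lambda>i. label_val (Inl i) (real n) (\<lambda>l. real (free_part u v l))) (\<lambda>i. label_val (Inr i) (real n) (\<lambda>l. real (free_part u v l))) C)"
      if C: "C \<in> Cyc \<pi> \<sigma>" for C
    proof -
      have "(\<Sum>i\<in>cplus C. real (u i)) = (\<Sum>j\<in>cminus C. real (v j))" using p(4) C by (metis of_nat_sum)
      then have "D_partial \<sigma> (\<lambda>i. real (u i)) (\<lambda>j. real (v j)) (cycle_rep C) (card C) = 0"
        unfolding D_partial_total[OF C] by simp
      moreover have "omega_cyc \<sigma> (\<lambda>i. real (u i)) (\<lambda>j. real (v j)) C =
        omega_cyc \<sigma> (\<lambda>i. label_val (Inl i) (real n) (\<lambda>l. real (free_part u v l))) (\<lambda>i. label_val (Inr i) (real n) (\<lambda>l. real (free_part u v l))) C"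
        by (rule omega_cong[OF C]) (simp_all add: z)
      ultimately show ?thesis by (simp add: cycle_weight_def)
    qed
    then show "lattice_weight N (\<lambda>x. label_val x (real n) (\<lambda>l. real ((case p of (u, v) \<Rightarrow> free_part u v) l))) = (case p of (u, v) \<Rightarrow> ?h u v)"
      unfolding p(1) lattice_weight_def by simp
  next
    fix w assume w: "w \<in> ?B"
    let ?z = "\<lambda>x. label_val x (real n) (\<lambda>l. real (w l))"
    let ?u = "\<lambda>i\<in>{1..k}. nat \<lfloor>?z (Inl i)\<rfloor>" and ?v = "\<lambda>j\<in>{1..k}. nat \<lfloor>?z (Inr j)\<rfloor>"
    have zn: "real (nat \<lfloor>?z x\<rfloor>) = ?z x" "1 \<le> nat \<lfloor>?z x\<rfloor>" if x: "x \<in> Omega k" for x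
    proof -
      have "0 < ?z x" using w x by auto
      moreover obtain m where "?z x = of_int m" by (rule Ints_cases[OF label_val_int[OF x]])
      ultimately show "real (nat \<lfloor>?z x\<rfloor>) = ?z x" "1 \<le> nat \<lfloor>?z x\<rfloor>" by auto
    qed
    have zu: "?z (Inl i) = u_of k (real n) (\<lambda>l. real (w l)) i" "?z (Inr i) = v_of k (real n) \<pi> \<sigma> (\<lambda>l. real (w l)) i" for i by (auto simp: label_val_def)
    have ru: "real (?u i) = u_of k (real n) (\<lambda>l. real (w l)) i" "real (?v i) = v_of k (real n) \<pi> \<sigma> (\<lambda>l. real (w l)) i" if "i \<in> {1..k}" for i
      using zn(1)[of "Inl i"] zn(1)[of "Inr i"] that by (simp_all add: zu)
    have su: "(\<Sum>i=1..k. ?u i) = n"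
    proof -
      have "real (\<Sum>i=1..k. ?u i) = (\<Sum>i=1..k. u_of k (real n) (\<lambda>l. real (w l)) i)" unfolding of_nat_sum by (intro sum.cong refl ru)
      then show ?thesis unfolding sum_u_of by (simp only: of_nat_eq_iff)
    qed
    have bal: "(\<Sum>i\<in>cplus C. ?u i) = (\<Sum>j\<in>cminus C. ?v j)" if C: "C \<in> Cyc \<pi> \<sigma>" for C
    proof -
      have "real (\<Sum>i\<in>cplus C. ?u i) = (\<Sum>i\<in>cplus C. u_of k (real n) (\<lambda>l. real (w l)) i)"
        unfolding of_nat_sum using plus_sub[OF C] by (intro sum.cong refl ru) auto
      also have "\<dots> = (\<Sum>j\<in>cminus C. v_of k (real n) \<pi> \<sigma> (\<lambda>l. real (w l)) j)" by (rule balance[OF C, symmetric])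
      also have "\<dots> = real (\<Sum>j\<in>cminus C. ?v j)"
        unfolding of_nat_sum using minus_sub[OF C] by (intro sum.cong refl ru[symmetric]) auto
      finally show ?thesis by (simp only: of_nat_eq_iff)
    qed
    have sv: "(\<Sum>j=1..k. ?v j) = n"
      using sum_over_plus[of ?u] sum_over_minus[of ?v] bal su by simp
    have "?u \<in> ?c" "?v \<in> ?c"
      using su sv zn(2) unfolding compositions_def by (auto simp: restrict_PiE_iff)
    then show "(?u, ?v) \<in> ?A" using bal by blast
    show "(case (?u, ?v) of (u, v) \<Rightarrow> free_part u v) = w"
    proof -
      have "free_part ?u ?v = w"
      proof (rule extensionalityI[of _ L])
        show "free_part ?u ?v \<in> extensional L" by (simp add: free_part_def)
        show "w \<in> extensional L" using w by (auto simp: PiE_def)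
        fix x assume x: "x \<in> L"
        have "nat \<lfloor>?z x\<rfloor> = w x" using label_val_free[OF x] by simp
        moreover have "free_part ?u ?v x = nat \<lfloor>?z x\<rfloor>"
          using x L_sub by (cases x) (auto simp: free_part_def)
        ultimately show "free_part ?u ?v x = w x" by simp
      qed
      then show ?thesis by simp
    qed
  qed
  also have "\<dots> = (\<Sum>w\<in>L \<rightarrow>\<^sub>E {1..n}. if \<forall>x\<in>Omega k. 0 < label_val x (real n) (\<lambda>l. real (w l))
      then lattice_weight N (\<lambda>x. label_val x (real n) (\<lambda>l. real (w l))) else 0)"
    using finL by (intro sum.inter_filter) (auto intro: finite_PiE)
  finally show ?thesis .
qed

lemma lattice_sum_riemann:
  assumes N: "N > 0"
  shows "lattice_sum k n N \<pi> \<sigma> = real N ^ card (Cyc \<pi> \<sigma>) * (\<Sum>w\<in>L \<rightarrow>\<^sub>E {1..n}. R.sample n N w)"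
  unfolding lattice_sum_free sum_distrib_left
proof (rule sum.cong[OF refl])
  fix w
  have z: "label_val x (real n) (\<lambda>l. real (w l)) = real N * label_val x (real n / real N) (\<lambda>l. real (w l) / real N)" if "x \<in> Omega k" for x
    using label_val_scale[OF that, of "real N" "real n / real N" "\<lambda>l. real (w l) / real N"] N by simp
  then have "(\<forall>x\<in>Omega k. 0 < label_val x (real n) (\<lambda>l. real (w l))) \<longleftrightarrow> (\<forall>x\<in>Omega k. 0 < label_val x (real n / real N) (\<lambda>l. real (w l) / real N))"
    using N by (simp add: zero_less_mult_iff)
  then show "(if \<forall>x\<in>Omega k. 0 < label_val x (real n) (\<lambda>l. real (w l)) then lattice_weight N (\<lambda>x. label_val x (real n) (\<lambda>l. real (w l))) else 0)
     = real N ^ card (Cyc \<pi> \<sigma>) * R.sample n N w"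
    using lattice_weight_scale[OF N z] by (simp add: R.integrand_def)
qed

lemma lattice_sum_asymptotic:
  assumes N: "N > 0" and c: "0 < c" "c \<le> B" and small: "(1 + real (card L)) / real N < c"
  shows "\<bar>lattice_sum k (nat \<lfloor>c * real N\<rfloor>) N \<pi> \<sigma> - cycle_integral k c \<pi> \<sigma> * real N ^ (2 * k - 1)\<bar>
     \<le> R.approx_const B * real N ^ (2 * k - 2)"
proof -
  let ?s = "card (Cyc \<pi> \<sigma>)" and ?n = "nat \<lfloor>c * real N\<rfloor>"
  let ?S = "\<Sum>w\<in>L \<rightarrow>\<^sub>E {1..?n}. R.sample ?n N w"
  have e: "2 * k - 1 = ?s + card L" using card_L by simp
  have "?s > 0"
  proof -
    have "cyc_of (Inl 1) \<in> Cyc \<pi> \<sigma>" using k by (intro cyc_of_in) simp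
    then show ?thesis using finCyc card_gt_0_iff by blast
  qed
  then have e2: "real N ^ ?s * (real N ^ card L / real N) = real N ^ (2 * k - 2)"
  proof -
    have "?s + card L = Suc (2 * k - 2)" using e k by simp
    then have "real N ^ ?s * real N ^ card L = real N ^ Suc (2 * k - 2)"
      by (simp only: power_add[symmetric])
    then show ?thesis using N by simp
  qed
  have "lattice_sum k ?n N \<pi> \<sigma> - cycle_integral k c \<pi> \<sigma> * real N ^ (2 * k - 1)
     = real N ^ ?s * (?S - real N ^ card L * (LINT y|PiM L (\<lambda>_. lborel). R.integrand c y))"
    unfolding lattice_sum_riemann[OF N] cycle_integral_eq e by (simp add: power_add algebra_simps)
  then have "\<bar>lattice_sum k ?n N \<pi> \<sigma> - cycle_integral k c \<pi> \<sigma> * real N ^ (2 * k - 1)\<bar>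
     = real N ^ ?s * \<bar>?S - real N ^ card L * (LINT y|PiM L (\<lambda>_. lborel). R.integrand c y)\<bar>"
    by (simp add: abs_mult)
  also have "\<dots> \<le> real N ^ ?s * (R.approx_const B * real N ^ card L / real N)"
    by (intro mult_left_mono R.riemann_sum[OF N c small]) simp
  also have "\<dots> = R.approx_const B * real N ^ (2 * k - 2)"
    unfolding e2[symmetric] by simp
  finally show ?thesis .
qed

end

text \<open>A cycle with labels of one sign only has a nonzero total increment for positive variables.\<close>

lemma (in block_permutation) unbalanced_zero:
  assumes "\<exists>C\<in>Cyc \<pi> \<sigma>. plus_idx (\<Union>C) = {} \<or> minus_idx (\<Union>C) = {}"
  shows "lattice_sum k n N \<pi> \<sigma> = 0" "cycle_integral k c \<pi> \<sigma> = 0"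
proof -
  show "cycle_integral k c \<pi> \<sigma> = 0" using assms by (simp add: cycle_integral_def)
  obtain C where C: "C \<in> Cyc \<pi> \<sigma>" "cplus C = {} \<or> cminus C = {}" using assms by auto
  have ne: "cplus C \<noteq> {} \<or> cminus C \<noteq> {}"
  proof -
    have "cycle_rep C \<in> \<pi>" using cycle_rep_mem[OF C(1)] cycle_sub[OF C(1)] by auto
    then have "cycle_rep C \<noteq> {}" using partition_onD3[OF part] by metis
    then obtain x where "x \<in> \<Union>C" using cycle_rep_mem[OF C(1)] by auto
    then show ?thesis by (cases x) (auto simp: plus_idx_def minus_idx_def)
  qed
  have pos: "(\<Sum>i\<in>S. real (u i)) > 0" if "u \<in> compositions k n" "S \<subseteq> {1..k}" "S \<noteq> {}" for u S
  proof (rule sum_pos)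
    show "finite S" using that(2) finite_subset by blast
    show "0 < real (u i)" if "i \<in> S" for i
      using that \<open>u \<in> compositions k n\<close> \<open>S \<subseteq> {1..k}\<close> by (fastforce simp: compositions_def PiE_iff)
  qed (rule that(3))
  have "(\<Prod>C\<in>Cyc \<pi> \<sigma>. cycle_weight (real N) \<sigma> (\<lambda>i. real (u i)) (\<lambda>j. real (v j)) C) = 0"
    if uv: "u \<in> compositions k n" "v \<in> compositions k n" for u v
  proof -
    have "(\<Sum>i\<in>cplus C. real (u i)) - (\<Sum>j\<in>cminus C. real (v j)) \<noteq> 0"
    proof (cases "cplus C = {}")
      case True
      then have "0 < (\<Sum>j\<in>cminus C. real (v j))" using ne pos[OF uv(2) minus_sub[OF C(1)]] by blast
      then show ?thesis unfolding True by simp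
    next
      case False
      then have "cminus C = {}" and "0 < (\<Sum>i\<in>cplus C. real (u i))"
        using C(2) pos[OF uv(1) plus_sub[OF C(1)]] by blast+
      then show ?thesis by simp
    qed
    then have "cycle_weight (real N) \<sigma> (\<lambda>i. real (u i)) (\<lambda>j. real (v j)) C = 0"
      unfolding cycle_weight_def D_partial_total[OF C(1)] by simp
    then show ?thesis using finCyc C(1) by (intro prod_zero) auto
  qed
  then show "lattice_sum k n N \<pi> \<sigma> = 0" unfolding lattice_sum_def by simp
qed

section \<open>The scaling limit\<close>

lemma lattice_sum_bound:
  assumes k: "k \<ge> 1" and J: "(\<pi>, \<sigma>) \<in> J_set k" and c0: "0 < c0"
  shows "\<exists>A N0. \<forall>N\<ge>N0. \<forall>c\<in>{c0..B}.
     \<bar>lattice_sum k (nat \<lfloor>c * real N\<rfloor>) N \<pi> \<sigma> - cycle_integral k c \<pi> \<sigma> * real N ^ (2 * k - 1)\<bar> \<le> A * real N ^ (2 * k - 2)"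
proof -
  interpret block_permutation k \<pi> \<sigma> using k J by unfold_locales (auto simp: J_set_def)
  show ?thesis
  proof (cases "\<exists>C\<in>Cyc \<pi> \<sigma>. plus_idx (\<Union>C) = {} \<or> minus_idx (\<Union>C) = {}")
    case True
    then show ?thesis using unbalanced_zero[OF True] by (intro exI[of _ 0]) simp
  next
    case False
    interpret balanced_permutation k \<pi> \<sigma> using False by unfold_locales auto
    \<comment> \<open>From here on the rounding error is below \<open>c\<close>, so that a form equal to \<open>c\<close> keeps its sign.\<close>
    obtain N1 :: nat where N1: "(1 + real (card L)) / c0 < real N1" using reals_Archimedean2 by blast
    show ?thesis
    proof (intro exI[of _ "R.approx_const B"] exI[of _ N1] allI impI ballI)
      fix N c assume N: "N \<ge> N1" and c: "c \<in> {c0..B}"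
      have "0 < real N1" using N1 c0 by (smt (verit) divide_nonneg_pos of_nat_0_le_iff)
      then have N0: "N > 0" using N by simp
      have "(1 + real (card L)) / c0 < real N" using N1 N by simp
      then have "(1 + real (card L)) / real N < c0" using c0 N0 by (simp add: divide_less_eq mult.commute)
      then show "\<bar>lattice_sum k (nat \<lfloor>c * real N\<rfloor>) N \<pi> \<sigma> - cycle_integral k c \<pi> \<sigma> * real N ^ (2 * k - 1)\<bar>
         \<le> R.approx_const B * real N ^ (2 * k - 2)"
        using c c0 by (intro lattice_sum_asymptotic N0) auto
    qed
  qed
qed

lemma finite_J_set: "finite (J_set k)"
proof -
  have "J_set k = Sigma {\<pi>. partition_on (Omega k) \<pi>} (\<lambda>\<pi>. {\<sigma>. \<sigma> permutes \<pi>})" by (auto simp: J_set_def)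
  then show ?thesis
    using finitely_many_partition_on[OF finite_Omega] finite_elements[OF finite_Omega]
    by (auto intro!: finite_SigmaI finite_permutations)
qed

lemma I_int_bound:
  assumes k: "k \<ge> 1" and haar: "\<And>N. N \<ge> 1 \<Longrightarrow> haar_unitary N (\<mu> N)" and c0: "0 < c0"
  shows "\<exists>A N0. N0 \<ge> 1 \<and> (\<forall>N\<ge>N0. \<forall>c\<in>{c0..B}.
     \<bar>I_int \<mu> k (nat \<lfloor>c * real N\<rfloor>) N - (\<Sum>(\<pi>, \<sigma>)\<in>J_set k. of_int (sign \<sigma>) * cycle_integral k c \<pi> \<sigma>) * real N ^ (2 * k - 1)\<bar>
       \<le> A * real N ^ (2 * k - 2))"
proof -
  let ?e = "\<lambda>N c z. \<bar>lattice_sum k (nat \<lfloor>c * real N\<rfloor>) N (fst z) (snd z) - cycle_integral k c (fst z) (snd z) * real N ^ (2 * k - 1)\<bar>"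
  have "\<forall>z\<in>J_set k. \<exists>A N0. \<forall>N\<ge>N0. \<forall>c\<in>{c0..B}. ?e N c z \<le> A * real N ^ (2 * k - 2)"
    using lattice_sum_bound[OF k _ c0] by auto
  then obtain A N0 where AN: "\<And>z N c. z \<in> J_set k \<Longrightarrow> N \<ge> N0 z \<Longrightarrow> c \<in> {c0..B} \<Longrightarrow> ?e N c z \<le> A z * real N ^ (2 * k - 2)"
    by metis
  let ?A = "\<Sum>z\<in>J_set k. A z"
  let ?N = "1 + (\<Sum>z\<in>J_set k. N0 z)"
  show ?thesis
  proof (intro exI[of _ ?A] exI[of _ ?N] conjI allI impI ballI)
    fix N c assume N: "N \<ge> ?N" and c: "c \<in> {c0..B}"
    have N0: "N \<ge> N0 z" if "z \<in> J_set k" for z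
      using N member_le_sum[OF that, of N0] finite_J_set by simp
    let ?n = "nat \<lfloor>c * real N\<rfloor>"
    have "I_int \<mu> k ?n N - (\<Sum>(\<pi>, \<sigma>)\<in>J_set k. of_int (sign \<sigma>) * cycle_integral k c \<pi> \<sigma>) * real N ^ (2 * k - 1)
      = (\<Sum>z\<in>J_set k. of_int (sign (snd z)) * (lattice_sum k ?n N (fst z) (snd z) - cycle_integral k c (fst z) (snd z) * real N ^ (2 * k - 1)))"
      using I_int_exact[of N \<mu> k ?n] haar[of N] N
      by (simp add: case_prod_unfold sum_subtractf right_diff_distrib sum_distrib_right mult.assoc)
    also have "\<bar>\<dots>\<bar> \<le> (\<Sum>z\<in>J_set k. ?e N c z)"
    proof (rule order.trans[OF sum_abs], rule sum_mono)
      fix z :: "block set \<times> (block \<Rightarrow> block)"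
      have "\<bar>real_of_int (sign (snd z))\<bar> = 1" by (simp flip: of_int_abs)
      then show "\<bar>of_int (sign (snd z)) * (lattice_sum k ?n N (fst z) (snd z) - cycle_integral k c (fst z) (snd z) * real N ^ (2 * k - 1))\<bar> \<le> ?e N c z"
        by (simp add: abs_mult)
    qed
    also have "\<dots> \<le> (\<Sum>z\<in>J_set k. A z * real N ^ (2 * k - 2))"
      using AN N0 c by (intro sum_mono) auto
    finally show "\<bar>I_int \<mu> k ?n N - (\<Sum>(\<pi>, \<sigma>)\<in>J_set k. of_int (sign \<sigma>) * cycle_integral k c \<pi> \<sigma>) * real N ^ (2 * k - 1)\<bar>
       \<le> ?A * real N ^ (2 * k - 2)" by (simp add: sum_distrib_right)
  qed simp
qed

theorem theorem2p2:
  fixes k :: nat and \<mu> :: "nat \<Rightarrow> complex mat measure"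
  assumes k: "k \<ge> 1"
    and haar: "\<And>N. N \<ge> 1 \<Longrightarrow> haar_unitary N (\<mu> N)"
  shows "(\<forall>c>0. convergent (scaled_I \<mu> k c) \<and>
            delta_fun \<mu> k c = (\<Sum>(\<pi>, \<sigma>)\<in>J_set k. of_int (sign \<sigma>) * cycle_integral k c \<pi> \<sigma>)) \<and>
         (\<forall>K. compact K \<and> K \<subseteq> {0<..} \<longrightarrow>
            (\<exists>A N\<^sub>0. \<forall>N\<ge>N\<^sub>0. \<forall>c\<in>K.
               \<bar>I_int \<mu> k (nat \<lfloor>c * real N\<rfloor>) N - delta_fun \<mu> k c * real N ^ (2 * k - 1)\<bar>
                 \<le> A * real N ^ (2 * k - 2)))"
proof -
  let ?d = "\<lambda>c. \<Sum>(\<pi>, \<sigma>)\<in>J_set k. of_int (sign \<sigma>) * cycle_integral k c \<pi> \<sigma>"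
  have lim: "scaled_I \<mu> k c \<longlonglongrightarrow> ?d c" if c: "c > 0" for c
  proof -
    obtain A N0 where N0: "N0 \<ge> 1" and b: "\<And>N. N \<ge> N0 \<Longrightarrow>
      \<bar>I_int \<mu> k (nat \<lfloor>c * real N\<rfloor>) N - ?d c * real N ^ (2 * k - 1)\<bar> \<le> A * real N ^ (2 * k - 2)"
      using I_int_bound[OF k haar c, of c] by auto
    have "(\<lambda>N. scaled_I \<mu> k c N - ?d c) \<longlonglongrightarrow> 0"
    proof (rule Lim_null_comparison)
      show "\<forall>\<^sub>F N in sequentially. norm (scaled_I \<mu> k c N - ?d c) \<le> A / real N"
        using eventually_ge_at_top[of N0]
      proof eventually_elim
        case (elim N)
        then have N: "real N > 0" using N0 by simp
        have p: "real N ^ (2 * k - 1) = real N ^ (2 * k - 2) * real N"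
          using k by (simp flip: power_Suc2 add: Suc_diff_Suc numeral_2_eq_2)
        have "scaled_I \<mu> k c N - ?d c = (I_int \<mu> k (nat \<lfloor>c * real N\<rfloor>) N - ?d c * real N ^ (2 * k - 1)) / real N ^ (2 * k - 1)"
          using N by (simp add: scaled_I_def diff_divide_distrib)
        then have "norm (scaled_I \<mu> k c N - ?d c) = \<bar>I_int \<mu> k (nat \<lfloor>c * real N\<rfloor>) N - ?d c * real N ^ (2 * k - 1)\<bar> / real N ^ (2 * k - 1)"
          by (simp add: abs_divide)
        also have "\<dots> \<le> A * real N ^ (2 * k - 2) / real N ^ (2 * k - 1)"
          using b[OF elim] N by (intro divide_right_mono) auto
        also have "\<dots> = A / real N" using N unfolding p by simp
        finally show ?case .
      qed
      show "(\<lambda>N. A / real N) \<longlonglongrightarrow> 0" by (rule lim_const_over_n)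
    qed
    then show ?thesis by (simp add: LIM_zero_iff)
  qed
  have delta: "delta_fun \<mu> k c = ?d c" if "c > 0" for c
    unfolding delta_fun_def using lim[OF that] by (rule limI)
  show ?thesis
  proof (intro conjI allI impI)
    fix c :: real assume c: "c > 0"
    show "convergent (scaled_I \<mu> k c)" using lim[OF c] by (rule convergentI)
    show "delta_fun \<mu> k c = ?d c" by (rule delta[OF c])
  next
    fix K :: "real set" assume K: "compact K \<and> K \<subseteq> {0<..}"
    show "\<exists>A N\<^sub>0. \<forall>N\<ge>N\<^sub>0. \<forall>c\<in>K. \<bar>I_int \<mu> k (nat \<lfloor>c * real N\<rfloor>) N - delta_fun \<mu> k c * real N ^ (2 * k - 1)\<bar>
                 \<le> A * real N ^ (2 * k - 2)"
    proof (cases "K = {}")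
      case False
      obtain c0 where c0: "c0 \<in> K" "\<And>c. c \<in> K \<Longrightarrow> c0 \<le> c" using compact_attains_inf[of K] K False by auto
      obtain c1 where c1: "\<And>c. c \<in> K \<Longrightarrow> c \<le> c1" using compact_attains_sup[of K] K False by auto
      have "c0 > 0" using c0 K by auto
      from I_int_bound[OF k haar this, of c1] obtain A N0 where
        b: "\<And>N c. N \<ge> N0 \<Longrightarrow> c \<in> {c0..c1} \<Longrightarrow> \<bar>I_int \<mu> k (nat \<lfloor>c * real N\<rfloor>) N - ?d c * real N ^ (2 * k - 1)\<bar> \<le> A * real N ^ (2 * k - 2)"
        by blast
      show ?thesis
      proof (intro exI[of _ A] exI[of _ N0] allI impI ballI)
        fix N c assume "N \<ge> N0" "c \<in> K"
        then show "\<bar>I_int \<mu> k (nat \<lfloor>c * real N\<rfloor>) N - delta_fun \<mu> k c * real N ^ (2 * k - 1)\<bar> \<le> A * real N ^ (2 * k - 2)"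
          using b[of N c] c0 c1 delta[of c] K by auto
      qed
    qed simp
  qed
qed

end
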